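(* Let $\alpha$ be an ordinal, viewed as the linearly ordered structure $(\alpha,<)$. Then $\alpha$ is an injectively $\omega$-tree-automatic ordinal if and only if $\alpha<\omega^{\omega^{\omega}}$ (ordinal exponentiation).
   Context: Trees: for a finite alphabet $\Sigma$, $T_\Sigma^\omega$ denotes the set of infinite binary trees with nodes labelled in $\Sigma$, i.e. functions $t:\{l,r\}^\star\to\Sigma$, where $\{l,r\}^\star$ is the set of finite words over $\{l,r\}$ (the root is the empty word $\varepsilon$). A tuple $(t_1,\ldots,t_k)\in T_{\Sigma_1}^\omega\times\cdots\times T_{\Sigma_k}^\omega$ is identified with the tree $u\mapsto(t_1(u),\ldots,t_k(u))$ over the product alphabet $\Sigma_1\times\cdots\times\Sigma_k$, so a $k$-ary relation between trees is regarded as a tree language over the product alphabet. Muller tree automata: a (non-deterministic) Muller tree automaton is $\mathcal{A}=(Q,\Sigma,\Delta,q_0,\mathcal{F})$ with $Q$ a finite set of states, $q_0\in Q$, $\Delta\subseteq Q\times\Sigma\times Q\times Q$, and $\mathcal{F}\subseteq P(Q)$ (the powerset of $Q$). A run on $t\in T_\Sigma^\omega$ is a function $\rho:\{l,r\}^\star\to Q$ with $\rho(\varepsilon)=q_0$ and $(\rho(u),t(u),\rho(ul),\rho(ur))\in\Delta$ for every node $u$; it is accepting if along every infinite branch the set of states occurring infinitely often belongs to $\mathcal{F}$. $L(\mathcal{A})$ is the set of trees having an accepting run. Injectively $\omega$-tree-automatic: a relational structure $\mathcal{M}=(M,(R_i)_{1\le i\le k})$, with $R_i$ of finite arity $n_i$,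 is injectively $\omega$-tree-automatic if there are a finite alphabet $\Sigma$, a Muller tree automaton $\mathcal{A}$ over $\Sigma$, and Muller tree automata $\mathcal{A}_i$ over $\Sigma^{n_i}$ accepting $n_i$-ary relations $R_i'\subseteq L(\mathcal{A})^{n_i}$ ($1\le i\le k$), together with an isomorphism $h$ from $(L(\mathcal{A}),(R_i')_{1\le i\le k})$ onto $\mathcal{M}$. An ordinal $\alpha$ is called injectively $\omega$-tree-automatic if the structure $(\alpha,<)$ is. *)

theory Defs
  imports Main
begin

unbundle cardinal_syntax

section \<open>Trees and tuples of trees\<close>

datatype direction = Lft | Rgt

text \<open>Nodes are words over the two directions; the children of \<open>u\<close> are \<open>u @ [Lft]\<close> and
  \<open>u @ [Rgt]\<close>.\<close>

type_synonym node = "direction list"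
type_synonym 'a tree = "node \<Rightarrow> 'a"

definition trees :: "'a set \<Rightarrow> 'a tree set" where
  "trees \<Sigma> = {t. \<forall>u. t u \<in> \<Sigma>}"

definition tuples :: "nat \<Rightarrow> 'a set \<Rightarrow> 'a list set" where
  "tuples n A = {xs. length xs = n \<and> set xs \<subseteq> A}"

text \<open>The identification of a tuple of trees with a tree over the product alphabet.\<close>

definition convolution :: "'a tree list \<Rightarrow> 'a list tree" where
  "convolution ts = (\<lambda>u. map (\<lambda>t. t u) ts)"


section \<open>Muller tree automata\<close>

record ('q, 'a) muller =
  states :: "'q set"
  alphabet :: "'a set"
  transitions :: "('q \<times> 'a \<times> 'q \<times> 'q) set"
  initial :: 'q
  acceptance :: "'q set set"

definition muller_automaton :: "('q, 'a) muller \<Rightarrow> bool" where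
  "muller_automaton \<A> \<longleftrightarrow>
     finite (states \<A>) \<and> finite (alphabet \<A>) \<and>
     transitions \<A> \<subseteq> states \<A> \<times> alphabet \<A> \<times> states \<A> \<times> states \<A> \<and>
     initial \<A> \<in> states \<A> \<and>
     acceptance \<A> \<subseteq> Pow (states \<A>)"

definition is_run :: "('q, 'a) muller \<Rightarrow> 'a tree \<Rightarrow> 'q tree \<Rightarrow> bool" where
  "is_run \<A> t \<rho> \<longleftrightarrow>
     \<rho> \<in> trees (states \<A>) \<and> \<rho> [] = initial \<A> \<and>
     (\<forall>u. (\<rho> u, t u, \<rho> (u @ [Lft]), \<rho> (u @ [Rgt])) \<in> transitions \<A>)"

text \<open>An infinite branch is given by the sequence \<open>\<pi>\<close> of directions taken; its nodes are the
  finite prefixes of \<open>\<pi>\<close>.\<close>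

definition inf_states :: "'q tree \<Rightarrow> (nat \<Rightarrow> direction) \<Rightarrow> 'q set" where
  "inf_states \<rho> \<pi> = {q. infinite {n. \<rho> (map \<pi> [0..<n]) = q}}"

definition accepting :: "('q, 'a) muller \<Rightarrow> 'q tree \<Rightarrow> bool" where
  "accepting \<A> \<rho> \<longleftrightarrow> (\<forall>\<pi>. inf_states \<rho> \<pi> \<in> acceptance \<A>)"

definition lang :: "('q, 'a) muller \<Rightarrow> 'a tree set" where
  "lang \<A> = {t \<in> trees (alphabet \<A>). \<exists>\<rho>. is_run \<A> t \<rho> \<and> accepting \<A> \<rho>}"


section \<open>Relational structures and automatic presentations\<close>

text \<open>Each relation is listed together with its arity.\<close>

record 'm rel_structure =
  universe :: "'m set"
  rels :: "(nat \<times> 'm list set) list"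

definition wf_structure :: "'m rel_structure \<Rightarrow> bool" where
  "wf_structure M \<longleftrightarrow> (\<forall>(n, R) \<in> set (rels M). R \<subseteq> tuples n (universe M))"

definition structure_iso ::
  "('b \<Rightarrow> 'm) \<Rightarrow> 'b rel_structure \<Rightarrow> 'm rel_structure \<Rightarrow> bool" where
  "structure_iso h P M \<longleftrightarrow>
     bij_betw h (universe P) (universe M) \<and>
     list_all2 (\<lambda>(m, R') (n, R). m = n \<and> (\<forall>ts \<in> tuples n (universe P). ts \<in> R' \<longleftrightarrow> map h ts \<in> R))
       (rels P) (rels M)"

text \<open>Taking letters and states to be natural numbers is no restriction, since alphabets and
  state sets are finite.\<close>

definition inj_omega_tree_automatic :: "'m rel_structure \<Rightarrow> bool" where
  "inj_omega_tree_automatic M \<longleftrightarrow>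
     wf_structure M \<and>
     (\<exists>(\<A> :: (nat, nat) muller) P h.
        muller_automaton \<A> \<and>
        wf_structure P \<and> universe P = lang \<A> \<and>
        (\<forall>(n, R') \<in> set (rels P). \<exists>\<B> :: (nat, nat list) muller.
           muller_automaton \<B> \<and> alphabet \<B> = tuples n (alphabet \<A>) \<and>
           lang \<B> = convolution ` R') \<and>
        structure_iso h P M)"


section \<open>Ordinals\<close>

text \<open>As in the theories on well-orders in \<^theory>\<open>Main\<close>, an ordinal is represented by a reflexive
  well-order on its field, over an arbitrary type, and ordinals are compared by \<open><o\<close>.\<close>

definition ordinal_structure :: "'a rel \<Rightarrow> 'a rel_structure" where
  "ordinal_structure r = \<lparr>universe = Field r, rels = [(2, {[x, y] | x y. (x, y) \<in> r \<and> x \<noteq> y})]\<rparr>"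

definition inj_omega_tree_automatic_ordinal :: "'a rel \<Rightarrow> bool" where
  "inj_omega_tree_automatic_ordinal r \<longleftrightarrow> inj_omega_tree_automatic (ordinal_structure r)"

text \<open>Ordinal exponentiation \<open>r\<^sup>s\<close>, as in \<open>HOL-Cardinals.Ordinal_Arithmetic\<close>: the functions from
  \<open>s\<close> to \<open>r\<close> that take a nonzero value only finitely often, compared at the largest argument
  where they differ. Elements of \<open>Func\<close> are \<open>undefined\<close> outside the first set.\<close>

definition fin_funs :: "'a rel \<Rightarrow> 'b rel \<Rightarrow> ('b \<Rightarrow> 'a) set" where
  "fin_funs r s =
     {f \<in> Func (Field s) (Field r). finite {b \<in> Field s. f b \<noteq> wo_rel.minim r (Field r)}}"

definition oexp :: "'a rel \<Rightarrow> 'b rel \<Rightarrow> ('b \<Rightarrow> 'a) rel"  (infixr \<open>^o\<close> 90) where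
  "r ^o s =
     {(f, g). f \<in> fin_funs r s \<and> g \<in> fin_funs r s \<and>
        (f = g \<or>
         (\<exists>b \<in> Field s. f b \<noteq> g b \<and> (f b, g b) \<in> r \<and>
            (\<forall>c \<in> Field s. (b, c) \<in> s \<and> c \<noteq> b \<longrightarrow> f c = g c)))}"

abbreviation omega :: "nat rel"  (\<open>\<omega>\<close>) where
  "\<omega> \<equiv> natLeq"

end

theory Submission
  imports Defs "HOL-Library.Multiset_Order" "HOL-Library.Ramsey"
begin

text \<open>
  Ordinals below \<open>\<omega>\<^sup>\<omega>\<^sup>\<omega>\<close> are written in Cantor normal form, with the exponents, which are below
  \<open>\<omega>\<^sup>\<omega>\<close>, written in Cantor normal form again. Such a normal form is a finite multiset of finite
  multisets of natural numbers; the multiset order is the order of the ordinals, and the union of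
  multisets is the natural sum.

  \<^bold>\<open>Automatic ordinals are small.\<close> Let automata recognize a set \<open>L\<close> of trees and a well-order on
  it. The key is that the trees of \<open>L\<close> have only finitely many different ends
  (\<open>finitely_many_ends\<close>): there is a finite set \<open>Z\<close> such that for every tree of \<open>L\<close> there is a
  depth at which all its subtrees are in \<open>Z\<close>. A tree with a distinguished node at which another tree is to be plugged
  in is a context, and the runs of the automata assign to it a type from a finite semigroup. By
  Ramsey's theorem, every branch has a node at which the subtree is a product \<open>c\<^sub>1 c\<^sub>2 c\<^sub>3 \<dots>\<close> of contexts
  of one idempotent type \<open>e\<close>, and \<open>e\<close> determines this subtree: otherwise there are two contexts
  \<open>c\<close>, \<open>d\<close> of type \<open>e\<close> that disagree at some node. Prepending a context of type \<open>e\<close> never makes a tree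
  smaller, because it would then do so below any number of copies of this context, and give
  an infinite descent. But \<open>r = (c d)\<^sup>\<omega>\<close> and \<open>r' = (d c)\<^sup>\<omega>\<close> satisfy \<open>r = c r'\<close> and \<open>r' = d r\<close>, so they
  would have to be equal (\<open>prepend_not_less\<close>, \<open>factors_unique\<close>).

  Fix \<open>x\<close> in \<open>L\<close> and a depth \<open>n\<close> at which all subtrees of \<open>x\<close> are in \<open>Z\<close>. The trees below \<open>x\<close> fall
  into finitely many classes according to their labels above depth \<open>n\<close> and to what the automata see
  of their subtrees at depth \<open>n\<close>. Each class is a product of orders, one for each node of depth \<open>n\<close>,
  taken from a finite family that does not depend on \<open>x\<close>, and its order extends the componentwise
  order (\<open>class_box\<close>). The type of such an order is bounded by the natural product of bounds
  for the factors (\<open>embeds_box\<close>), and the ordinals below \<open>\<omega>\<close> to the power of \<open>\<omega>\<^sup>k\<close> are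
  closed under natural sums and products. So if the trees below \<open>x\<close> form this
  ordinal, then some member of the family has at least this type, and certainly less than the one for
  \<open>k + 1\<close>. If \<open>\<omega>\<^sup>\<omega>\<^sup>\<omega>\<close> were an initial segment of \<open>L\<close>, all \<open>k \<ge> 1\<close> would occur, and the family would be
  infinite (\<open>no_cofinal_segments\<close>).

  \<^bold>\<open>Small ordinals are automatic.\<close> The nodes with at most \<open>k\<close> steps to the left, in depth-first
  order, have type \<open>\<omega>\<^sup>k\<^sup>+\<^sup>1\<close>. Finite sets of such nodes, viewed as trees labelled with \<open>0\<close> and \<open>1\<close> and
  compared at the last node where they differ, are therefore ordered like \<open>\<omega>\<close> to the power of
  \<open>\<omega>\<^sup>k\<close>. An automaton can guess the last difference. To get
  a smaller ordinal one restricts to the trees below a fixed tree, which has only finitely many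
  different subtrees and can therefore be built into the states.
\<close>

section \<open>Branches of the binary tree\<close>

definition branch_prefix :: "(nat \<Rightarrow> direction) \<Rightarrow> nat \<Rightarrow> node" where
  "branch_prefix \<pi> n = map \<pi> [0..<n]"

lemma length_branch_prefix [simp]: "length (branch_prefix \<pi> n) = n"
  by (simp add: branch_prefix_def)

lemma branch_prefix_0 [simp]: "branch_prefix \<pi> 0 = []"
  by (simp add: branch_prefix_def)

lemma branch_prefix_Suc: "branch_prefix \<pi> (Suc n) = branch_prefix \<pi> n @ [\<pi> n]"
  by (simp add: branch_prefix_def)

lemma branch_prefix_Suc_Cons: "branch_prefix \<pi> (Suc n) = \<pi> 0 # branch_prefix (\<lambda>i. \<pi> (Suc i)) n"
  unfolding branch_prefix_def map_upt_Suc ..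

lemma branch_prefix_add:
  "branch_prefix \<pi> (m + n) = branch_prefix \<pi> m @ branch_prefix (\<lambda>i. \<pi> (m + i)) n"
  by (induction n) (simp_all add: branch_prefix_Suc)

lemma branch_through: "\<exists>\<pi>'. (\<forall>n. branch_prefix \<pi>' (length u + n) = u @ branch_prefix \<pi> n) \<and>
    (\<lambda>i. \<pi>' (length u + i)) = \<pi>"
proof -
  define \<pi>' where "\<pi>' i = (if i < length u then u ! i else \<pi> (i - length u))" for i
  have "branch_prefix \<pi>' (length u) = u"
    by (rule nth_equalityI) (simp_all add: branch_prefix_def \<pi>'_def)
  moreover have "(\<lambda>i. \<pi>' (length u + i)) = \<pi>"
    by (simp add: \<pi>'_def)
  ultimately show ?thesis by (intro exI[of _ \<pi>']) (simp add: branch_prefix_add)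
qed

lemma dependent_branch:
  assumes "P []" and "\<And>u. P u \<Longrightarrow> \<exists>d. P (u @ [d])"
  shows "\<exists>\<pi>. \<forall>n. P (branch_prefix \<pi> n)"
proof -
  define next_dir where "next_dir u = (SOME d. P (u @ [d]))" for u
  define U where "U = rec_nat [] (\<lambda>_ u. u @ [next_dir u])"
  have U: "U 0 = []" "U (Suc n) = U n @ [next_dir (U n)]" for n
    by (simp_all add: U_def)
  have "P (u @ [next_dir u])" if "P u" for u
    unfolding next_dir_def using assms(2)[OF that] by (rule someI_ex)
  then have P: "P (U n)" for n
    by (induction n) (simp_all add: U assms(1))
  have "branch_prefix (\<lambda>n. next_dir (U n)) n = U n" for n
    by (induction n) (simp_all add: U branch_prefix_Suc)
  with P show ?thesis by metis
qed

text \<open>Koenig's lemma: a node with arbitrarily long extensions in \<open>P\<close> has a child with this property.\<close>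

lemma konig:
  assumes long: "\<And>n. \<exists>v. length v = n \<and> P v" and prefix: "\<And>u v. P (u @ v) \<Longrightarrow> P u"
  shows "\<exists>\<pi>. \<forall>n. P (branch_prefix \<pi> n)"
proof -
  define Q where "Q u \<longleftrightarrow> (\<forall>n. \<exists>v. length v = n \<and> P (u @ v))" for u
  have step: "\<exists>d. Q (u @ [d])" if "Q u" for u
  proof (rule ccontr)
    assume "\<not> ?thesis"
    then obtain N where N: "\<And>d v. length v = N d \<Longrightarrow> \<not> P (u @ [d] @ v)"
      unfolding Q_def by simp metis
    obtain v where v: "length v = Suc (N Lft + N Rgt)" "P (u @ v)"
      using \<open>Q u\<close> unfolding Q_def by blast
    then obtain d v' where v': "v = d # v'" by (cases v) auto
    have "N d \<le> length v'" using v v' by (cases d) auto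
    then have "length (take (N d) v') = N d" by simp
    moreover have "P (u @ [d] @ take (N d) v')"
      using v v' prefix[of "u @ [d] @ take (N d) v'" "drop (N d) v'"] by simp
    ultimately show False using N by blast
  qed
  have "Q []" using long by (simp add: Q_def)
  from dependent_branch[of Q, OF this step] obtain \<pi> where "\<And>n. Q (branch_prefix \<pi> n)" by blast
  then have "P (branch_prefix \<pi> n)" for n
    unfolding Q_def by (metis append_Nil2 length_0_conv)
  then show ?thesis by blast
qed

lemma finite_directions: "finite (UNIV :: direction set)"
  by (rule finite_subset[of _ "{Lft, Rgt}"]) (use direction.exhaust in auto)

fun other :: "direction \<Rightarrow> direction" where
  "other Lft = Rgt" | "other Rgt = Lft"

lemma neq_other: "d \<noteq> d' \<longleftrightarrow> d = other d'"
  by (cases d; cases d') auto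

section \<open>Runs from an arbitrary state\<close>

definition subtree :: "'a tree \<Rightarrow> node \<Rightarrow> 'a tree" where
  "subtree t u = (\<lambda>v. t (u @ v))"

lemma subtree_Nil [simp]: "subtree t [] = t"
  by (simp add: subtree_def)

lemma subtree_subtree [simp]: "subtree (subtree t u) v = subtree t (u @ v)"
  by (simp add: subtree_def)

lemma subtree_apply: "subtree t u v = t (u @ v)"
  by (simp add: subtree_def)

definition accepting_run_from :: "('q, 'a) muller \<Rightarrow> 'q \<Rightarrow> 'a tree \<Rightarrow> 'q tree \<Rightarrow> bool" where
  "accepting_run_from M p t \<rho> \<longleftrightarrow> \<rho> [] = p \<and>
     (\<forall>u. (\<rho> u, t u, \<rho> (u @ [Lft]), \<rho> (u @ [Rgt])) \<in> transitions M) \<and> accepting M \<rho>"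

definition accepts_from :: "('q, 'a) muller \<Rightarrow> 'q \<Rightarrow> 'a tree \<Rightarrow> bool" where
  "accepts_from M p t \<longleftrightarrow> (\<exists>\<rho>. accepting_run_from M p t \<rho>)"

lemma lang_iff_accepts_from:
  assumes "muller_automaton M"
  shows "t \<in> lang M \<longleftrightarrow> accepts_from M (initial M) t"
proof -
  have tr: "transitions M \<subseteq> states M \<times> alphabet M \<times> states M \<times> states M"
    using assms by (simp add: muller_automaton_def)
  show ?thesis
    unfolding lang_def accepts_from_def accepting_run_from_def is_run_def trees_def
    using tr by (auto 4 4)
qed

definition inf_often :: "(nat \<Rightarrow> 'q) \<Rightarrow> 'q set" where
  "inf_often \<sigma> = {q. infinite {n. \<sigma> n = q}}"

lemma inf_states_eq: "inf_states \<rho> \<pi> = inf_often (\<lambda>n. \<rho> (branch_prefix \<pi> n))"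
  by (simp add: inf_states_def inf_often_def branch_prefix_def)

lemma infinite_shift_iff: "infinite {n. P (n + k)} \<longleftrightarrow> infinite {n::nat. P n}"
proof -
  have "(\<exists>\<^sub>\<infinity>n. P (n + k)) \<longleftrightarrow> (\<exists>\<^sub>\<infinity>n. P n)"
    unfolding INFM_nat_le
  proof safe
    fix m assume "\<forall>m. \<exists>n\<ge>m. P (n + k)" then show "\<exists>n\<ge>m. P n"
      by (meson le_add1 le_trans)
  next
    fix m assume "\<forall>m. \<exists>n\<ge>m. P n" 
    then obtain n where "n \<ge> m + k" "P n" by blast
    then show "\<exists>n\<ge>m. P (n + k)" by (intro exI[of _ "n - k"]) auto
  qed
  then show ?thesis by (simp add: frequently_cofinite)
qed

lemma inf_often_shift: "inf_often (\<lambda>n. \<sigma> (n + k)) = inf_often \<sigma>"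
  unfolding inf_often_def by (intro Collect_cong infinite_shift_iff)

lemma inf_states_Cons: "inf_states \<rho> \<pi> = inf_states (subtree \<rho> [\<pi> 0]) (\<lambda>i. \<pi> (Suc i))"
proof -
  have "inf_often (\<lambda>n. \<rho> (branch_prefix \<pi> (n + 1))) = inf_often (\<lambda>n. \<rho> (branch_prefix \<pi> n))"
    by (rule inf_often_shift)
  then show ?thesis
    by (simp add: inf_states_eq branch_prefix_Suc_Cons subtree_def)
qed

lemma inf_states_subtree:
  "inf_states \<rho> \<pi> = inf_states (subtree \<rho> (branch_prefix \<pi> n)) (\<lambda>i. \<pi> (n + i))"
proof (induction n)
  case (Suc n)
  then show ?case
    by (subst (asm) (2) inf_states_Cons) (simp add: branch_prefix_Suc)
qed simp

lemma accepting_run_from_subtree: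
  assumes "accepting_run_from M p t \<rho>"
  shows "accepting_run_from M (\<rho> u) (subtree t u) (subtree \<rho> u)"
proof -
  have "inf_states (subtree \<rho> u) \<pi> \<in> acceptance M" for \<pi>
  proof -
    obtain \<pi>' where "\<And>n. branch_prefix \<pi>' (length u + n) = u @ branch_prefix \<pi> n"
      and "(\<lambda>i. \<pi>' (length u + i)) = \<pi>"
      using branch_through by blast
    moreover from this(1)[of 0] have "branch_prefix \<pi>' (length u) = u" by simp
    ultimately have "inf_states \<rho> \<pi>' = inf_states (subtree \<rho> u) \<pi>"
      using inf_states_subtree[of \<rho> \<pi>' "length u"] by simp
    then show ?thesis
      using assms by (metis accepting_run_from_def accepting_def)
  qed
  moreover have "(\<rho> (u @ v), t (u @ v), \<rho> (u @ v @ [Lft]), \<rho> (u @ v @ [Rgt])) \<in> transitions M" for v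
    using assms unfolding accepting_run_from_def by (metis append_assoc)
  ultimately show ?thesis
    by (simp add: accepting_run_from_def subtree_def accepting_def)
qed

text \<open>One step of a run along a branch. The child that the branch does not enter is settled by some
  accepting run, so only the state on the branch remains visible.\<close>

definition edge :: "('q, 'a) muller \<Rightarrow> 'a tree \<Rightarrow> direction \<Rightarrow> 'q \<Rightarrow> 'q \<Rightarrow> bool" where
  "edge M t d p q \<longleftrightarrow> (\<exists>p'. (case d of Lft \<Rightarrow> (p, t [], q, p') \<in> transitions M
                                   | Rgt \<Rightarrow> (p, t [], p', q) \<in> transitions M) \<and>
                            accepts_from M p' (subtree t [other d]))"

text \<open>The state at the node \<open>u\<close> below the \<open>n\<close>-th node of the branch \<open>\<pi>\<close>, for a run with states \<open>\<sigma>\<close>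
  along \<open>\<pi>\<close> that continues with \<open>R m\<close> in the subtree entered by leaving \<open>\<pi>\<close> at its \<open>m\<close>-th node.\<close>

primrec glued_run :: "(nat \<Rightarrow> direction) \<Rightarrow> (nat \<Rightarrow> 'q) \<Rightarrow> (nat \<Rightarrow> 'q tree) \<Rightarrow> node \<Rightarrow> nat \<Rightarrow> 'q" where
  "glued_run \<pi> \<sigma> R [] = (\<lambda>n. \<sigma> n)"
| "glued_run \<pi> \<sigma> R (d # u) = (\<lambda>n. if d = \<pi> n then glued_run \<pi> \<sigma> R u (Suc n) else R n u)"

text \<open>Every branch other than \<open>\<pi>\<close> ends up in a subtree that hangs off \<open>\<pi>\<close>, where the acceptance
  condition is met by the run chosen there; only \<open>\<pi>\<close> itself constrains the states \<open>\<sigma>\<close>.\<close>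

lemma accepts_from_iff_path:
  "accepts_from M p t \<longleftrightarrow>
     (\<exists>\<sigma>. \<sigma> 0 = p \<and> (\<forall>n. edge M (subtree t (branch_prefix \<pi> n)) (\<pi> n) (\<sigma> n) (\<sigma> (Suc n))) \<and>
          inf_often \<sigma> \<in> acceptance M)" (is "?lhs \<longleftrightarrow> ?rhs")
proof
  assume ?lhs
  then obtain \<rho> where \<rho>: "accepting_run_from M p t \<rho>" unfolding accepts_from_def by blast
  define \<sigma> where "\<sigma> n = \<rho> (branch_prefix \<pi> n)" for n
  have acc: "accepts_from M (\<rho> u) (subtree t u)" for u
    using accepting_run_from_subtree[OF \<rho>] unfolding accepts_from_def by blast
  have "edge M (subtree t (branch_prefix \<pi> n)) (\<pi> n) (\<sigma> n) (\<sigma> (Suc n))" for n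
  proof -
    have "(\<rho> u, t u, \<rho> (u @ [Lft]), \<rho> (u @ [Rgt])) \<in> transitions M" for u
      using \<rho> by (simp add: accepting_run_from_def)
    then show ?thesis unfolding edge_def \<sigma>_def branch_prefix_Suc
      by (intro exI[of _ "\<rho> (branch_prefix \<pi> n @ [other (\<pi> n)])"])
        (cases "\<pi> n"; simp add: acc subtree_apply)
  qed
  moreover have "\<sigma> 0 = p" "inf_often \<sigma> \<in> acceptance M"
    using \<rho> by (simp_all add: \<sigma>_def[abs_def] accepting_run_from_def accepting_def flip: inf_states_eq)
  ultimately show ?rhs by blast
next
  assume ?rhs
  then obtain \<sigma> where \<sigma>: "\<sigma> 0 = p" "inf_often \<sigma> \<in> acceptance M"
    and ed: "\<And>n. edge M (subtree t (branch_prefix \<pi> n)) (\<pi> n) (\<sigma> n) (\<sigma> (Suc n))" by blast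
  have "\<forall>n. \<exists>R. (case \<pi> n of Lft \<Rightarrow> (\<sigma> n, t (branch_prefix \<pi> n), \<sigma> (Suc n), R []) \<in> transitions M
                      | Rgt \<Rightarrow> (\<sigma> n, t (branch_prefix \<pi> n), R [], \<sigma> (Suc n)) \<in> transitions M) \<and>
              accepting_run_from M (R []) (subtree t (branch_prefix \<pi> n @ [other (\<pi> n)])) R"
  proof
    fix n
    show "\<exists>R. (case \<pi> n of Lft \<Rightarrow> (\<sigma> n, t (branch_prefix \<pi> n), \<sigma> (Suc n), R []) \<in> transitions M
                      | Rgt \<Rightarrow> (\<sigma> n, t (branch_prefix \<pi> n), R [], \<sigma> (Suc n)) \<in> transitions M) \<and>
              accepting_run_from M (R []) (subtree t (branch_prefix \<pi> n @ [other (\<pi> n)])) R"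
      using ed[of n] unfolding edge_def accepts_from_def
      by (auto simp: accepting_run_from_def subtree_apply split: direction.splits) metis+
  qed
  then obtain R where
    R1: "\<And>n. case \<pi> n of Lft \<Rightarrow> (\<sigma> n, t (branch_prefix \<pi> n), \<sigma> (Suc n), R n []) \<in> transitions M
                      | Rgt \<Rightarrow> (\<sigma> n, t (branch_prefix \<pi> n), R n [], \<sigma> (Suc n)) \<in> transitions M" and
    R2: "\<And>n. accepting_run_from M (R n []) (subtree t (branch_prefix \<pi> n @ [other (\<pi> n)])) (R n)"
    by metis
  define G where "G = glued_run \<pi> \<sigma> R"
  have G: "G [] n = \<sigma> n" "G (d # u) n = (if d = \<pi> n then G u (Suc n) else R n u)" for n d u
    by (simp_all add: G_def)
  have tr: "(G u n, t (branch_prefix \<pi> n @ u), G (u @ [Lft]) n, G (u @ [Rgt]) n) \<in> transitions M" for u n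
  proof (induction u arbitrary: n)
    case Nil
    show ?case using R1[of n] by (cases "\<pi> n") (simp_all add: G)
  next
    case (Cons d u)
    show ?case
    proof (cases "d = \<pi> n")
      case True
      then show ?thesis using Cons[of "Suc n"] by (simp add: G branch_prefix_Suc)
    next
      case False
      then have "d = other (\<pi> n)" by (simp add: neq_other)
      with False show ?thesis using R2[of n] by (simp add: G accepting_run_from_def subtree_def)
    qed
  qed
  have onpath: "G (branch_prefix \<pi> n @ u) 0 = G u n" for n u
    by (induction n arbitrary: u) (simp_all add: G branch_prefix_Suc)
  have "inf_states (\<lambda>u. G u 0) \<tau> \<in> acceptance M" for \<tau>
  proof (cases "\<tau> = \<pi>")
    case True
    have "(\<lambda>n. G (branch_prefix \<pi> n) 0) = \<sigma>"
      using onpath[where u = "[]"] by (simp add: G)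
    with True \<sigma> show ?thesis by (simp add: inf_states_eq)
  next
    case False
    define n where "n = (LEAST n. \<tau> n \<noteq> \<pi> n)"
    have n: "\<tau> n \<noteq> \<pi> n" unfolding n_def by (rule LeastI_ex) (use False in blast)
    have "\<tau> i = \<pi> i" if "i < n" for i using not_less_Least[of i] that n_def by blast
    then have eq: "branch_prefix \<tau> n = branch_prefix \<pi> n" by (simp add: branch_prefix_def)
    have "subtree (\<lambda>u. G u 0) (branch_prefix \<tau> (Suc n)) = R n"
      using n by (simp add: fun_eq_iff subtree_def branch_prefix_Suc eq onpath G)
    then have "inf_states (\<lambda>u. G u 0) \<tau> = inf_states (R n) (\<lambda>i. \<tau> (Suc n + i))"
      using inf_states_subtree[of "\<lambda>u. G u 0" \<tau> "Suc n"] by simp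
    then show ?thesis using R2[of n] by (simp add: accepting_run_from_def accepting_def)
  qed
  then have "accepting_run_from M p t (\<lambda>u. G u 0)"
    using tr[of _ 0] \<sigma> by (simp add: accepting_run_from_def accepting_def G)
  then show ?lhs unfolding accepts_from_def by blast
qed

lemma accepts_from_edge:
  "accepts_from M p t \<longleftrightarrow> (\<exists>q. edge M t d p q \<and> accepts_from M q (subtree t [d]))"
proof
  assume "accepts_from M p t"
  then obtain \<rho> where \<rho>: "accepting_run_from M p t \<rho>" unfolding accepts_from_def by blast
  have acc: "accepts_from M (\<rho> u) (subtree t u)" for u
    using accepting_run_from_subtree[OF \<rho>] unfolding accepts_from_def by blast
  have "(\<rho> [], t [], \<rho> [Lft], \<rho> [Rgt]) \<in> transitions M"
    using \<rho> unfolding accepting_run_from_def by (metis append_Nil)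
  then have "edge M t d p (\<rho> [d])"
    using \<rho> unfolding edge_def accepting_run_from_def
    by (intro exI[of _ "\<rho> [other d]"]) (cases d; simp add: acc)
  with acc show "\<exists>q. edge M t d p q \<and> accepts_from M q (subtree t [d])" by blast
next
  assume "\<exists>q. edge M t d p q \<and> accepts_from M q (subtree t [d])"
  then obtain q where q: "edge M t d p q" "accepts_from M q (subtree t [d])" by blast
  define \<pi> where "\<pi> = (\<lambda>n::nat. d)"
  obtain \<sigma> where \<sigma>: "\<sigma> 0 = q" "inf_often \<sigma> \<in> acceptance M"
    and ed: "\<And>n. edge M (subtree (subtree t [d]) (branch_prefix \<pi> n)) (\<pi> n) (\<sigma> n) (\<sigma> (Suc n))"
    using q(2) unfolding accepts_from_iff_path[where \<pi> = \<pi>] by blast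
  define \<sigma>' where "\<sigma>' n = (case n of 0 \<Rightarrow> p | Suc m \<Rightarrow> \<sigma> m)" for n
  have "edge M (subtree t (branch_prefix \<pi> n)) (\<pi> n) (\<sigma>' n) (\<sigma>' (Suc n))" for n
  proof (cases n)
    case 0 then show ?thesis using q(1) \<sigma> by (simp add: \<sigma>'_def \<pi>_def)
  next
    case (Suc m)
    then show ?thesis using ed[of m] by (simp add: \<sigma>'_def branch_prefix_Suc_Cons) (simp add: \<pi>_def)
  qed
  moreover have "inf_often \<sigma>' = inf_often \<sigma>"
    using inf_often_shift[of \<sigma>' 1] by (simp add: \<sigma>'_def)
  ultimately show "accepts_from M p t"
    unfolding accepts_from_iff_path[where \<pi> = \<pi>] using \<sigma> by (intro exI[of _ \<sigma>']) (simp add: \<sigma>'_def)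
qed

lemma accepts_from_children:
  "accepts_from M p t \<longleftrightarrow> (\<exists>q q'. (p, t [], q, q') \<in> transitions M \<and>
     accepts_from M q (subtree t [Lft]) \<and> accepts_from M q' (subtree t [Rgt]))"
  unfolding accepts_from_edge[of M p t Lft] edge_def by auto

section \<open>Types of contexts\<close>

text \<open>The pair of \<open>s\<close> and \<open>h\<close> serves as a context, the tree \<open>s\<close> with a hole at the node \<open>h\<close>; what \<open>s\<close>
  contains at and below \<open>h\<close> is ignored.\<close>

definition plug :: "'a tree \<Rightarrow> node \<Rightarrow> 'a tree \<Rightarrow> 'a tree" where
  "plug s h r = (\<lambda>u. if take (length h) u = h then r (drop (length h) u) else s u)"

lemma plug_Nil [simp]: "plug s [] r = r"
  by (simp add: plug_def)

lemma subtree_plug [simp]: "subtree (plug s h r) h = r"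
  by (simp add: plug_def subtree_def)

lemma plug_subtree: "plug t u (subtree t u) = t"
  by (auto simp: plug_def subtree_def fun_eq_iff) (metis append_take_drop_id)

lemma subtree_plug_Cons: "subtree (plug s (d # h) r) [d] = plug (subtree s [d]) h r"
  by (simp add: plug_def subtree_def fun_eq_iff)

lemma subtree_plug_other: "subtree (plug s (d # h) r) [other d] = subtree s [other d]"
  using neq_other[of "other d" d] by (simp add: plug_def subtree_def)

lemma plug_Cons_root: "plug s (d # h) r [] = s []"
  by (simp add: plug_def)

lemma plug_plug: "plug s h (plug s' h' r) = plug (plug s h s') (h @ h') r"
proof
  fix u
  show "plug s h (plug s' h' r) u = plug (plug s h s') (h @ h') r u"
  proof (cases "take (length h) u = h")
    case True
    then have u: "u = h @ drop (length h) u" by (metis append_take_drop_id)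
    show ?thesis by (subst (1 2) u) (simp add: plug_def add.commute)
  next
    case False
    then have "take (length (h @ h')) u \<noteq> h @ h'"
      by (metis append_eq_conv_conj append_take_drop_id append_assoc)
    with False show ?thesis by (simp add: plug_def)
  qed
qed

text \<open>The triple \<open>(p, V, q)\<close> says that a run which is accepting on all subtrees hanging off the path \<open>w\<close>
  can lead from \<open>p\<close> at the root to \<open>q\<close> at the node \<open>w\<close>, with \<open>V\<close> the set of states visited before
  that node.\<close>

primrec segment_type ::
  "('q, 'a) muller \<Rightarrow> node \<Rightarrow> 'a tree \<Rightarrow> ('q \<times> 'q set \<times> 'q) set" where
  "segment_type M [] t = {(p, {}, p) | p. True}"
| "segment_type M (d # w) t =
     {(p, insert p V, q) | p V q. \<exists>p'. edge M t d p p' \<and> (p', V, q) \<in> segment_type M w (subtree t [d])}"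

definition compose_types ::
  "('q \<times> 'q set \<times> 'q) set \<Rightarrow> ('q \<times> 'q set \<times> 'q) set \<Rightarrow> ('q \<times> 'q set \<times> 'q) set" where
  "compose_types T T' = {(p, V \<union> V', q) | p V V' q. \<exists>m. (p, V, m) \<in> T \<and> (m, V', q) \<in> T'}"

lemma mem_compose_types:
  "(p, W, q) \<in> compose_types T T' \<longleftrightarrow>
     (\<exists>V m V'. (p, V, m) \<in> T \<and> (m, V', q) \<in> T' \<and> W = V \<union> V')"
  unfolding compose_types_def by blast

lemma compose_types_assoc:
  "compose_types (compose_types T T') T'' = compose_types T (compose_types T' T'')"
proof -
  have "(p, W, q) \<in> compose_types (compose_types T T') T'' \<longleftrightarrow>
        (p, W, q) \<in> compose_types T (compose_types T' T'')" for p W q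
  proof
    assume "(p, W, q) \<in> compose_types (compose_types T T') T''"
    then obtain V1 m V2 n V3 where "(p, V1, m) \<in> T" "(m, V2, n) \<in> T'" "(n, V3, q) \<in> T''"
      "W = V1 \<union> (V2 \<union> V3)"
      unfolding mem_compose_types Un_assoc[symmetric] by blast
    then show "(p, W, q) \<in> compose_types T (compose_types T' T'')"
      unfolding mem_compose_types by blast
  next
    assume "(p, W, q) \<in> compose_types T (compose_types T' T'')"
    then obtain V1 m V2 n V3 where "(p, V1, m) \<in> T" "(m, V2, n) \<in> T'" "(n, V3, q) \<in> T''"
      "W = (V1 \<union> V2) \<union> V3"
      unfolding mem_compose_types Un_assoc by blast
    then show "(p, W, q) \<in> compose_types (compose_types T T') T''"
      unfolding mem_compose_types by blast
  qed
  then show ?thesis by auto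
qed

lemma mem_segment_type_Cons:
  "(p, W, q) \<in> segment_type M (d # w) t \<longleftrightarrow>
     (\<exists>V p'. W = insert p V \<and> edge M t d p p' \<and> (p', V, q) \<in> segment_type M w (subtree t [d]))"
  by auto

lemma segment_type_append:
  "segment_type M (w @ w') t = compose_types (segment_type M w t) (segment_type M w' (subtree t w))"
proof (induction w arbitrary: t)
  case Nil
  show ?case by (auto simp: compose_types_def)
next
  case (Cons d w)
  have "(p, W, q) \<in> segment_type M ((d # w) @ w') t \<longleftrightarrow>
        (p, W, q) \<in> compose_types (segment_type M (d # w) t) (segment_type M w' (subtree t (d # w)))" for p W q
  proof
    assume "(p, W, q) \<in> segment_type M ((d # w) @ w') t"
    then obtain V p' m V' where "W = insert p V \<union> V'" "edge M t d p p'"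
      "(p', V, m) \<in> segment_type M w (subtree t [d])" "(m, V', q) \<in> segment_type M w' (subtree t (d # w))"
      unfolding append_Cons mem_segment_type_Cons Cons mem_compose_types by auto
    then show "(p, W, q) \<in> compose_types (segment_type M (d # w) t) (segment_type M w' (subtree t (d # w)))"
      unfolding mem_compose_types mem_segment_type_Cons by blast
  next
    assume "(p, W, q) \<in> compose_types (segment_type M (d # w) t) (segment_type M w' (subtree t (d # w)))"
    then obtain V p' m V' where "W = insert p (V \<union> V')" "edge M t d p p'"
      "(p', V, m) \<in> segment_type M w (subtree t [d])" "(m, V', q) \<in> segment_type M w' (subtree t (d # w))"
      unfolding mem_segment_type_Cons mem_compose_types by auto
    then show "(p, W, q) \<in> segment_type M ((d # w) @ w') t"
      unfolding append_Cons mem_segment_type_Cons Cons mem_compose_types subtree_subtree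
      by (intro exI[of _ "V \<union> V'"] exI[of _ p'] conjI exI[of _ V] exI[of _ m] exI[of _ V'] refl) simp_all
  qed
  then show ?case unfolding set_eq_iff split_paired_All by blast
qed

lemma edge_plug: "edge M (plug s (d # h) r) d p q = edge M s d p q"
  unfolding edge_def plug_Cons_root subtree_plug_other ..

lemma segment_type_plug [simp]: "segment_type M h (plug s h r) = segment_type M h s"
  by (induction h arbitrary: s) (simp_all add: edge_plug subtree_plug_Cons)

lemma accepts_from_segment:
  "accepts_from M p t \<longleftrightarrow> (\<exists>V q. (p, V, q) \<in> segment_type M w t \<and> accepts_from M q (subtree t w))"
proof (induction w arbitrary: p t)
  case (Cons d w)
  show ?case
  proof
    assume "accepts_from M p t"
    then obtain p' where "edge M t d p p'" "accepts_from M p' (subtree t [d])"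
      unfolding accepts_from_edge[of M p t d] by blast
    moreover from this(2) obtain V q where "(p', V, q) \<in> segment_type M w (subtree t [d])"
      "accepts_from M q (subtree t (d # w))"
      using Cons[of p' "subtree t [d]"] by auto
    ultimately show "\<exists>V q. (p, V, q) \<in> segment_type M (d # w) t \<and> accepts_from M q (subtree t (d # w))"
      unfolding mem_segment_type_Cons by blast
  next
    assume "\<exists>V q. (p, V, q) \<in> segment_type M (d # w) t \<and> accepts_from M q (subtree t (d # w))"
    then obtain p' V q where "edge M t d p p'" "(p', V, q) \<in> segment_type M w (subtree t [d])"
      "accepts_from M q (subtree t (d # w))"
      unfolding mem_segment_type_Cons by blast
    then show "accepts_from M p t"
      unfolding accepts_from_edge[of M p t d] Cons[of _ "subtree t [d]"] by auto
  qed
qed simp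

lemma accepts_from_plug:
  "accepts_from M p (plug s h r) \<longleftrightarrow> (\<exists>V q. (p, V, q) \<in> segment_type M h s \<and> accepts_from M q r)"
  using accepts_from_segment[of M p "plug s h r" h] by simp

lemma segment_type_subset:
  assumes "muller_automaton M" "w \<noteq> []"
  shows "segment_type M w t \<subseteq> states M \<times> Pow (states M) \<times> states M"
proof -
  have tr: "transitions M \<subseteq> states M \<times> alphabet M \<times> states M \<times> states M"
    using assms by (simp add: muller_automaton_def)
  have edge: "p \<in> states M \<and> q \<in> states M" if "edge M t d p q" for t d p q
    using that tr unfolding edge_def by (cases d) auto
  have sub: "V \<subseteq> states M \<and> (p \<in> states M \<longrightarrow> q \<in> states M)"
    if "(p, V, q) \<in> segment_type M w t" for p V q w t
    using that
  proof (induction w arbitrary: t p V)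
    case (Cons d w)
    then obtain V' p' where "V = insert p V'" "edge M t d p p'" "(p', V', q) \<in> segment_type M w (subtree t [d])"
      unfolding mem_segment_type_Cons by blast
    with Cons.IH[of p' V'] edge show ?case by blast
  qed simp
  show ?thesis
  proof
    fix x assume "x \<in> segment_type M w t"
    moreover obtain p V q where "x = (p, V, q)" by (cases x)
    moreover obtain d w' where "w = d # w'" using assms(2) by (cases w) auto
    ultimately show "x \<in> states M \<times> Pow (states M) \<times> states M"
      using sub[of p V q w t] edge by (auto simp del: segment_type.simps simp: mem_segment_type_Cons)
  qed
qed

lemma segment_type_iff_path:
  "(p, V, q) \<in> segment_type M w t \<longleftrightarrow>
     (\<exists>\<tau>. \<tau> 0 = p \<and> \<tau> (length w) = q \<and> V = \<tau> ` {..<length w} \<and>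
          (\<forall>j<length w. edge M (subtree t (take j w)) (w ! j) (\<tau> j) (\<tau> (Suc j))))"
proof (induction w arbitrary: p V t)
  case Nil
  show ?case by (auto intro: exI[of _ "\<lambda>_. p"])
next
  case (Cons d w)
  show ?case (is "?L \<longleftrightarrow> ?R")
  proof
    assume ?L
    then obtain p' V' where V: "V = insert p V'" and e: "edge M t d p p'"
      and "(p', V', q) \<in> segment_type M w (subtree t [d])" by auto
    then obtain \<tau> where \<tau>: "\<tau> 0 = p'" "\<tau> (length w) = q" "V' = \<tau> ` {..<length w}"
      "\<And>j. j < length w \<Longrightarrow> edge M (subtree (subtree t [d]) (take j w)) (w ! j) (\<tau> j) (\<tau> (Suc j))"
      unfolding Cons by blast
    define \<tau>' where "\<tau>' n = (case n of 0 \<Rightarrow> p | Suc m \<Rightarrow> \<tau> m)" for n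
    have "V = \<tau>' ` {..<length (d # w)}"
      unfolding V \<tau> list.size(4) add_Suc_right add_0_right lessThan_Suc_eq_insert_0
      by (simp add: \<tau>'_def image_image)
    moreover have "edge M (subtree t (take j (d # w))) ((d # w) ! j) (\<tau>' j) (\<tau>' (Suc j))"
      if "j < length (d # w)" for j
      using that e \<tau>(1) \<tau>(4)[of "j - 1"] by (cases j) (simp_all add: \<tau>'_def)
    ultimately show ?R
      using \<tau> by (intro exI[of _ \<tau>']) (simp add: \<tau>'_def)
  next
    assume ?R
    then obtain \<tau> where \<tau>: "\<tau> 0 = p" "\<tau> (length (d # w)) = q" "V = \<tau> ` {..<length (d # w)}"
      "\<And>j. j < length (d # w) \<Longrightarrow> edge M (subtree t (take j (d # w))) ((d # w) ! j) (\<tau> j) (\<tau> (Suc j))"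
      by blast
    have "(\<tau> 1, (\<lambda>j. \<tau> (Suc j)) ` {..<length w}, q) \<in> segment_type M w (subtree t [d])"
      unfolding Cons
      by (intro exI[of _ "\<lambda>j. \<tau> (Suc j)"]) (use \<tau>(2) \<tau>(4)[of "Suc _"] in auto)
    moreover have "edge M t d p (\<tau> 1)" using \<tau>(1) \<tau>(4)[of 0] by simp
    moreover have "V = insert p ((\<lambda>j. \<tau> (Suc j)) ` {..<length w})"
      unfolding \<tau>(3) list.size(4) add_Suc_right add_0_right lessThan_Suc_eq_insert_0
      by (simp add: \<tau>(1) image_image)
    ultimately show ?L by auto
  qed
qed

subsection \<open>Infinite products of contexts\<close>

definition branch_segment :: "(nat \<Rightarrow> direction) \<Rightarrow> nat \<Rightarrow> nat \<Rightarrow> node" where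
  "branch_segment \<pi> a b = branch_prefix (\<lambda>i. \<pi> (a + i)) (b - a)"

lemma branch_prefix_segment: "a \<le> b \<Longrightarrow> branch_prefix \<pi> b = branch_prefix \<pi> a @ branch_segment \<pi> a b"
  using branch_prefix_add[of \<pi> a "b - a"] by (simp add: branch_segment_def)

lemma take_branch_segment:
  "j \<le> b - a \<Longrightarrow> take j (branch_segment \<pi> a b) = branch_segment \<pi> a (a + j)"
  by (simp add: branch_segment_def branch_prefix_def take_map take_upt)

lemma nth_branch_segment: "j < b - a \<Longrightarrow> branch_segment \<pi> a b ! j = \<pi> (a + j)"
  by (simp add: branch_segment_def branch_prefix_def)

lemma length_branch_segment [simp]: "length (branch_segment \<pi> a b) = b - a"
  by (simp add: branch_segment_def)

definition block_index :: "(nat \<Rightarrow> nat) \<Rightarrow> nat \<Rightarrow> nat" where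
  "block_index m n = (THE i. m i \<le> n \<and> n < m (Suc i))"

lemma block_index_eqI:
  assumes "strict_mono m" "m i \<le> n" "n < m (Suc i)"
  shows "block_index m n = i"
  unfolding block_index_def
proof (rule the_equality)
  fix j assume j: "m j \<le> n \<and> n < m (Suc j)"
  then have "m j < m (Suc i)" "m i < m (Suc j)" using assms by linarith+
  then show "j = i" using assms(1) by (simp add: strict_mono_less)
qed (use assms in simp)

lemma block_index:
  assumes "strict_mono m" "m 0 = (0::nat)"
  shows "m (block_index m n) \<le> n" "n < m (Suc (block_index m n))"
proof -
  have "\<exists>i. m i \<le> n \<and> n < m (Suc i)"
  proof (induction n)
    case 0
    then show ?case using assms by (metis le_refl lessI strict_monoD)
  next
    case (Suc n)
    then obtain i where i: "m i \<le> n" "n < m (Suc i)" by blast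
    show ?case
    proof (cases "Suc n < m (Suc i)")
      case True
      with i show ?thesis by (intro exI[of _ i]) simp
    next
      case False
      with i have "Suc n = m (Suc i)" by simp
      then show ?thesis using assms by (metis le_refl lessI strict_monoD)
    qed
  qed
  then obtain i where i: "m i \<le> n" "n < m (Suc i)" by blast
  with block_index_eqI[OF assms(1) this]
  show "m (block_index m n) \<le> n" "n < m (Suc (block_index m n))" by simp_all
qed

text \<open>Blocks are finite, so a state recurs in \<open>\<sigma>\<close> just in case infinitely many blocks contain it.\<close>

lemma inf_often_blocks:
  assumes m: "strict_mono m" "m 0 = 0"
  shows "inf_often \<sigma> = {q. infinite {i. q \<in> \<sigma> ` {m i..<m (Suc i)}}}"
proof -
  have "finite {n. \<sigma> n = q} \<longleftrightarrow> finite {i. q \<in> \<sigma> ` {m i..<m (Suc i)}}" for q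
  proof
    assume "finite {n. \<sigma> n = q}"
    moreover have "{i. q \<in> \<sigma> ` {m i..<m (Suc i)}} \<subseteq> block_index m ` {n. \<sigma> n = q}"
    proof
      fix i assume "i \<in> {i. q \<in> \<sigma> ` {m i..<m (Suc i)}}"
      then obtain n where "m i \<le> n" "n < m (Suc i)" "\<sigma> n = q" by auto
      then show "i \<in> block_index m ` {n. \<sigma> n = q}"
        using block_index_eqI[OF m(1)] by blast
    qed
    ultimately show "finite {i. q \<in> \<sigma> ` {m i..<m (Suc i)}}" by (rule finite_surj)
  next
    assume fin: "finite {i. q \<in> \<sigma> ` {m i..<m (Suc i)}}"
    have "{n. \<sigma> n = q} \<subseteq> (\<Union>i\<in>{i. q \<in> \<sigma> ` {m i..<m (Suc i)}}. {m i..<m (Suc i)})"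
    proof
      fix n assume "n \<in> {n. \<sigma> n = q}"
      then show "n \<in> (\<Union>i\<in>{i. q \<in> \<sigma> ` {m i..<m (Suc i)}}. {m i..<m (Suc i)})"
        using block_index[OF m, of n] by (auto intro!: exI[of _ "block_index m n"])
    qed
    then show "finite {n. \<sigma> n = q}" by (rule finite_subset) (use fin in blast)
  qed
  then show ?thesis by (simp add: inf_often_def)
qed

text \<open>Acceptance of an infinite product of contexts depends only on the sequence of their types, as the
  pieces of an accepting path through the first product can be exchanged for pieces with the same
  end points and the same visited states.\<close>

lemma accepts_from_product_cong:
  assumes m: "strict_mono m" "m 0 = 0" and m': "strict_mono m'" "m' 0 = 0"
    and types: "\<And>i. segment_type M (branch_segment \<pi> (m i) (m (Suc i))) (subtree s (branch_prefix \<pi> (m i))) =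
       segment_type M (branch_segment \<pi>' (m' i) (m' (Suc i))) (subtree s' (branch_prefix \<pi>' (m' i)))"
    and acc: "accepts_from M p s"
  shows "accepts_from M p s'"
proof -
  obtain \<sigma> where \<sigma>: "\<sigma> 0 = p" "inf_often \<sigma> \<in> acceptance M"
    and ed: "\<And>n. edge M (subtree s (branch_prefix \<pi> n)) (\<pi> n) (\<sigma> n) (\<sigma> (Suc n))"
    using acc unfolding accepts_from_iff_path[where \<pi> = \<pi>] by blast
  have less: "m i < m (Suc i)" "m' i < m' (Suc i)" for i
    using m m' by (simp_all add: strict_mono_less)
  define V where "V i = \<sigma> ` {m i..<m (Suc i)}" for i
  have "(\<sigma> (m i), V i, \<sigma> (m (Suc i))) \<in>
      segment_type M (branch_segment \<pi> (m i) (m (Suc i))) (subtree s (branch_prefix \<pi> (m i)))" for i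
    unfolding segment_type_iff_path
  proof (intro exI[of _ "\<lambda>j. \<sigma> (m i + j)"] conjI allI impI)
    have "{m i..<m (Suc i)} = (\<lambda>j. m i + j) ` {..<m (Suc i) - m i}"
      using less(1)[of i] by (simp add: lessThan_atLeast0 image_add_atLeastLessThan)
    then show "V i = (\<lambda>j. \<sigma> (m i + j)) ` {..<length (branch_segment \<pi> (m i) (m (Suc i)))}"
      by (simp add: V_def image_image)
  next
    fix j assume j: "j < length (branch_segment \<pi> (m i) (m (Suc i)))"
    then show "edge M (subtree (subtree s (branch_prefix \<pi> (m i))) (take j (branch_segment \<pi> (m i) (m (Suc i)))))
        (branch_segment \<pi> (m i) (m (Suc i)) ! j) (\<sigma> (m i + j)) (\<sigma> (m i + Suc j))"
      using ed[of "m i + j"]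
      by (simp add: take_branch_segment nth_branch_segment flip: branch_prefix_segment)
  qed (use less(1)[of i] in simp_all)
  then have "\<forall>i. \<exists>\<tau>. \<tau> 0 = \<sigma> (m i) \<and> \<tau> (m' (Suc i) - m' i) = \<sigma> (m (Suc i)) \<and>
      V i = \<tau> ` {..<m' (Suc i) - m' i} \<and>
      (\<forall>j<m' (Suc i) - m' i. edge M (subtree s' (branch_prefix \<pi>' (m' i + j))) (\<pi>' (m' i + j)) (\<tau> j) (\<tau> (Suc j)))"
    unfolding types segment_type_iff_path
    by (simp add: take_branch_segment nth_branch_segment cong: conj_cong flip: branch_prefix_segment)
  then obtain \<tau> where \<tau>: "\<And>i. \<tau> i 0 = \<sigma> (m i)" "\<And>i. \<tau> i (m' (Suc i) - m' i) = \<sigma> (m (Suc i))"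
    "\<And>i. V i = \<tau> i ` {..<m' (Suc i) - m' i}"
    "\<And>i j. j < m' (Suc i) - m' i \<Longrightarrow>
       edge M (subtree s' (branch_prefix \<pi>' (m' i + j))) (\<pi>' (m' i + j)) (\<tau> i j) (\<tau> i (Suc j))"
    by metis
  define \<sigma>' where "\<sigma>' n = \<tau> (block_index m' n) (n - m' (block_index m' n))" for n
  have \<sigma>'_le: "\<sigma>' n = \<tau> i (n - m' i)" if "m' i \<le> n" "n \<le> m' (Suc i)" for i n
  proof (cases "n < m' (Suc i)")
    case True
    then show ?thesis using that block_index_eqI[OF m'(1)] by (simp add: \<sigma>'_def)
  next
    case False
    then have n: "n = m' (Suc i)" using that by simp
    then have "block_index m' n = Suc i"
      using block_index_eqI[OF m'(1), of "Suc i" n] less(2)[of "Suc i"] by simp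
    then show ?thesis using n \<tau>(1,2) by (simp add: \<sigma>'_def)
  qed
  have "edge M (subtree s' (branch_prefix \<pi>' n)) (\<pi>' n) (\<sigma>' n) (\<sigma>' (Suc n))" for n
  proof -
    define i where "i = block_index m' n"
    have i: "m' i \<le> n" "n < m' (Suc i)" unfolding i_def by (rule block_index[OF m'])+
    then show ?thesis
      using \<tau>(4)[of "n - m' i" i] \<sigma>'_le[of i n] \<sigma>'_le[of i "Suc n"] by (simp add: Suc_diff_le)
  qed
  moreover have "\<sigma>' 0 = p"
    using \<sigma>'_le[of 0 0] m' m \<sigma> \<tau>(1)[of 0] by simp
  moreover have "\<sigma>' ` {m' i..<m' (Suc i)} = V i" for i
  proof -
    have "{m' i..<m' (Suc i)} = (\<lambda>j. m' i + j) ` {..<m' (Suc i) - m' i}"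
      using less(2)[of i] by (simp add: lessThan_atLeast0 image_add_atLeastLessThan)
    then have "\<sigma>' ` {m' i..<m' (Suc i)} = (\<lambda>j. \<sigma>' (m' i + j)) ` {..<m' (Suc i) - m' i}"
      by (simp add: image_image)
    also have "\<dots> = V i"
    proof -
      have "\<sigma>' (m' i + j) = \<tau> i j" if "j < m' (Suc i) - m' i" for j
        using that \<sigma>'_le[of i "m' i + j"] by simp
      then show ?thesis unfolding \<tau>(3) by (intro image_cong) simp_all
    qed
    finally show ?thesis .
  qed
  then have "inf_often \<sigma>' = inf_often \<sigma>"
    unfolding inf_often_blocks[OF m, of \<sigma>] inf_often_blocks[OF m', of \<sigma>'] by (simp add: V_def)
  ultimately show ?thesis
    unfolding accepts_from_iff_path[where \<pi> = \<pi>'] using \<sigma> by (intro exI[of _ \<sigma>']) simp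
qed

text \<open>The infinite power \<open>c\<^sup>\<omega>\<close> of the context \<open>c\<close> given by \<open>x\<close> and the hole \<open>w\<close>.\<close>

function context_power :: "'a tree \<Rightarrow> node \<Rightarrow> 'a tree" where
  "context_power x w u =
     (if w \<noteq> [] \<and> take (length w) u = w then context_power x w (drop (length w) u) else x u)"
  by auto
termination
proof (relation "Wellfounded.measure (\<lambda>(x, w, u). length u)", simp)
  fix w u :: node assume "w \<noteq> [] \<and> take (length w) u = w"
  then have "0 < length w" "length w \<le> length u"
    by (auto simp: min_def split: if_splits dest!: arg_cong[of _ _ length])
  then have "length u - length w < length u" by linarith
  then show "((x, w, drop (length w) u), (x, w, u)) \<in> Wellfounded.measure (\<lambda>(x, w, u). length u)" for x :: "'a tree"
    by simp
qed

declare context_power.simps [simp del]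

lemma plug_context_power: "w \<noteq> [] \<Longrightarrow> plug x w (context_power x w) = context_power x w"
  unfolding fun_eq_iff plug_def by (simp add: context_power.simps[of x w])

section \<open>Recognizable well-orders of trees\<close>

definition pair_tree :: "'a tree \<Rightarrow> 'a tree \<Rightarrow> 'a list tree" where
  "pair_tree x y = convolution [x, y]"

lemma subtree_pair_tree [simp]: "subtree (pair_tree x y) u = pair_tree (subtree x u) (subtree y u)"
  by (simp add: pair_tree_def convolution_def subtree_def)

lemma plug_pair_tree: "pair_tree (plug s h y) (plug s' h y') = plug (pair_tree s s') h (pair_tree y y')"
  by (simp add: pair_tree_def convolution_def plug_def fun_eq_iff)

locale recognizable_wellorder =
  fixes A :: "('q, 'a) muller" and B :: "('p, 'a list) muller"
  assumes muller_A: "muller_automaton A" and muller_B: "muller_automaton B"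
  fixes less :: "'a tree \<Rightarrow> 'a tree \<Rightarrow> bool"
  assumes less_iff: "\<And>x y. less x y \<longleftrightarrow> pair_tree x y \<in> lang B"
    and irrefl: "\<And>x. x \<in> lang A \<Longrightarrow> \<not> less x x"
    and trans: "\<And>x y z. x \<in> lang A \<Longrightarrow> y \<in> lang A \<Longrightarrow> z \<in> lang A \<Longrightarrow> less x y \<Longrightarrow> less y z \<Longrightarrow> less x z"
    and total: "\<And>x y. x \<in> lang A \<Longrightarrow> y \<in> lang A \<Longrightarrow> x \<noteq> y \<Longrightarrow> less x y \<or> less y x"
    and no_descent: "\<And>f. (\<And>n::nat. f n \<in> lang A) \<Longrightarrow> \<not> (\<forall>n. less (f (Suc n)) (f n))"
begin

lemma mem_A: "x \<in> lang A \<longleftrightarrow> accepts_from A (initial A) x"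
  by (rule lang_iff_accepts_from[OF muller_A])

lemma less_B: "less x y \<longleftrightarrow> accepts_from B (initial B) (pair_tree x y)"
  unfolding less_iff by (rule lang_iff_accepts_from[OF muller_B])

text \<open>The order automaton reads the context on the diagonal: in a pair of trees that arise from one
  context by plugging in different trees, both components show the same context.\<close>

definition ctx_type :: "node \<Rightarrow> 'a tree \<Rightarrow> ('q \<times> 'q set \<times> 'q) set \<times> ('p \<times> 'p set \<times> 'p) set" where
  "ctx_type w s = (segment_type A w s, segment_type B w (pair_tree s s))"

definition compose where
  "compose e e' = (compose_types (fst e) (fst e'), compose_types (snd e) (snd e'))"

lemma compose_assoc: "compose (compose e e') e'' = compose e (compose e' e'')"
  by (simp add: compose_def compose_types_assoc)

lemma ctx_type_append: "ctx_type (w @ w') s = compose (ctx_type w s) (ctx_type w' (subtree s w))"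
  by (simp add: ctx_type_def compose_def segment_type_append)

lemma ctx_type_plug [simp]: "ctx_type h (plug s h r) = ctx_type h s"
  by (simp add: ctx_type_def plug_pair_tree)

definition ctx_types where
  "ctx_types = Pow (states A \<times> Pow (states A) \<times> states A) \<times> Pow (states B \<times> Pow (states B) \<times> states B)"

lemma finite_ctx_types: "finite ctx_types"
  using muller_A muller_B by (simp add: ctx_types_def muller_automaton_def)

lemma ctx_type_in_ctx_types: "w \<noteq> [] \<Longrightarrow> ctx_type w s \<in> ctx_types"
  using segment_type_subset[OF muller_A] segment_type_subset[OF muller_B] by (simp add: ctx_type_def ctx_types_def)

text \<open>The tree \<open>s\<close> is an infinite product of contexts of type \<open>e\<close> along some branch.\<close>

definition factors :: "_ \<Rightarrow> 'a tree \<Rightarrow> bool" where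
  "factors e s \<longleftrightarrow> (\<exists>\<pi> m. strict_mono m \<and> m 0 = (0::nat) \<and>
     (\<forall>i. ctx_type (branch_segment \<pi> (m i) (m (Suc i))) (subtree s (branch_prefix \<pi> (m i))) = e))"

lemma factors_long_prefix:
  assumes "factors e s" "compose e e = e"
  shows "\<exists>h. length h > n \<and> ctx_type h s = e"
proof -
  obtain \<pi> m where m: "strict_mono m" "m 0 = (0::nat)"
    and e: "\<And>i. ctx_type (branch_segment \<pi> (m i) (m (Suc i))) (subtree s (branch_prefix \<pi> (m i))) = e"
    using assms(1) unfolding factors_def by blast
  have "ctx_type (branch_prefix \<pi> (m (Suc i))) s = e" for i
  proof (induction i)
    case 0
    show ?case using e[of 0] by (simp add: m branch_segment_def)
  next
    case (Suc i)
    have "m (Suc i) \<le> m (Suc (Suc i))" using m by (simp add: strict_mono_less_eq)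
    then show ?case
      using Suc e[of "Suc i"] assms(2) by (simp add: branch_prefix_segment ctx_type_append)
  qed
  moreover have "m (Suc n) \<ge> Suc n" using m(1) by (rule strict_mono_imp_increasing)
  ultimately show ?thesis
    by (intro exI[of _ "branch_prefix \<pi> (m (Suc n))"]) simp
qed

lemma factors_context_power:
  assumes "w \<noteq> []" "ctx_type w x = e"
  shows "factors e (context_power x w)"
proof -
  define \<pi> where "\<pi> n = w ! (n mod length w)" for n
  have seg: "branch_segment \<pi> (i * length w) (Suc i * length w) = w" for i
    by (rule nth_equalityI) (simp_all add: nth_branch_segment \<pi>_def)
  have sub: "subtree (context_power x w) w = context_power x w"
    using subtree_plug[of x w "context_power x w"] assms by (simp add: plug_context_power)
  have sub': "subtree (context_power x w) (branch_prefix \<pi> (i * length w)) = context_power x w" for i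
  proof (induction i)
    case (Suc i)
    have "branch_prefix \<pi> (Suc i * length w) = branch_prefix \<pi> (i * length w) @ w"
      using branch_prefix_segment[of "i * length w" "Suc i * length w" \<pi>] unfolding seg by simp
    then have "subtree (context_power x w) (branch_prefix \<pi> (Suc i * length w)) =
      subtree (subtree (context_power x w) (branch_prefix \<pi> (i * length w))) w" by simp
    with Suc sub show ?case by (simp only:)
  qed simp
  have "ctx_type w (context_power x w) = e"
    using ctx_type_plug[of w x "context_power x w"] assms by (simp add: plug_context_power)
  then have "ctx_type (branch_segment \<pi> (i * length w) (Suc i * length w))
       (subtree (context_power x w) (branch_prefix \<pi> (i * length w))) = e" for i
    unfolding seg sub' .
  moreover have "strict_mono (\<lambda>i. i * length w)" using assms by (simp add: strict_mono_def)
  ultimately show ?thesis unfolding factors_def by (intro exI[of _ \<pi>] exI[of _ "\<lambda>i. i * length w"]) simp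
qed

lemma accepts_from_factors:
  assumes "factors e s" "factors e s'" "accepts_from A q s"
  shows "accepts_from A q s'"
proof -
  obtain \<pi> m where m: "strict_mono m" "m 0 = (0::nat)"
    and e: "\<And>i. ctx_type (branch_segment \<pi> (m i) (m (Suc i))) (subtree s (branch_prefix \<pi> (m i))) = e"
    using assms(1) unfolding factors_def by blast
  obtain \<pi>' m' where m': "strict_mono m'" "m' 0 = (0::nat)"
    and e': "\<And>i. ctx_type (branch_segment \<pi>' (m' i) (m' (Suc i))) (subtree s' (branch_prefix \<pi>' (m' i))) = e"
    using assms(2) unfolding factors_def by blast
  show ?thesis
  proof (rule accepts_from_product_cong[OF m m' _ assms(3)])
    fix i
    show "segment_type A (branch_segment \<pi> (m i) (m (Suc i))) (subtree s (branch_prefix \<pi> (m i))) =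
      segment_type A (branch_segment \<pi>' (m' i) (m' (Suc i))) (subtree s' (branch_prefix \<pi>' (m' i)))"
      using e[of i] e'[of i] unfolding ctx_type_def by (metis fst_conv)
  qed
qed

primrec iterate_context :: "'a tree \<Rightarrow> node \<Rightarrow> nat \<Rightarrow> 'a tree \<Rightarrow> 'a tree" where
  "iterate_context c h 0 y = y"
| "iterate_context c h (Suc n) y = plug c h (iterate_context c h n y)"

lemma iterate_context_plug: "iterate_context c h n (plug c h y) = plug c h (iterate_context c h n y)"
  by (induction n) simp_all

lemma iterate_context_as_plug:
  assumes "compose e e = e" "ctx_type h c = e"
  shows "\<exists>c' h'. ctx_type h' c' = e \<and> (\<forall>y. iterate_context c h (Suc n) y = plug c' h' y)"
proof (induction n)
  case 0
  show ?case using assms by auto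
next
  case (Suc n)
  then obtain c' h' where c': "ctx_type h' c' = e" "\<And>y. iterate_context c h (Suc n) y = plug c' h' y" by blast
  have "ctx_type (h @ h') (plug c h c') = e" using c' assms by (simp add: ctx_type_append)
  moreover have "iterate_context c h (Suc (Suc n)) y = plug (plug c h c') (h @ h') y" for y
    using c' by (simp add: plug_plug)
  ultimately show ?case by blast
qed

lemma less_plug_cong:
  assumes "ctx_type h c = ctx_type h' c'"
  shows "less (plug c h y) (plug c h y') \<longleftrightarrow> less (plug c' h' y) (plug c' h' y')"
  using assms by (simp add: less_B plug_pair_tree accepts_from_plug ctx_type_def)

lemma mem_plug_cong:
  assumes "ctx_type h c = ctx_type h' c'"
  shows "plug c h y \<in> lang A \<longleftrightarrow> plug c' h' y \<in> lang A"
  using assms by (simp add: mem_A accepts_from_plug ctx_type_def)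

text \<open>If prepending the context \<open>c\<close> to \<open>y\<close> made the tree smaller, then it would do so below any
  number of copies of \<open>c\<close>, because the prefixes \<open>u c\<^sup>n\<close> all have the same type; the trees \<open>u c\<^sup>n y\<close> would
  form an infinite descending sequence.\<close>

lemma prepend_not_less:
  assumes e: "compose e e = e" and u: "compose (ctx_type u t) e = ctx_type u t"
    and c: "ctx_type h c = e"
    and mem: "plug t u y \<in> lang A" "plug t u (plug c h y) \<in> lang A"
  shows "\<not> less (plug t u (plug c h y)) (plug t u y)"
proof
  assume less: "less (plug t u (plug c h y)) (plug t u y)"
  define f where "f n = plug t u (iterate_context c h n y)" for n
  have step: "f n \<in> lang A \<and> less (f (Suc n)) (f n)" for n
  proof (cases n)
    case 0 then show ?thesis using mem less by (simp add: f_def)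
  next
    case (Suc k)
    obtain c' h' where c': "ctx_type h' c' = e" "\<And>y. iterate_context c h (Suc k) y = plug c' h' y"
      using iterate_context_as_plug[OF e c] by blast
    define t' u' where "t' = plug t u c'" and "u' = u @ h'"
    have ctx_type: "ctx_type u' t' = ctx_type u t"
      unfolding t'_def u'_def using c' u by (simp add: ctx_type_append)
    have eq: "f n = plug t' u' y"
      unfolding f_def Suc c' t'_def u'_def by (rule plug_plug)
    have "f (Suc n) = plug t u (iterate_context c h (Suc k) (plug c h y))"
      by (simp add: f_def Suc iterate_context_plug)
    also have "\<dots> = plug t' u' (plug c h y)"
      unfolding f_def Suc c' t'_def u'_def by (rule plug_plug)
    finally show ?thesis
      unfolding eq using less_plug_cong[OF ctx_type] mem_plug_cong[OF ctx_type] less mem by simp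
  qed
  then show False using no_descent[of f] by blast
qed

text \<open>Long prefixes of two different trees that factor into contexts of type \<open>e\<close> are contexts \<open>c\<close>,
  \<open>d\<close> of type \<open>e\<close> that disagree at a node \<open>v\<close> outside both holes. The trees \<open>r = (c d)\<^sup>\<omega>\<close> and \<open>r' = d r\<close>
  satisfy \<open>r = c r'\<close>, so neither is smaller than the other and they are equal, although they show
  \<open>c\<close> and \<open>d\<close> at the top.\<close>

lemma factors_unique:
  assumes e: "compose e e = e" and s: "factors e s" "factors e s'"
    and t: "t \<in> lang A" "subtree t u = s"
  shows "s = s'"
proof (rule ccontr)
  assume "s \<noteq> s'"
  then obtain v where v: "s v \<noteq> s' v" by blast
  obtain h where h: "length h > length v" "ctx_type h s = e" using factors_long_prefix[OF s(1) e] by blast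
  obtain h' where h': "length h' > length v" "ctx_type h' s' = e" using factors_long_prefix[OF s(2) e] by blast
  define w where "w = h @ h'"
  define r where "r = context_power (plug s h s') w"
  define r' where "r' = plug s' h' r"
  have w: "w \<noteq> []" using h by (auto simp: w_def)
  have "ctx_type w (plug s h s') = e" using h h' e by (simp add: w_def ctx_type_append)
  then have fac: "factors e r" unfolding r_def by (rule factors_context_power[OF w])
  have r: "plug s h r' = r"
    using plug_context_power[OF w, of "plug s h s'"] unfolding r_def r'_def w_def by (simp add: plug_plug)
  have "t = plug t u s" using plug_subtree[of t u] t by simp
  then obtain V q where q: "(initial A, V, q) \<in> segment_type A u t" "accepts_from A q s"
    using t(1) by (metis mem_A accepts_from_plug)
  have "accepts_from A q r" by (rule accepts_from_factors[OF s(1) fac q(2)])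
  then have mem_r: "plug t u r \<in> lang A"
    using q by (auto simp: mem_A accepts_from_plug)
  \<comment> \<open>one copy of \<open>c\<close> is appended to the prefix so that it absorbs further factors of type \<open>e\<close>\<close>
  define t1 u1 where "t1 = plug t u s" and "u1 = u @ h"
  have t1: "plug t u (plug s h y) = plug t1 u1 y" for y
    unfolding t1_def u1_def by (rule plug_plug)
  have ty1: "compose (ctx_type u1 t1) e = ctx_type u1 t1"
    unfolding t1_def u1_def using h e
    by (simp add: ctx_type_append compose_assoc)
  have mem_r': "plug t1 u1 r' \<in> lang A" using mem_r unfolding t1[symmetric] r .
  have ty2: "ctx_type (u1 @ h) (plug t1 u1 s) = ctx_type u1 t1"
    using h ty1 by (simp add: ctx_type_append)
  have "plug (plug t1 u1 s) (u1 @ h) r' \<in> lang A"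
    using mem_plug_cong[OF ty2] mem_r' by simp
  then have mem_r1: "plug t1 u1 r \<in> lang A"
    unfolding plug_plug[symmetric] r .
  have "\<not> less (plug t1 u1 r) (plug t1 u1 r')"
    using prepend_not_less[OF e ty1 h(2), of r'] mem_r1 mem_r' by (simp add: r)
  moreover have "\<not> less (plug t1 u1 r') (plug t1 u1 r)"
    using prepend_not_less[OF e ty1 h'(2), of r] mem_r1 mem_r' by (simp add: r'_def)
  ultimately have "plug t1 u1 r = plug t1 u1 r'" using total mem_r1 mem_r' by blast
  then have "r = r'" by (metis subtree_plug)
  have "take (length h) v \<noteq> h" "take (length h') v \<noteq> h'" using h h' by auto
  then have "plug s h r' v = s v" "r' v = s' v" unfolding r'_def plug_def by simp_all
  then have "r v = s v" "r' v = s' v" by (simp_all add: r)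
  with v \<open>r = r'\<close> show False by simp
qed

definition recurrent_subtrees :: "'a tree set" where
  "recurrent_subtrees =
     {s. \<exists>t\<in>lang A. \<exists>u. s = subtree t u \<and> (\<exists>e\<in>ctx_types. compose e e = e \<and> factors e s)}"

lemma finite_recurrent_subtrees: "finite recurrent_subtrees"
proof -
  have "\<forall>s\<in>recurrent_subtrees. \<exists>e\<in>ctx_types. compose e e = e \<and> factors e s"
    unfolding recurrent_subtrees_def by blast
  then obtain f where f: "\<And>s. s \<in> recurrent_subtrees \<Longrightarrow>
      f s \<in> ctx_types \<and> compose (f s) (f s) = f s \<and> factors (f s) s" by metis
  have "inj_on f recurrent_subtrees"
  proof (rule inj_onI)
    fix s s' assume s: "s \<in> recurrent_subtrees" "s' \<in> recurrent_subtrees" "f s = f s'"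
    obtain t u where "t \<in> lang A" "subtree t u = s" using s(1) unfolding recurrent_subtrees_def by blast
    then show "s = s'" using factors_unique[of "f s" s s'] f s by metis
  qed
  moreover have "f ` recurrent_subtrees \<subseteq> ctx_types" using f by blast
  ultimately show ?thesis using finite_ctx_types by (rule inj_on_finite)
qed

text \<open>By Ramsey's theorem there are infinitely many nodes on the branch such that all segments between
  two of them have the same type. This type is idempotent, because a segment can be cut at a third
  such node.\<close>

lemma branch_meets_recurrent:
  assumes t: "t \<in> lang A"
  shows "\<exists>n\<ge>k. subtree t (branch_prefix \<pi> n) \<in> recurrent_subtrees"
proof -
  define colour where "colour i j = ctx_type (branch_segment \<pi> i j) (subtree t (branch_prefix \<pi> i))" for i j
  have colour_in: "colour i j \<in> ctx_types" if "i < j" for i j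
  proof -
    have "branch_segment \<pi> i j \<noteq> []"
      using that by (metis length_branch_segment list.size(3) zero_less_diff less_irrefl)
    then show ?thesis unfolding colour_def by (rule ctx_type_in_ctx_types)
  qed
  obtain g n where g: "g ` ctx_types = {i::nat. i < n}" "inj_on g ctx_types"
    using finite_imp_inj_to_nat_seg[OF finite_ctx_types] by blast
  define f where "f X = g (colour (Min X) (Max X))" for X
  have f: "f {x, y} < n" if "x \<noteq> y" for x y
  proof -
    have "Min {x, y} < Max {x, y}" using that by (simp add: min_def max_def)
    then show ?thesis using g(1) colour_in unfolding f_def by blast
  qed
  obtain Y c where Y: "Y \<subseteq> {k..}" "infinite Y" and c: "\<And>x y. x \<in> Y \<Longrightarrow> y \<in> Y \<Longrightarrow> x \<noteq> y \<Longrightarrow> f {x, y} = c"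
    using Ramsey2[of "{k..}" f n] f by (auto simp: infinite_Ici)
  define p where "p = enumerate Y"
  have p: "strict_mono p" "\<And>i. p i \<in> Y"
    using Y(2) by (simp_all add: p_def strict_mono_enumerate enumerate_in_set)
  then have less: "p i < p j \<longleftrightarrow> i < j" "p i \<le> p j \<longleftrightarrow> i \<le> j" for i j
    by (simp_all add: strict_mono_less strict_mono_less_eq)
  define e where "e = colour (p 0) (p 1)"
  have colour: "colour (p i) (p j) = e" if "i < j" for i j
  proof -
    have lt: "p a < p b" if "a < b" for a b using that by (simp add: less)
    have "g (colour (p a) (p b)) = c" if "a < b" for a b
      using c[of "p a" "p b"] p(2) lt[OF that] by (simp add: f_def min_def max_def)
    then show ?thesis unfolding e_def
      using inj_onD[OF g(2)] colour_in lt that by (metis zero_less_one)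
  qed
  have "compose (colour (p 0) (p 1)) (colour (p 1) (p 2)) = colour (p 0) (p 2)"
  proof -
    have pre: "branch_prefix \<pi> (p j) = branch_prefix \<pi> (p i) @ branch_segment \<pi> (p i) (p j)" if "i \<le> j" for i j
      using that by (intro branch_prefix_segment) (simp add: less)
    have "branch_prefix \<pi> (p 0) @ branch_segment \<pi> (p 0) (p 2) =
        branch_prefix \<pi> (p 0) @ branch_segment \<pi> (p 0) (p 1) @ branch_segment \<pi> (p 1) (p 2)"
      using pre[of 0 2] pre[of 0 1] pre[of 1 2] by simp
    then have "branch_segment \<pi> (p 0) (p 2) = branch_segment \<pi> (p 0) (p 1) @ branch_segment \<pi> (p 1) (p 2)"
      by simp
    then show ?thesis using pre[of 0 1] by (simp add: colour_def ctx_type_append)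
  qed
  then have idem: "compose e e = e" by (simp add: colour)
  define \<pi>' where "\<pi>' i = \<pi> (p 0 + i)" for i
  define m where "m i = p i - p 0" for i
  have m: "p 0 + m i = p i" for i by (simp add: m_def less)
  have pre': "branch_prefix \<pi> (p 0) @ branch_prefix \<pi>' (m i) = branch_prefix \<pi> (p i)" for i
    using branch_prefix_add[of \<pi> "p 0" "m i"] unfolding m \<pi>'_def by simp
  have seg': "branch_segment \<pi>' (m i) (m j) = branch_segment \<pi> (p i) (p j)" for i j
  proof -
    have "m j - m i = p j - p i" "p 0 + m i = p i"
      using m[of i] m[of j] by linarith+
    then show ?thesis unfolding branch_segment_def \<pi>'_def by (simp flip: add.assoc)
  qed
  have "factors e (subtree t (branch_prefix \<pi> (p 0)))"
    unfolding factors_def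
  proof (intro exI[of _ \<pi>'] exI[of _ m] conjI allI)
    show "strict_mono m"
      using m unfolding strict_mono_def by (metis less(1) nat_add_left_cancel_less)
    show "m 0 = 0" by (simp add: m_def)
    show "ctx_type (branch_segment \<pi>' (m i) (m (Suc i)))
          (subtree (subtree t (branch_prefix \<pi> (p 0))) (branch_prefix \<pi>' (m i))) = e" for i
      using colour[of i "Suc i"] by (simp add: seg' pre' colour_def)
  qed
  moreover have "e \<in> ctx_types" unfolding e_def by (rule colour_in) (simp add: less)
  ultimately have "subtree t (branch_prefix \<pi> (p 0)) \<in> recurrent_subtrees"
    using t idem unfolding recurrent_subtrees_def by blast
  moreover have "p 0 \<ge> k" using p(2)[of 0] Y(1) by auto
  ultimately show ?thesis by blast
qed

text \<open>Compactness turns the statement about branches into a bound. The bound is on positions strictly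
  below \<open>u\<close>, so that it can be applied again at the recurrent subtree that has been found.\<close>

lemma recurrent_bar:
  assumes t: "t \<in> lang A"
  shows "\<exists>N. \<forall>v. length v \<ge> N \<longrightarrow> (\<exists>k. 1 \<le> k \<and> k \<le> N \<and> subtree t (u @ take k v) \<in> recurrent_subtrees)"
proof (rule ccontr)
  define P where "P v \<longleftrightarrow> (\<forall>k. 1 \<le> k \<and> k \<le> length v \<longrightarrow> subtree t (u @ take k v) \<notin> recurrent_subtrees)" for v
  assume no_bar: "\<not> ?thesis"
  have "\<exists>v. length v = N \<and> P v" for N
  proof -
    obtain v where "length v \<ge> N" "\<And>k. 1 \<le> k \<Longrightarrow> k \<le> N \<Longrightarrow> subtree t (u @ take k v) \<notin> recurrent_subtrees"
      using no_bar by blast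
    then show ?thesis by (intro exI[of _ "take N v"]) (simp add: P_def min_def)
  qed
  moreover have "P v" if "P (v @ w)" for v w
    unfolding P_def
  proof (intro allI impI)
    fix k assume "1 \<le> k \<and> k \<le> length v"
    then show "subtree t (u @ take k v) \<notin> recurrent_subtrees"
      using that unfolding P_def by (auto dest!: spec[of _ k])
  qed
  ultimately obtain \<pi> where \<pi>: "\<And>n. P (branch_prefix \<pi> n)" using konig[of P] by blast
  obtain \<pi>' where \<pi>': "\<And>n. branch_prefix \<pi>' (length u + n) = u @ branch_prefix \<pi> n"
    using branch_through by blast
  obtain n where n: "n \<ge> length u + 1" "subtree t (branch_prefix \<pi>' n) \<in> recurrent_subtrees"
    using branch_meets_recurrent[OF t] by blast
  then have "branch_prefix \<pi>' n = u @ branch_prefix \<pi> (n - length u)"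
    using \<pi>'[of "n - length u"] by simp
  then show False
    using \<pi>[of "n - length u"] n unfolding P_def by (auto dest!: spec[of _ "n - length u"])
qed

text \<open>Recurrent subtrees occur on every branch of every tree of the language, also strictly below
  themselves; hence all subtrees from some depth on lie at bounded depth below a recurrent one.\<close>

theorem finitely_many_ends:
  "\<exists>Z. finite Z \<and> (\<forall>t\<in>lang A. \<exists>n. \<forall>d. length d = n \<longrightarrow> subtree t d \<in> Z)"
proof -
  have "\<forall>z\<in>recurrent_subtrees. \<exists>N. \<forall>v. length v \<ge> N \<longrightarrow>
      (\<exists>k. 1 \<le> k \<and> k \<le> N \<and> subtree z (take k v) \<in> recurrent_subtrees)"
  proof
    fix z assume "z \<in> recurrent_subtrees"
    then obtain t u where "t \<in> lang A" "z = subtree t u" unfolding recurrent_subtrees_def by blast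
    then show "\<exists>N. \<forall>v. length v \<ge> N \<longrightarrow>
        (\<exists>k. 1 \<le> k \<and> k \<le> N \<and> subtree z (take k v) \<in> recurrent_subtrees)"
      using recurrent_bar[of t u] by simp
  qed
  then obtain b where b: "\<And>z v. z \<in> recurrent_subtrees \<Longrightarrow> length v \<ge> b z \<Longrightarrow>
      \<exists>k. 1 \<le> k \<and> k \<le> b z \<and> subtree z (take k v) \<in> recurrent_subtrees" by metis
  define N where "N = Max (b ` recurrent_subtrees)"
  have N: "b z \<le> N" if "z \<in> recurrent_subtrees" for z
    unfolding N_def using that finite_recurrent_subtrees by simp
  define Z where "Z = (\<lambda>(z, v). subtree z v) ` (recurrent_subtrees \<times> {v. set v \<subseteq> UNIV \<and> length v \<le> N})"
  have "finite Z"
    unfolding Z_def using finite_directions finite_recurrent_subtrees by (intro finite_imageI finite_cartesian_product finite_lists_length_le)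
  moreover have below: "subtree z v \<in> Z" if "z \<in> recurrent_subtrees" for z v
    using that
  proof (induction "length v" arbitrary: z v rule: less_induct)
    case less
    show ?case
    proof (cases "length v \<le> N")
      case True
      then show ?thesis using less(2) unfolding Z_def by force
    next
      case False
      then obtain k where k: "1 \<le> k" "k \<le> b z" "subtree z (take k v) \<in> recurrent_subtrees"
        using b[OF less(2), of v] N[OF less(2)] by auto
      then have "length (drop k v) < length v" using False N[OF less(2)] by simp
      from less(1)[OF this k(3)] show ?thesis by simp
    qed
  qed
  moreover have "\<exists>n. \<forall>d. length d = n \<longrightarrow> subtree t d \<in> Z" if t: "t \<in> lang A" for t
  proof -
    obtain n where n: "\<And>v. length v \<ge> n \<Longrightarrow> \<exists>k. k \<le> n \<and> subtree t (take k v) \<in> recurrent_subtrees"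
      using recurrent_bar[OF t, of "[]"] by (metis append_Nil)
    show ?thesis
    proof (intro exI allI impI)
      fix d :: node assume "length d = n"
      then obtain k where "subtree t (take k d) \<in> recurrent_subtrees" using n[of d] by auto
      from below[OF this, of "drop k d"] show "subtree t d \<in> Z" by simp
    qed
  qed
  ultimately show ?thesis by blast
qed

end

section \<open>Ordinals below \<open>\<omega>\<^sup>\<omega>\<^sup>\<omega>\<close> and rank functions\<close>

text \<open>The exponent \<open>{#n\<^sub>1, \<dots>, n\<^sub>r#}\<close> denotes the natural sum of the powers of \<open>\<omega>\<close> with exponents \<open>n\<^sub>i\<close>, and
  likewise \<open>{#\<gamma>\<^sub>1, \<dots>, \<gamma>\<^sub>r#}\<close> denotes the natural sum of the powers of \<open>\<omega>\<close> with exponents \<open>\<gamma>\<^sub>i\<close>.\<close>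

type_synonym cnf = "nat multiset multiset"

text \<open>For a strict well-order \<open>R\<close> on \<open>S\<close> this means that the order type of \<open>S\<close> is at most \<open>z\<close>.\<close>

definition embeds :: "'b set \<Rightarrow> ('b \<Rightarrow> 'b \<Rightarrow> bool) \<Rightarrow> cnf \<Rightarrow> bool" where
  "embeds S R z \<longleftrightarrow> (\<exists>f. (\<forall>s\<in>S. f s < z) \<and> (\<forall>s\<in>S. \<forall>t\<in>S. R s t \<longrightarrow> f s < f t))"

lemma embeds_mono: "embeds S R z \<Longrightarrow> S' \<subseteq> S \<Longrightarrow> z \<le> z' \<Longrightarrow> embeds S' R z'"
  unfolding embeds_def by (meson order_less_le_trans subsetD)

lemma embeds_empty [simp]: "embeds {} R z"
  by (simp add: embeds_def)

text \<open>Mapping \<open>w\<close> to the least \<open>z\<close> that bounds the type of the elements below \<open>w\<close> is strictly increasing: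
  an embedding of the segment below a larger \<open>w'\<close> bounds the segment below \<open>w\<close> by the image of \<open>w\<close>.\<close>

lemma embeds_if_initial_segments:
  assumes trans: "transp_on S R"
    and init: "\<And>w. w \<in> S \<Longrightarrow> \<exists>z<Z. embeds {s \<in> S. R s w} R z"
  shows "embeds S R Z"
proof -
  define h where "h w = (LEAST z. embeds {s \<in> S. R s w} R z)" for w
  have h: "embeds {s \<in> S. R s w} R (h w)" "h w < Z" if w: "w \<in> S" for w
  proof -
    obtain z where z: "z < Z" "embeds {s \<in> S. R s w} R z" using init[OF w] by blast
    show "embeds {s \<in> S. R s w} R (h w)" unfolding h_def by (rule LeastI[of _ z]) fact
    have "h w \<le> z" unfolding h_def by (rule Least_le) fact
    with z show "h w < Z" by simp
  qed
  have "h v < h w" if vw: "v \<in> S" "w \<in> S" "R v w" for v w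
  proof -
    obtain f where f: "\<And>s. s \<in> S \<Longrightarrow> R s w \<Longrightarrow> f s < h w"
      "\<And>s t. s \<in> S \<Longrightarrow> R s w \<Longrightarrow> t \<in> S \<Longrightarrow> R t w \<Longrightarrow> R s t \<Longrightarrow> f s < f t"
      using h(1)[OF vw(2)] unfolding embeds_def by blast
    have "R s w" if "s \<in> S" "R s v" for s
      using transp_onD[OF trans] that vw by blast
    then have "embeds {s \<in> S. R s v} R (f v)"
      unfolding embeds_def
      by (intro exI[of _ f] conjI ballI impI; elim CollectE conjE) (simp_all add: f vw)
    then have "h v \<le> f v" unfolding h_def by (rule Least_le)
    also have "f v < h w" using f(1) vw by blast
    finally show ?thesis .
  qed
  then show ?thesis
    unfolding embeds_def by (intro exI[of _ h] conjI ballI impI) (simp_all add: h(2))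
qed

text \<open>The rank of a point in a union is the natural sum of the ranks of its traces on the two
  parts: both grow along the order, and one of them strictly.\<close>

lemma embeds_Un:
  assumes trans: "transp_on (S \<union> T) R" and S: "embeds S R a" and T: "embeds T R b"
  shows "embeds (S \<union> T) R (a + b)"
proof -
  have trace: "\<exists>h. (\<forall>w. h w \<le> c) \<and> (\<forall>w\<in>V. h w < c) \<and>
      (\<forall>w\<in>S \<union> T. \<forall>w'\<in>S \<union> T. R w w' \<longrightarrow> h w \<le> h w' \<and> (w \<in> V \<longrightarrow> h w < h w'))"
    if V: "V \<subseteq> S \<union> T" "embeds V R c" for V c
  proof -
    obtain f where f: "\<And>s. s \<in> V \<Longrightarrow> f s < c" "\<And>s t. s \<in> V \<Longrightarrow> t \<in> V \<Longrightarrow> R s t \<Longrightarrow> f s < f t"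
      using V(2) unfolding embeds_def by blast
    define h where "h w = (LEAST z. \<forall>x\<in>V. R x w \<longrightarrow> f x < z)" for w
    have least: "h w \<le> z" if "\<And>x. x \<in> V \<Longrightarrow> R x w \<Longrightarrow> f x < z" for w z
      unfolding h_def by (rule Least_le) (use that in blast)
    have hI: "f x < h w" if "x \<in> V" "R x w" for x w
    proof -
      have "\<forall>x\<in>V. R x w \<longrightarrow> f x < h w"
        unfolding h_def by (rule LeastI[of _ c]) (use f in blast)
      with that show ?thesis by blast
    qed
    have h_le: "h w \<le> f w" if "w \<in> V" for w
      by (rule least) (use f(2) that in blast)
    have "h w \<le> h w'" if "w \<in> S \<union> T" "w' \<in> S \<union> T" "R w w'" for w w'
    proof (rule least)
      fix x assume "x \<in> V" "R x w"
      moreover from this have "R x w'"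
        using transp_onD[OF trans] that \<open>V \<subseteq> S \<union> T\<close> by blast
      ultimately show "f x < h w'" using hI by blast
    qed
    moreover have "h w < h w'" if "w \<in> V" "R w w'" for w w'
      using h_le[OF that(1)] hI[OF that] by simp
    moreover have "h w < c" if "w \<in> V" for w
      using h_le[OF that] f(1)[OF that] by simp
    moreover have "h w \<le> c" for w
      by (rule least) (use f(1) in blast)
    ultimately show ?thesis by blast
  qed
  obtain g where g: "\<And>w. g w \<le> a" "\<And>w. w \<in> S \<Longrightarrow> g w < a"
    "\<And>w w'. w \<in> S \<union> T \<Longrightarrow> w' \<in> S \<union> T \<Longrightarrow> R w w' \<Longrightarrow> g w \<le> g w' \<and> (w \<in> S \<longrightarrow> g w < g w')"
    using trace[OF _ S] by blast
  obtain h where h: "\<And>w. h w \<le> b" "\<And>w. w \<in> T \<Longrightarrow> h w < b"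
    "\<And>w w'. w \<in> S \<union> T \<Longrightarrow> w' \<in> S \<union> T \<Longrightarrow> R w w' \<Longrightarrow> h w \<le> h w' \<and> (w \<in> T \<longrightarrow> h w < h w')"
    using trace[OF _ T] by blast
  show ?thesis
    unfolding embeds_def
  proof (intro exI[of _ "\<lambda>w. g w + h w"] conjI ballI impI)
    fix w assume "w \<in> S \<union> T"
    then show "g w + h w < a + b"
      using g(1,2)[of w] h(1,2)[of w] by (auto intro: add_less_le_mono add_le_less_mono)
  next
    fix w w' assume "w \<in> S \<union> T" "w' \<in> S \<union> T" "R w w'"
    then show "g w + h w < g w' + h w'"
      using g(3)[of w w'] h(3)[of w w'] by (auto intro: add_less_le_mono add_le_less_mono)
  qed
qed

lemma embeds_UN:
  assumes "finite I" and trans: "transp_on (\<Union>i\<in>I. S i) R" and "\<And>i. i \<in> I \<Longrightarrow> embeds (S i) R (a i)"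
  shows "embeds (\<Union>i\<in>I. S i) R (\<Sum>i\<in>I. a i)"
  using assms
proof (induction I)
  case (insert i I)
  have "transp_on (\<Union>i\<in>I. S i) R"
    using insert.prems(1) by (rule transp_on_subset) blast
  with insert have "embeds (S i \<union> (\<Union>i\<in>I. S i)) R (a i + (\<Sum>i\<in>I. a i))"
    by (intro embeds_Un) auto
  with insert show ?case by simp
qed simp

text \<open>Cantor normal forms are compared at the largest exponent whose coefficients differ.\<close>

lemma less_multiset_iff_max_difference:
  fixes M N :: "'b :: linorder multiset"
  shows "M < N \<longleftrightarrow> (\<exists>y. count M y < count N y \<and> (\<forall>x>y. count M x = count N x))"
proof
  assume less: "M < N"
  define Y where "Y = {x. count M x \<noteq> count N x}"
  have "Y \<subseteq> set_mset M \<union> set_mset N"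
    unfolding Y_def by (rule subsetI, rule ccontr) (simp add: not_in_iff)
  then have fin: "finite Y" by (rule finite_subset) simp
  have "M \<noteq> N" using less by blast
  then have "Y \<noteq> {}" unfolding Y_def by (auto simp: multiset_eq_iff)
  with fin have max: "count M (Max Y) \<noteq> count N (Max Y)" using Max_in[of Y] by (simp add: Y_def)
  have above: "count M x = count N x" if "Max Y < x" for x
    
  proof (rule ccontr)
    assume "count M x \<noteq> count N x"
    then have "x \<le> Max Y" using fin by (intro Max_ge) (simp_all add: Y_def)
    with that show False by simp
  qed
  then have "count M (Max Y) < count N (Max Y)"
    using less max unfolding less_multiset\<^sub>H\<^sub>O by (metis less_irrefl linorder_neqE)
  with above show "\<exists>y. count M y < count N y \<and> (\<forall>x>y. count M x = count N x)" by blast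
next
  assume "\<exists>y. count M y < count N y \<and> (\<forall>x>y. count M x = count N x)"
  then show "M < N"
    unfolding less_multiset\<^sub>H\<^sub>O by (metis less_irrefl linorder_neqE order_less_asym)
qed

text \<open>Splitting off the least summand \<open>\<omega>\<^sup>\<gamma>\<close> of \<open>M\<close> cuts the ordinals below \<open>M\<close> into those below
  the remaining sum \<open>M'\<close> and those of the form \<open>M' + z\<close> with \<open>z < \<omega>\<^sup>\<gamma>\<close>.\<close>

lemma cut_last_summand:
  fixes M' :: "'b :: linorder multiset"
  assumes min: "\<And>x. x \<in># M' \<Longrightarrow> \<gamma> \<le> x" and z: "z < add_mset \<gamma> M'" "\<not> z < M'"
  shows "M' \<subseteq># z \<and> z - M' < {#\<gamma>#}"
proof -
  obtain y where y: "count z y < count (add_mset \<gamma> M') y"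
    and above: "\<And>x. x > y \<Longrightarrow> count z x = count (add_mset \<gamma> M') x"
    using z(1) unfolding less_multiset_iff_max_difference by blast
  have "y = \<gamma>"
  proof (rule ccontr)
    assume neq: "y \<noteq> \<gamma>"
    with y have "y \<in># M'" by (metis count_add_mset count_greater_zero_iff gr_zeroI not_less0)
    with min neq have "\<gamma> < y" by (metis le_less)
    then have "z < M'"
      unfolding less_multiset_iff_max_difference using y above neq by (intro exI[of _ y]) auto
    with z show False by blast
  qed
  have above': "count z x = count M' x" if "x > \<gamma>" for x
    using above[of x] that \<open>y = \<gamma>\<close> by simp
  then have "\<not> count z \<gamma> < count M' \<gamma>"
    using z(2) unfolding less_multiset_iff_max_difference by blast
  then have eq: "count z x = count M' x" if "x \<ge> \<gamma>" for x
    using that y above'[of x] \<open>y = \<gamma>\<close> by (cases "x = \<gamma>") auto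
  have below: "count M' x = 0" if "x < \<gamma>" for x
    using min[of x] that by (meson leD not_in_iff)
  have "M' \<subseteq># z"
    unfolding subseteq_mset_def by (metis below eq le0 le_refl linorder_not_le)
  moreover have "x < \<gamma>" if "x \<in># z - M'" for x
    using that eq[of x] by (metis count_diff count_greater_zero_iff diff_self_eq_0 less_irrefl not_le)
  ultimately show ?thesis by simp
qed

text \<open>Iterating the cut decomposes the ordinals below \<open>M\<close> into one piece \<open>D\<close> for each summand \<open>\<omega>\<^sup>\<gamma>\<close> of
  \<open>M\<close>; the map \<open>\<psi>\<close> moves this piece to the ordinals below \<open>\<omega>\<^sup>\<gamma>\<close>.\<close>

lemma pieces_below:
  fixes M :: "'b :: linorder multiset"
  shows "\<exists>F :: ('b multiset set \<times> 'b \<times> ('b multiset \<Rightarrow> 'b multiset)) set. finite F \<and>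
     (\<forall>z<M. \<exists>(D, \<gamma>, \<psi>)\<in>F. z \<in> D) \<and>
     (\<forall>(D, \<gamma>, \<psi>)\<in>F. \<gamma> \<in># M \<and> (\<forall>z\<in>D. \<psi> z < {#\<gamma>#}) \<and> (\<forall>z\<in>D. \<forall>z'\<in>D. \<psi> z \<le> \<psi> z' \<longrightarrow> z \<le> z'))"
proof (induction "size M" arbitrary: M)
  case 0
  then show ?case by (intro exI[of _ "{}"]) simp
next
  case (Suc n)
  then have ne: "set_mset M \<noteq> {}" by auto
  define \<gamma> where "\<gamma> = Min (set_mset M)"
  have \<gamma>: "\<gamma> \<in># M" using ne unfolding \<gamma>_def by (intro Min_in) auto
  define M' where "M' = M - {#\<gamma>#}"
  have M: "M = add_mset \<gamma> M'" using \<gamma> by (simp add: M'_def)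
  have min: "\<gamma> \<le> x" if "x \<in># M'" for x
    using that unfolding M'_def \<gamma>_def by (intro Min_le) (auto dest: in_diffD)
  have "n = size M'" using Suc.hyps(2) M by simp
  from Suc.hyps(1)[OF this] obtain F where F: "finite F" "\<forall>z<M'. \<exists>(D, \<gamma>, \<psi>)\<in>F. z \<in> D"
    "\<forall>(D, \<gamma>, \<psi>)\<in>F. \<gamma> \<in># M' \<and> (\<forall>z\<in>D. \<psi> z < {#\<gamma>#}) \<and> (\<forall>z\<in>D. \<forall>z'\<in>D. \<psi> z \<le> \<psi> z' \<longrightarrow> z \<le> z')"
    by blast
  define D where "D = {z. z < M \<and> \<not> z < M'}"
  have D: "M' \<subseteq># z" "z - M' < {#\<gamma>#}" if "z \<in> D" for z
    using cut_last_summand[of M' \<gamma> z, OF min] that unfolding D_def M by blast+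
  have "z \<le> z'" if "z \<in> D" "z' \<in> D" "z - M' \<le> z' - M'" for z z'
    using add_left_mono[OF that(3), of M'] D(1)[OF that(1)] D(1)[OF that(2)] by simp
  then have "\<forall>(D, \<gamma>, \<psi>)\<in>insert (D, \<gamma>, \<lambda>z. z - M') F. \<gamma> \<in># M \<and> (\<forall>z\<in>D. \<psi> z < {#\<gamma>#}) \<and>
      (\<forall>z\<in>D. \<forall>z'\<in>D. \<psi> z \<le> \<psi> z' \<longrightarrow> z \<le> z')"
    using F(3) D(2) unfolding M by fastforce
  moreover have "\<forall>z<M. \<exists>(D, \<gamma>, \<psi>)\<in>insert (D, \<gamma>, \<lambda>z. z - M') F. z \<in> D"
    using F(2) unfolding D_def by fastforce
  ultimately show ?case using F(1) by (intro exI[of _ "insert (D, \<gamma>, \<lambda>z. z - M') F"]) blast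
qed

text \<open>Powers of \<open>\<omega>\<close> are closed under natural sums.\<close>

lemma sum_less_single:
  fixes a :: "'i \<Rightarrow> 'b :: linorder multiset"
  assumes "\<And>i. i \<in> I \<Longrightarrow> a i < {#\<delta>#}"
  shows "(\<Sum>i\<in>I. a i) < {#\<delta>#}"
  using assms by (induction I rule: infinite_finite_induct) auto

text \<open>A linear order on a product that extends the componentwise order has at most the type of the
  natural product of the factors, which for powers of \<open>\<omega>\<close> adds the exponents. The points below \<open>w\<^sub>0\<close> lie below \<open>w\<^sub>0\<close> in some coordinate, so
  they are covered by finitely many products in which one factor has been made smaller.\<close>

lemma embeds_box:
  fixes \<gamma> :: "'i \<Rightarrow> nat multiset"
  assumes "finite I" "transp_on W R"
    and "\<And>i w. i \<in> I \<Longrightarrow> w \<in> W \<Longrightarrow> \<phi> i w < {#\<gamma> i#}"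
    and "\<And>w w'. w \<in> W \<Longrightarrow> w' \<in> W \<Longrightarrow> \<forall>i\<in>I. \<phi> i w \<le> \<phi> i w' \<Longrightarrow> \<not> R w' w"
  shows "embeds W R {#\<Sum>i\<in>I. \<gamma> i#}"
  using assms
proof (induction "\<Sum>i\<in>I. \<gamma> i" arbitrary: \<gamma> \<phi> W rule: less_induct)
  case less
  show ?case
  proof (rule embeds_if_initial_segments[OF less.prems(2)])
    fix w0 assume w0: "w0 \<in> W"
    define is_piece where "is_piece i D \<delta> \<psi> \<longleftrightarrow> \<delta> \<in># \<phi> i w0 \<and> (\<forall>z\<in>D. \<psi> z < {#\<delta>#}) \<and>
         (\<forall>z\<in>D. \<forall>z'\<in>D. \<psi> z \<le> \<psi> z' \<longrightarrow> z \<le> z')"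
      for i D and \<delta> :: "nat multiset" and \<psi> :: "cnf \<Rightarrow> cnf"
    have "\<forall>i. \<exists>F. finite F \<and> (\<forall>z<\<phi> i w0. \<exists>(D, \<delta>, \<psi>)\<in>F. z \<in> D) \<and> (\<forall>(D, \<delta>, \<psi>)\<in>F. is_piece i D \<delta> \<psi>)"
      unfolding is_piece_def using pieces_below by (rule allI)
    then obtain F where F: "\<forall>i. finite (F i) \<and> (\<forall>z<\<phi> i w0. \<exists>(D, \<delta>, \<psi>)\<in>F i. z \<in> D) \<and>
        (\<forall>(D, \<delta>, \<psi>)\<in>F i. is_piece i D \<delta> \<psi>)"
      by (rule choice[THEN exE])
    then have fin: "finite (F i)" and cover: "z < \<phi> i w0 \<Longrightarrow> \<exists>(D, \<delta>, \<psi>)\<in>F i. z \<in> D"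
      and piece: "(D, \<delta>, \<psi>) \<in> F i \<Longrightarrow> is_piece i D \<delta> \<psi>" for i z D \<delta> \<psi>
      by blast+
    note piece = piece[unfolded is_piece_def]
    define K where "K = Sigma I F"
    define S :: "'i \<times> cnf set \<times> nat multiset \<times> (cnf \<Rightarrow> cnf) \<Rightarrow> _"
      where "S = (\<lambda>(i, D, \<delta>, \<psi>). {w \<in> W. \<phi> i w \<in> D})"
    define a :: "'i \<times> cnf set \<times> nat multiset \<times> (cnf \<Rightarrow> cnf) \<Rightarrow> cnf"
      where "a = (\<lambda>(i, D, \<delta>, \<psi>). {#\<Sum>j\<in>I. (\<gamma>(i := \<delta>)) j#})"
    have "embeds (S k) R (a k) \<and> a k < {#\<Sum>i\<in>I. \<gamma> i#}" if "k \<in> K" for k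
    proof -
      obtain i D \<delta> \<psi> where k: "k = (i, D, \<delta>, \<psi>)" by (metis prod.exhaust)
      with that have i: "i \<in> I" "(D, \<delta>, \<psi>) \<in> F i" by (simp_all add: K_def)
      have "\<delta> < \<gamma> i"
        using piece[OF i(2)] less.prems(3)[OF i(1) w0] by simp
      then have sum: "(\<Sum>j\<in>I. (\<gamma>(i := \<delta>)) j) < (\<Sum>j\<in>I. \<gamma> j)"
        using less.prems(1) i(1) by (intro sum_strict_mono_ex1) auto
      have "embeds {w \<in> W. \<phi> i w \<in> D} R {#\<Sum>j\<in>I. (\<gamma>(i := \<delta>)) j#}"
      proof (rule less.hyps[OF sum less.prems(1)])
        show "transp_on {w \<in> W. \<phi> i w \<in> D} R"
          using less.prems(2) by (rule transp_on_subset) blast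
        show "(\<phi>(i := \<psi> \<circ> \<phi> i)) j w < {#(\<gamma>(i := \<delta>)) j#}" if "j \<in> I" "w \<in> {w \<in> W. \<phi> i w \<in> D}" for j w
          using that less.prems(3)[of j w] piece[OF i(2)] by (cases "j = i") auto
        fix w w' assume w: "w \<in> {w \<in> W. \<phi> i w \<in> D}" "w' \<in> {w \<in> W. \<phi> i w \<in> D}"
          and le: "\<forall>j\<in>I. (\<phi>(i := \<psi> \<circ> \<phi> i)) j w \<le> (\<phi>(i := \<psi> \<circ> \<phi> i)) j w'"
        have "\<phi> j w \<le> \<phi> j w'" if "j \<in> I" for j
        proof (cases "j = i")
          case True
          then have "\<psi> (\<phi> i w) \<le> \<psi> (\<phi> i w')" using le that by (auto dest: bspec[of _ _ i])
          then show ?thesis using w piece[OF i(2)] True by blast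
        next
          case False
          then show ?thesis using le that by (auto dest: bspec[of _ _ j])
        qed
        then show "\<not> R w' w" using less.prems(4) w by blast
      qed
      then show ?thesis using sum by (simp add: k S_def a_def)
    qed
    then have k: "embeds (S k) R (a k)" "a k < {#\<Sum>i\<in>I. \<gamma> i#}" if "k \<in> K" for k
      using that by blast+
    have "(\<Union>k\<in>K. S k) \<subseteq> W" by (auto simp: S_def)
    then have "transp_on (\<Union>k\<in>K. S k) R" by (rule transp_on_subset[OF less.prems(2)])
    then have U: "embeds (\<Union>k\<in>K. S k) R (\<Sum>k\<in>K. a k)"
      using less.prems(1) fin k(1) by (intro embeds_UN) (simp_all add: K_def)
    have "{s \<in> W. R s w0} \<subseteq> (\<Union>k\<in>K. S k)"
    proof
      fix s assume s: "s \<in> {s \<in> W. R s w0}"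
      then have "\<not> (\<forall>i\<in>I. \<phi> i w0 \<le> \<phi> i s)" using less.prems(4)[OF w0, of s] by blast
      with s obtain i where i: "i \<in> I" "\<phi> i s < \<phi> i w0" "s \<in> W"
        by (auto simp: not_le)
      then obtain D \<delta> \<psi> where "(D, \<delta>, \<psi>) \<in> F i" "\<phi> i s \<in> D" using cover[OF i(2)] by blast
      with i show "s \<in> (\<Union>k\<in>K. S k)" unfolding K_def S_def by force
    qed
    then show "\<exists>z<{#\<Sum>i\<in>I. \<gamma> i#}. embeds {s \<in> W. R s w0} R z"
      using embeds_mono[OF U] sum_less_single[of K a, OF k(2)] by blast
  qed
qed

text \<open>For \<open>k \<ge> 1\<close>, \<open>small k S R\<close> expresses that the order type of \<open>S\<close> is less than \<open>\<omega>\<close> to the power of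
  \<open>\<omega>\<close> to the power of \<open>k\<close>, which \<open>{#{#k#}#}\<close> denotes.\<close>

definition small :: "nat \<Rightarrow> 'b set \<Rightarrow> ('b \<Rightarrow> 'b \<Rightarrow> bool) \<Rightarrow> bool" where
  "small k S R \<longleftrightarrow> (\<exists>\<gamma><{#k#}. embeds S R {#\<gamma>#})"

lemma small_mono: "small k S R \<Longrightarrow> k \<le> k' \<Longrightarrow> small k' S R"
  unfolding small_def by (metis mset_le_single_iff order_less_le_trans)

lemma small_subset: "small k S R \<Longrightarrow> S' \<subseteq> S \<Longrightarrow> small k S' R"
  unfolding small_def using embeds_mono by blast

lemma small_image:
  assumes "small k S R" "\<And>x. x \<in> T \<Longrightarrow> f x \<in> S" "\<And>x y. x \<in> T \<Longrightarrow> y \<in> T \<Longrightarrow> Q x y \<Longrightarrow> R (f x) (f y)"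
  shows "small k T Q"
proof -
  obtain \<gamma> g where \<gamma>: "\<gamma> < {#k#}" "\<forall>s\<in>S. g s < {#\<gamma>#}" "\<forall>s\<in>S. \<forall>t\<in>S. R s t \<longrightarrow> g s < g t"
    using assms(1) unfolding small_def embeds_def by blast
  then have "embeds T Q {#\<gamma>#}"
    unfolding embeds_def using assms(2,3)
    by (intro exI[of _ "\<lambda>x. g (f x)"] conjI ballI impI) blast+
  with \<gamma> show ?thesis unfolding small_def by blast
qed

lemma small_empty [simp]: "small k {} R"
  unfolding small_def by (intro exI[of _ "{#}"]) simp

lemma small_UN:
  assumes "finite I" and trans: "transp_on (\<Union>i\<in>I. S i) R" and S: "\<And>i. i \<in> I \<Longrightarrow> small k (S i) R"
    and k: "k \<ge> 1"
  shows "small k (\<Union>i\<in>I. S i) R"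
proof -
  obtain \<gamma> where \<gamma>: "\<And>i. i \<in> I \<Longrightarrow> \<gamma> i < {#k#}" "\<And>i. i \<in> I \<Longrightarrow> embeds (S i) R {#\<gamma> i#}"
    using S unfolding small_def by metis
  \<comment> \<open>one more than the natural sum, hence strictly above every \<open>\<gamma> i\<close>\<close>
  define \<delta> where "\<delta> = add_mset 0 (\<Sum>i\<in>I. \<gamma> i)"
  have "(\<Sum>i\<in>I. \<gamma> i) < {#k#}" using \<gamma>(1) by (rule sum_less_single)
  then have "\<delta> < {#k#}" using k by (simp add: \<delta>_def)
  have "\<gamma> i < \<delta>" if "i \<in> I" for i
  proof -
    have "\<gamma> i \<le> (\<Sum>i\<in>I. \<gamma> i)"
      using assms(1) that by (metis less_eq_multiset_plus_right sum.remove)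
    also have "\<dots> < \<delta>" unfolding \<delta>_def by (rule le_multiset_right_total)
    finally show ?thesis .
  qed
  then have "(\<Sum>i\<in>I. {#\<gamma> i#}) < {#\<delta>#}" by (intro sum_less_single) simp
  then have "embeds (\<Union>i\<in>I. S i) R {#\<delta>#}"
    using embeds_UN[OF assms(1) trans \<gamma>(2)] by (meson embeds_mono order_refl order_less_imp_le)
  with \<open>\<delta> < {#k#}\<close> show ?thesis unfolding small_def by blast
qed

text \<open>A strictly increasing map of a well-order into itself never decreases an element, so the ordinal
  \<open>{#{#k#}#}\<close> cannot be embedded below one of its elements.\<close>

lemma initial_segment_not_small:
  assumes "\<And>z. z < {#{#k#}#} \<Longrightarrow> g z \<in> S"
    and "\<And>z z'. z < z' \<Longrightarrow> z' < {#{#k#}#} \<Longrightarrow> R (g z) (g z')"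
  shows "\<not> small k S R"
proof
  assume "small k S R"
  then obtain \<gamma> f where \<gamma>: "\<gamma> < {#k#}" "\<And>s. s \<in> S \<Longrightarrow> f s < {#\<gamma>#}"
    "\<And>s t. s \<in> S \<Longrightarrow> t \<in> S \<Longrightarrow> R s t \<Longrightarrow> f s < f t"
    unfolding small_def embeds_def by blast
  have "z \<le> f (g z)" if "z < {#{#k#}#}" for z
    using that
  proof (induction z rule: less_induct)
    case (less z)
    have "y < f (g z)" if "y < z" for y
    proof -
      have "y < {#{#k#}#}" using that less.prems by (rule order_less_trans)
      then have "y \<le> f (g y)" "f (g y) < f (g z)"
        using less that \<gamma>(3) assms by blast+
      then show ?thesis by (rule order_le_less_trans)
    qed
    then show ?case by (meson less_irrefl not_le)
  qed
  moreover have lt: "{#\<gamma>#} < {#{#k#}#}" using \<gamma>(1) by (simp only: mset_lt_single_iff)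
  ultimately show False using \<gamma>(2)[OF assms(1)[OF lt]] by (metis leD)
qed

lemma small_Suc:
  assumes "\<And>s. s \<in> S \<Longrightarrow> f s < {#{#k#}#}" "\<And>s t. s \<in> S \<Longrightarrow> t \<in> S \<Longrightarrow> R s t \<Longrightarrow> f s < f t"
  shows "small (Suc k) S R"
  unfolding small_def embeds_def
  by (intro exI[of _ "{#k#}"] exI[of _ f] conjI ballI impI assms) simp_all

section \<open>Decomposition of initial segments\<close>

lemma accepts_from_in_states:
  assumes "muller_automaton M" "accepts_from M p t"
  shows "p \<in> states M"
  using assms unfolding accepts_from_children[of M p t] muller_automaton_def by blast

lemma accepts_from_depth_cong:
  assumes "\<And>u. length u < n \<Longrightarrow> t u = t' u"
    and "\<And>d q. length d = n \<Longrightarrow> accepts_from M q (subtree t d) \<longleftrightarrow> accepts_from M q (subtree t' d)"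
  shows "accepts_from M p t \<longleftrightarrow> accepts_from M p t'"
  using assms
proof (induction n arbitrary: p t t')
  case 0
  then show ?case using "0.prems"(2)[of "[]" p] by simp
next
  case (Suc n)
  have "accepts_from M q (subtree t [d]) \<longleftrightarrow> accepts_from M q (subtree t' [d])" for d q
    by (rule Suc.IH) (use Suc.prems(1)[of "d # _"] Suc.prems(2)[of "d # _"] in \<open>simp_all add: subtree_apply\<close>)
  moreover have "t [] = t' []" using Suc.prems(1)[of "[]"] by simp
  ultimately show ?case unfolding accepts_from_children[of M p] by simp
qed

lemma finite_nodes: "finite {d :: node. length d = n}" "finite {d :: node. length d < n}"
proof -
  from finite_lists_length_le[OF finite_directions, of n] have fin: "finite {d :: node. length d \<le> n}" by simp
  show "finite {d :: node. length d = n}" by (rule finite_subset[OF _ fin]) auto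
  show "finite {d :: node. length d < n}" by (rule finite_subset[OF _ fin]) auto
qed

lemma subtree_plug_same_length:
  assumes "length d = length d'"
  shows "subtree (plug y d s) d' = (if d' = d then s else subtree y d')"
proof -
  have "take (length d) (d' @ v) = d'" for v unfolding assms by simp
  then show ?thesis unfolding subtree_def plug_def by auto
qed

lemma plug_above: "length u < length d \<Longrightarrow> plug y d s u = y u"
  by (auto simp: plug_def dest: arg_cong[of _ _ length])

lemma pair_tree_apply: "pair_tree x y u = [x u, y u]"
  by (simp add: pair_tree_def convolution_def)

context recognizable_wellorder
begin

definition accepted_from :: "'a tree \<Rightarrow> 'a tree \<Rightarrow> 'p set" where
  "accepted_from x y = {p. accepts_from B p (pair_tree x y)}"

text \<open>What the automata see of a subtree \<open>s\<close> at a place where the tree that bounds the initial segment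
  has the subtree \<open>z\<close>: its states of acceptance, its comparison with \<open>z\<close>, and its behaviour on the
  diagonal, which matters when two trees that share \<open>s\<close> are compared.\<close>

definition profile :: "'a tree \<Rightarrow> 'a tree \<Rightarrow> 'q set \<times> 'p set \<times> 'p set" where
  "profile z s = ({q. accepts_from A q s}, accepted_from s z, accepted_from s s)"

definition profiles where
  "profiles = Pow (states A) \<times> Pow (states B) \<times> Pow (states B)"

lemma finite_profiles: "finite profiles"
  using muller_A muller_B by (simp add: profiles_def muller_automaton_def)

lemma accepted_from_subset: "accepted_from x y \<subseteq> states B"
  unfolding accepted_from_def using accepts_from_in_states[OF muller_B] by blast

lemma profile_in_profiles: "profile z s \<in> profiles"
  using accepts_from_in_states[OF muller_A] accepted_from_subset by (auto simp: profile_def profiles_def)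

text \<open>The order on a component is described by the set of all \<open>accepted_from s s'\<close> with \<open>s\<close> below
  \<open>s'\<close>, so there are only finitely many components once \<open>z\<close> ranges over a finite set.\<close>

definition component :: "'a tree \<Rightarrow> 'q set \<times> 'p set \<times> 'p set \<Rightarrow> 'a tree set" where
  "component z P = {s. profile z s = P}"

definition component_less :: "'p set set \<Rightarrow> 'a tree \<Rightarrow> 'a tree \<Rightarrow> bool" where
  "component_less U s s' \<longleftrightarrow> accepted_from s s' \<in> U"

definition agree :: "'a tree \<Rightarrow> nat \<Rightarrow> 'a tree \<Rightarrow> 'a tree \<Rightarrow> bool" where
  "agree x n y y' \<longleftrightarrow> (\<forall>u. length u < n \<longrightarrow> y u = y' u) \<and>
     (\<forall>d. length d = n \<longrightarrow> profile (subtree x d) (subtree y d) = profile (subtree x d) (subtree y' d))"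

lemma agree_plug:
  assumes "agree x n y y'" "length d = n" "profile (subtree x d) s = profile (subtree x d) (subtree y' d)"
  shows "agree x n (plug y d s) y'"
  using assms by (auto simp: agree_def subtree_plug_same_length plug_above)

lemma agree_mem:
  assumes "agree x n y y'"
  shows "y \<in> lang A \<longleftrightarrow> y' \<in> lang A" "less y x \<longleftrightarrow> less y' x"
proof -
  have above: "y u = y' u" if "length u < n" for u
    using assms that unfolding agree_def by blast
  have below: "accepts_from A q (subtree y d) = accepts_from A q (subtree y' d)"
    "accepts_from B p (subtree (pair_tree y x) d) = accepts_from B p (subtree (pair_tree y' x) d)"
    if "length d = n" for d p q
  proof -
    have "profile (subtree x d) (subtree y d) = profile (subtree x d) (subtree y' d)"
      using assms that unfolding agree_def by blast
    then show "accepts_from A q (subtree y d) = accepts_from A q (subtree y' d)"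
      "accepts_from B p (subtree (pair_tree y x) d) = accepts_from B p (subtree (pair_tree y' x) d)"
      unfolding profile_def accepted_from_def subtree_pair_tree by blast+
  qed
  show "y \<in> lang A \<longleftrightarrow> y' \<in> lang A"
    unfolding mem_A by (rule accepts_from_depth_cong[of n]) (use above below in blast)+
  show "less y x \<longleftrightarrow> less y' x"
    unfolding less_B by (rule accepts_from_depth_cong[of n]) (use above below in \<open>auto simp: pair_tree_apply\<close>)
qed

text \<open>Two trees that differ only below \<open>d\<close> are compared by what the order automaton sees of the pair of
  subtrees there and of the diagonal elsewhere, and the class determines the latter.\<close>

lemma less_plug_agree:
  assumes agree: "agree x n y y'" and d: "length d = n"
    and acc: "accepted_from s1 s2 = accepted_from s1' s2'"
  shows "less (plug y d s1) (plug y d s2) \<longleftrightarrow> less (plug y' d s1') (plug y' d s2')"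
  unfolding less_B
proof (rule accepts_from_depth_cong[of n])
  fix u :: node assume "length u < n"
  then show "pair_tree (plug y d s1) (plug y d s2) u = pair_tree (plug y' d s1') (plug y' d s2') u"
    using agree d by (simp add: pair_tree_apply plug_above agree_def)
next
  fix d' :: node and q assume d': "length d' = n"
  have "accepted_from (subtree y d') (subtree y d') = accepted_from (subtree y' d') (subtree y' d')"
    using agree d' by (simp add: agree_def profile_def)
  then show "accepts_from B q (subtree (pair_tree (plug y d s1) (plug y d s2)) d') \<longleftrightarrow>
      accepts_from B q (subtree (pair_tree (plug y' d s1') (plug y' d s2')) d')"
    using acc d d' by (auto simp: subtree_plug_same_length accepted_from_def)
qed

text \<open>A class of the relation \<open>agree\<close> is the full product of its components, and the order on it
  extends the componentwise order: coordinates can be changed one at a time.\<close>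

lemma class_box:
  fixes x y0 :: "'a tree" and n k :: nat
  assumes x: "x \<in> lang A" and y0: "y0 \<in> lang A" "less y0 x"
  defines "W \<equiv> {y. agree x n y y0}"
  defines "C \<equiv> \<lambda>d. component (subtree x d) (profile (subtree x d) (subtree y0 d))"
  shows "\<exists>U. (\<forall>d. length d = n \<longrightarrow> U d \<subseteq> Pow (states B) \<and>
      (\<forall>s\<in>C d. plug y0 d s \<in> W) \<and>
      (\<forall>s\<in>C d. \<forall>s'\<in>C d. component_less (U d) s s' \<longrightarrow> less (plug y0 d s) (plug y0 d s'))) \<and>
    ((\<forall>d. length d = n \<longrightarrow> small k (C d) (component_less (U d))) \<longrightarrow> small k W less)"
proof -
  define U where "U d = {accepted_from s s' | s s'. s \<in> C d \<and> s' \<in> C d \<and> less (plug y0 d s) (plug y0 d s')}" for d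
  have W: "y \<in> lang A" if "y \<in> W" for y
    using that agree_mem(1)[of x n y y0] y0 by (simp add: W_def)
  have C: "plug y d s \<in> W" if "y \<in> W" "length d = n" "s \<in> C d" for y d s
    using that agree_plug by (simp add: W_def C_def component_def)
  have y0W: "y0 \<in> W" by (simp add: W_def agree_def)
  have sub: "subtree y d \<in> C d" if "y \<in> W" "length d = n" for y d
    using that by (simp add: W_def C_def component_def agree_def)
  have U: "component_less (U d) s s' \<longleftrightarrow> less (plug y d s) (plug y d s')"
    if d: "length d = n" and y: "y \<in> W" and s: "s \<in> C d" "s' \<in> C d" for d y s s'
  proof
    assume "component_less (U d) s s'"
    then obtain s1 s1' where "accepted_from s s' = accepted_from s1 s1'" "less (plug y0 d s1) (plug y0 d s1')"
      unfolding component_less_def U_def by blast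
    then show "less (plug y d s) (plug y d s')"
      using less_plug_agree[of x n y y0 d s s' s1 s1'] y d by (simp add: W_def)
  next
    assume "less (plug y d s) (plug y d s')"
    then have "less (plug y0 d s) (plug y0 d s')"
      using less_plug_agree[of x n y y0 d s s' s s'] y d by (simp add: W_def)
    then show "component_less (U d) s s'"
      using s unfolding component_less_def U_def by blast
  qed
  have chain: "\<not> less w' w"
    if w: "w \<in> W" "w' \<in> W" and le: "\<And>d. length d = n \<Longrightarrow>
      subtree w d = subtree w' d \<or> component_less (U d) (subtree w d) (subtree w' d)" for w w'
  proof -
    \<comment> \<open>the coordinates in \<open>E\<close> have already been changed from those of \<open>w\<close> to those of \<open>w'\<close>\<close>
    define mix where "mix E = (\<lambda>u. if n \<le> length u \<and> take n u \<in> E then w' u else w u)" for E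
    have "mix E \<in> W \<and> (mix E = w \<or> less w (mix E))" if "finite E" "E \<subseteq> {d. length d = n}" for E
      using that
    proof (induction E)
      case empty
      then show ?case using w by (simp add: mix_def)
    next
      case (insert d E)
      then have d: "length d = n" and IH: "mix E \<in> W" "mix E = w \<or> less w (mix E)" by simp_all
      have "subtree (mix E) d = subtree w d"
        using insert.hyps d by (auto simp: mix_def subtree_def)
      then have eq: "mix E = plug (mix E) d (subtree w d)" by (metis plug_subtree)
      have eq': "mix (insert d E) = plug (mix E) d (subtree w' d)"
      proof
        fix u
        show "mix (insert d E) u = plug (mix E) d (subtree w' d) u"
        proof (cases "take n u = d")
          case True
          then have "n \<le> length u" using d by (metis length_take min.absorb_iff2 min.commute)
          moreover have "w' u = w' (d @ drop n u)" using True by (metis append_take_drop_id)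
          ultimately show ?thesis using True d by (simp add: mix_def plug_def subtree_def)
        next
          case False
          then show ?thesis using d by (auto simp: mix_def plug_def)
        qed
      qed
      have "mix (insert d E) \<in> W" unfolding eq' by (rule C[OF IH(1) d sub[OF w(2) d]])
      moreover have "mix E = mix (insert d E) \<or> less (mix E) (mix (insert d E))"
        using le[OF d] U[OF d IH(1) sub[OF w(1) d] sub[OF w(2) d]] eq eq' by metis
      ultimately show ?case using IH(2) trans W w(1) IH(1) by metis
    qed
    from this[OF finite_nodes(1)] have mix: "mix {d. length d = n} = w \<or> less w (mix {d. length d = n})" by blast
    have "w u = w' u" if "length u < n" for u using w that by (simp add: W_def agree_def)
    then have "mix {d. length d = n} = w'"
      by (fastforce simp: mix_def fun_eq_iff not_le)
    with mix show ?thesis using irrefl trans W w by metis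
  qed
  have "small k W less" if sm: "\<And>d. length d = n \<Longrightarrow> small k (C d) (component_less (U d))"
  proof -
    have "\<forall>d. \<exists>\<gamma> f. length d = n \<longrightarrow> \<gamma> < {#k#} \<and> (\<forall>s\<in>C d. f s < {#\<gamma>#}) \<and>
        (\<forall>s\<in>C d. \<forall>t\<in>C d. component_less (U d) s t \<longrightarrow> f s < f t)"
      using sm unfolding small_def embeds_def by blast
    then obtain \<gamma> f where \<gamma>: "\<And>d. length d = n \<Longrightarrow> \<gamma> d < {#k#}"
      and f: "\<And>d s. length d = n \<Longrightarrow> s \<in> C d \<Longrightarrow> f d s < {#\<gamma> d#}"
        "\<And>d s t. length d = n \<Longrightarrow> s \<in> C d \<Longrightarrow> t \<in> C d \<Longrightarrow> component_less (U d) s t \<Longrightarrow> f d s < f d t"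
      by metis
    have "embeds W less {#\<Sum>d\<in>{d. length d = n}. \<gamma> d#}"
    proof (rule embeds_box[where \<phi> = "\<lambda>d w. f d (subtree w d)"])
      show "finite {d :: node. length d = n}" by (rule finite_nodes)
      show "transp_on W less" by (rule transp_onI) (use trans W in blast)
      show "f d (subtree w d) < {#\<gamma> d#}" if "d \<in> {d. length d = n}" "w \<in> W" for d w
        by (rule f(1)) (use that sub in simp_all)
      fix w w' assume w: "w \<in> W" "w' \<in> W"
        and le: "\<forall>d\<in>{d. length d = n}. f d (subtree w d) \<le> f d (subtree w' d)"
      show "\<not> less w' w"
      proof (rule chain[OF w])
        fix d :: node assume d: "length d = n"
        have "\<not> component_less (U d) (subtree w' d) (subtree w d)"
          using f(2)[OF d sub[OF w(2) d] sub[OF w(1) d]] le d by (auto simp: not_less[symmetric])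
        then show "subtree w d = subtree w' d \<or> component_less (U d) (subtree w d) (subtree w' d)"
          using U[OF d y0W sub[OF w(1) d] sub[OF w(2) d]] U[OF d y0W sub[OF w(2) d] sub[OF w(1) d]]
            total[OF W[OF C[OF y0W d sub[OF w(1) d]]] W[OF C[OF y0W d sub[OF w(2) d]]]]
          by (metis subtree_plug)
      qed
    qed
    moreover have "(\<Sum>d\<in>{d. length d = n}. \<gamma> d) < {#k#}"
      using \<gamma> by (intro sum_less_single) simp
    ultimately show ?thesis unfolding small_def by blast
  qed
  moreover have "U d \<subseteq> Pow (states B)" for d
    using accepted_from_subset by (auto simp: U_def)
  ultimately show ?thesis
    using C[OF y0W] U[OF _ y0W] by (intro exI[of _ U]) blast
qed

text \<open>A finite union of small classes would be small, so some class is not small, and by \<open>class_box\<close> one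
  of its components is not small either. Changing a single coordinate embeds this component into
  the initial segment, which bounds it from above.\<close>

lemma large_segment_has_large_component:
  assumes x: "x \<in> lang A" and n: "\<And>d. length d = n \<Longrightarrow> subtree x d \<in> Z" and k: "k \<ge> 1"
    and large: "\<not> small k {y \<in> lang A. less y x} less"
    and upper: "small (Suc k) {y \<in> lang A. less y x} less"
  shows "\<exists>z\<in>Z. \<exists>P\<in>profiles. \<exists>U\<in>Pow (Pow (states B)).
    \<not> small k (component z P) (component_less U) \<and> small (Suc k) (component z P) (component_less U)"
proof -
  define Y where "Y = {y \<in> lang A. less y x}"
  define key where "key y = ((\<lambda>u. (u, y u)) ` {u. length u < n},
      (\<lambda>d. (d, profile (subtree x d) (subtree y d))) ` {d. length d = n})" for y
  have "key y \<in> Pow ({u. length u < n} \<times> alphabet A) \<times> Pow ({d. length d = n} \<times> profiles)" if "y \<in> Y" for y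
    using that profile_in_profiles by (auto simp: key_def Y_def lang_def trees_def)
  then have "key ` Y \<subseteq> Pow ({u. length u < n} \<times> alphabet A) \<times> Pow ({d. length d = n} \<times> profiles)" by blast
  then have fin: "finite (key ` Y)"
    by (rule finite_subset) (use finite_nodes finite_profiles muller_A in \<open>simp add: muller_automaton_def\<close>)
  have key_agree: "agree x n y y'" if eq: "key y = key y'" for y y'
  proof -
    have 1: "(\<lambda>u. (u, y u)) ` {u. length u < n} = (\<lambda>u. (u, y' u)) ` {u. length u < n}"
      and 2: "(\<lambda>d. (d, profile (subtree x d) (subtree y d))) ` {d. length d = n} =
        (\<lambda>d. (d, profile (subtree x d) (subtree y' d))) ` {d. length d = n}"
      using eq by (simp_all add: key_def)
    have "y u = y' u" if "length u < n" for u
    proof -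
      have "(u, y u) \<in> (\<lambda>u. (u, y' u)) ` {u. length u < n}" unfolding 1[symmetric] using that by blast
      then show ?thesis by blast
    qed
    moreover have "profile (subtree x d) (subtree y d) = profile (subtree x d) (subtree y' d)"
      if "length d = n" for d
    proof -
      have "(d, profile (subtree x d) (subtree y d)) \<in>
          (\<lambda>d. (d, profile (subtree x d) (subtree y' d))) ` {d. length d = n}"
        unfolding 2[symmetric] using that by blast
      then show ?thesis by blast
    qed
    ultimately show ?thesis unfolding agree_def by blast
  qed
  have trans_Y: "transp_on Y less"
    by (rule transp_onI) (use trans in \<open>auto simp: Y_def\<close>)
  have "\<exists>c\<in>key ` Y. \<not> small k {y \<in> Y. key y = c} less"
  proof (rule ccontr)
    assume "\<not> ?thesis"
    then have *: "\<And>c. c \<in> key ` Y \<Longrightarrow> small k {y \<in> Y. key y = c} less" by blast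
    have eq: "(\<Union>c\<in>key ` Y. {y \<in> Y. key y = c}) = Y" by blast
    have "small k (\<Union>c\<in>key ` Y. {y \<in> Y. key y = c}) less"
      by (rule small_UN[OF fin _ * k]) (use trans_Y eq in simp_all)
    then have "small k Y less" unfolding eq .
    then show False using large by (simp add: Y_def)
  qed
  then obtain y0 where y0: "y0 \<in> Y" "\<not> small k {y \<in> Y. key y = key y0} less" by blast
  then have y0': "y0 \<in> lang A" "less y0 x" by (simp_all add: Y_def)
  define C where "C d = component (subtree x d) (profile (subtree x d) (subtree y0 d))" for d
  obtain U where "\<forall>d. length d = n \<longrightarrow> U d \<subseteq> Pow (states B) \<and>
      (\<forall>s\<in>C d. plug y0 d s \<in> {y. agree x n y y0}) \<and>
      (\<forall>s\<in>C d. \<forall>s'\<in>C d. component_less (U d) s s' \<longrightarrow> less (plug y0 d s) (plug y0 d s'))"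
    and box: "(\<forall>d. length d = n \<longrightarrow> small k (C d) (component_less (U d))) \<longrightarrow>
      small k {y. agree x n y y0} less"
    using class_box[OF x y0', of n k] unfolding C_def by (elim exE conjE)
  then have U: "U d \<subseteq> Pow (states B)"
    "s \<in> C d \<Longrightarrow> agree x n (plug y0 d s) y0"
    "s \<in> C d \<Longrightarrow> s' \<in> C d \<Longrightarrow> component_less (U d) s s' \<Longrightarrow> less (plug y0 d s) (plug y0 d s')"
    if "length d = n" for d s s'
    using that by simp_all
  have "{y \<in> Y. key y = key y0} \<subseteq> {y. agree x n y y0}" using key_agree by blast
  then have "\<not> small k {y. agree x n y y0} less" using y0(2) small_subset by blast
  then obtain d where d: "length d = n" "\<not> small k (C d) (component_less (U d))" using box by blast
  have "small (Suc k) (C d) (component_less (U d))"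
  proof (rule small_image[OF upper, where f = "plug y0 d"])
    fix s assume "s \<in> C d"
    then have "agree x n (plug y0 d s) y0" by (rule U(2)[OF d(1)])
    from agree_mem[OF this] show "plug y0 d s \<in> {y \<in> lang A. less y x}" using y0' by blast
  qed (rule U(3)[OF d(1)])
  with d U(1)[OF d(1)] n[OF d(1)] profile_in_profiles show ?thesis unfolding C_def by blast
qed

text \<open>The segment below \<open>g {#{#k#}#}\<close> requires a component whose type lies between two successive
  members of the sequence of ordinals \<open>{#{#k#}#}\<close>. Different \<open>k\<close> require different components, but
  there are only finitely many.\<close>

theorem no_cofinal_segments:
  assumes g: "\<And>z :: cnf. g z \<in> lang A" "\<And>z z'. z < z' \<Longrightarrow> less (g z) (g z')"
    and initial: "\<And>z y. y \<in> lang A \<Longrightarrow> less y (g z) \<Longrightarrow> y \<in> range g"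
  shows False
proof -
  obtain Z where Z: "finite Z" "\<And>t. t \<in> lang A \<Longrightarrow> \<exists>n. \<forall>d. length d = n \<longrightarrow> subtree t d \<in> Z"
    using finitely_many_ends by blast
  have g_less: "z < z'" if "less (g z) (g z')" for z z'
    using that g irrefl trans by (metis linorder_neqE)
  define X where "X k = {y \<in> lang A. less y (g {#{#k#}#})}" for k
  have X: "y \<in> X k \<longleftrightarrow> (\<exists>z<{#{#k#}#}. y = g z)" for y k
    using g initial g_less unfolding X_def by blast
  have large: "\<not> small k (X k) less" for k
    by (rule initial_segment_not_small[where g = g]) (use X g in blast)+
  have upper: "small (Suc k) (X k) less" for k
  proof (rule small_Suc[where f = "inv g"])
    have inj: "inj g" using g irrefl by (metis injI linorder_neqE)
    show "inv g s < {#{#k#}#}" if "s \<in> X k" for s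
      using that X inj by auto
    show "inv g s < inv g t" if "s \<in> X k" "t \<in> X k" "less s t" for s t
      using that X inj g_less by auto
  qed
  define J where "J = Z \<times> profiles \<times> Pow (Pow (states B))"
  have "finite J"
    using Z(1) finite_profiles muller_B by (simp add: J_def muller_automaton_def)
  have "\<exists>j\<in>J. k \<ge> 1 \<longrightarrow> (case j of (z, P, U) \<Rightarrow> \<not> small k (component z P) (component_less U) \<and>
      small (Suc k) (component z P) (component_less U))" if "k \<ge> 1" for k
  proof -
    obtain n where "\<And>d. length d = n \<Longrightarrow> subtree (g {#{#k#}#}) d \<in> Z" using Z(2) g(1) by blast
    from large_segment_has_large_component[OF g(1) this that] large[of k] upper[of k]
    show ?thesis unfolding X_def J_def by fastforce
  qed
  then obtain j where j: "\<And>k. k \<ge> 1 \<Longrightarrow> j k \<in> J" "\<And>k z P U. k \<ge> 1 \<Longrightarrow> j k = (z, P, U) \<Longrightarrow>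
      \<not> small k (component z P) (component_less U) \<and> small (Suc k) (component z P) (component_less U)"
    by (metis (no_types, lifting) case_prodD)
  have neq: "j k \<noteq> j k'" if "1 \<le> k" "k < k'" for k k'
  proof
    assume eq: "j k = j k'"
    obtain z P U where zPU: "j k = (z, P, U)" by (metis prod.exhaust)
    have "small (Suc k) (component z P) (component_less U)" using j(2)[OF that(1) zPU] by blast
    then have "small k' (component z P) (component_less U)" by (rule small_mono) (use that in simp)
    then show False using j(2)[of k' z P U] eq zPU that by simp
  qed
  have "inj_on j {1..}"
    by (rule inj_onI) (metis neq atLeast_iff linorder_neqE_nat)
  moreover have "j ` {1..} \<subseteq> J" using j(1) by auto
  ultimately have "finite {1::nat..}" using \<open>finite J\<close> by (rule inj_on_finite)
  then show False by (simp add: infinite_Ici)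
qed

end

section \<open>Constructions on Muller tree automata\<close>

lemma inf_often_finite_image:
  assumes "finite (range \<sigma>)"
  shows "inf_often (\<lambda>n. h (\<sigma> n)) = h ` inf_often \<sigma>"
proof
  show "h ` inf_often \<sigma> \<subseteq> inf_often (\<lambda>n. h (\<sigma> n))"
    unfolding inf_often_def by (auto elim!: infinite_super[rotated])
  show "inf_often (\<lambda>n. h (\<sigma> n)) \<subseteq> h ` inf_often \<sigma>"
  proof
    fix q assume "q \<in> inf_often (\<lambda>n. h (\<sigma> n))"
    then have inf: "infinite {n. h (\<sigma> n) = q}" by (simp add: inf_often_def)
    have "{n. h (\<sigma> n) = q} = (\<Union>p\<in>{p \<in> range \<sigma>. h p = q}. {n. \<sigma> n = p})" by auto
    moreover have "finite {p \<in> range \<sigma>. h p = q}" using assms by simp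
    ultimately obtain p where "h p = q" "infinite {n. \<sigma> n = p}"
      using inf by (metis (mono_tags, lifting) finite_UN mem_Collect_eq)
    then show "q \<in> h ` inf_often \<sigma>" by (auto simp: inf_often_def)
  qed
qed

lemma inf_often_eventually_const:
  assumes "\<And>n. n \<ge> N \<Longrightarrow> \<sigma> n = c"
  shows "inf_often \<sigma> = {c}"
proof -
  have "inf_often \<sigma> = inf_often (\<lambda>n. \<sigma> (n + N))" by (rule inf_often_shift[symmetric])
  also have "(\<lambda>n. \<sigma> (n + N)) = (\<lambda>n. c)" using assms by simp
  also have "inf_often (\<lambda>n. c) = {c}" by (auto simp: inf_often_def)
  finally show ?thesis .
qed

lemma accepting_run_in_states:
  assumes "muller_automaton M" "accepting_run_from M p t \<rho>"
  shows "\<rho> u \<in> states M" "t u \<in> alphabet M"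
  using assms unfolding muller_automaton_def accepting_run_from_def by blast+

lemma finite_run_range:
  assumes "muller_automaton M" "accepting_run_from M p t \<rho>"
  shows "finite (range (\<lambda>n. \<rho> (branch_prefix \<pi> n)))"
proof (rule finite_subset)
  show "range (\<lambda>n. \<rho> (branch_prefix \<pi> n)) \<subseteq> states M" using accepting_run_in_states(1)[OF assms] by blast
  show "finite (states M)" using assms(1) by (simp add: muller_automaton_def)
qed

lemma inf_states_finite_image:
  assumes "finite (range (\<lambda>n. \<rho> (branch_prefix \<pi> n)))"
  shows "inf_states (\<lambda>u. h (\<rho> u)) \<pi> = h ` inf_states \<rho> \<pi>"
  unfolding inf_states_eq using inf_often_finite_image[OF assms] .

lemma inf_states_subset: "range \<rho> \<subseteq> S \<Longrightarrow> inf_states \<rho> \<pi> \<subseteq> S"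
  unfolding inf_states_eq inf_often_def by (auto dest!: not_finite_existsD)

definition rename :: "('q \<Rightarrow> 'r) \<Rightarrow> ('q, 'a) muller \<Rightarrow> ('r, 'a) muller" where
  "rename h M = \<lparr>states = h ` states M, alphabet = alphabet M,
     transitions = (\<lambda>(p, a, q, r). (h p, a, h q, h r)) ` transitions M,
     initial = h (initial M), acceptance = (`) h ` acceptance M\<rparr>"

lemma muller_rename:
  assumes "muller_automaton M"
  shows "muller_automaton (rename h M)"
proof -
  have "p \<in> states M \<and> a \<in> alphabet M \<and> q \<in> states M \<and> r \<in> states M"
    if "(p, a, q, r) \<in> transitions M" for p a q r
    using that assms unfolding muller_automaton_def by blast
  then have "transitions (rename h M) \<subseteq> h ` states M \<times> alphabet M \<times> h ` states M \<times> h ` states M"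
    unfolding rename_def by auto
  moreover have "acceptance M \<subseteq> Pow (states M)" using assms by (simp add: muller_automaton_def)
  then have "acceptance (rename h M) \<subseteq> Pow (h ` states M)" unfolding rename_def by auto
  ultimately show ?thesis
    using assms unfolding muller_automaton_def by (simp add: rename_def)
qed

lemma lang_rename:
  assumes M: "muller_automaton M" and h: "inj_on h (states M)"
  shows "lang (rename h M) = lang M"
proof -
  have tr: "transitions M \<subseteq> states M \<times> alphabet M \<times> states M \<times> states M" "initial M \<in> states M"
    "acceptance M \<subseteq> Pow (states M)"
    using M by (simp_all add: muller_automaton_def)
  have "t \<in> lang (rename h M) \<longleftrightarrow> t \<in> lang M" for t
  proof
    assume "t \<in> lang M"
    then obtain \<rho> where \<rho>: "accepting_run_from M (initial M) t \<rho>"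
      unfolding lang_iff_accepts_from[OF M] accepts_from_def by blast
    have "inf_states (\<lambda>u. h (\<rho> u)) \<pi> \<in> acceptance (rename h M)" for \<pi>
      using \<rho> inf_states_finite_image[OF finite_run_range[OF M \<rho>], of h \<pi>]
      by (simp add: rename_def accepting_run_from_def accepting_def)
    moreover have "(h (\<rho> u), t u, h (\<rho> (u @ [Lft])), h (\<rho> (u @ [Rgt]))) \<in> transitions (rename h M)" for u
    proof -
      have "(\<rho> u, t u, \<rho> (u @ [Lft]), \<rho> (u @ [Rgt])) \<in> transitions M"
        using \<rho> by (simp add: accepting_run_from_def)
      from imageI[OF this, of "\<lambda>(p, a, q, r). (h p, a, h q, h r)"] show ?thesis by (simp add: rename_def)
    qed
    moreover have "h (\<rho> []) = initial (rename h M)"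
      using \<rho> by (simp add: rename_def accepting_run_from_def)
    ultimately have "accepting_run_from (rename h M) (initial (rename h M)) t (\<lambda>u. h (\<rho> u))"
      unfolding accepting_run_from_def accepting_def by blast
    then show "t \<in> lang (rename h M)"
      unfolding lang_iff_accepts_from[OF muller_rename[OF M]] accepts_from_def by blast
  next
    assume "t \<in> lang (rename h M)"
    then obtain \<rho> where \<rho>: "accepting_run_from (rename h M) (initial (rename h M)) t \<rho>"
      unfolding lang_iff_accepts_from[OF muller_rename[OF M]] accepts_from_def by blast
    define g where "g = inv_into (states M) h"
    have g: "g (h p) = p" if "p \<in> states M" for p unfolding g_def using h that by (rule inv_into_f_f)
    have "inf_states (\<lambda>u. g (\<rho> u)) \<pi> \<in> acceptance M" for \<pi>
    proof -
      obtain F where F: "F \<in> acceptance M" "inf_states \<rho> \<pi> = h ` F"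
      proof -
        have "inf_states \<rho> \<pi> \<in> (`) h ` acceptance M"
          using \<rho> unfolding accepting_run_from_def accepting_def rename_def by simp
        then show thesis using that by blast
      qed
      have "g (h p) = p" if "p \<in> F" for p using g that F(1) tr(3) by blast
      then have "g ` inf_states \<rho> \<pi> = F" unfolding F(2) image_image by simp
      then show ?thesis
        using F(1) inf_states_finite_image[OF finite_run_range[OF muller_rename[OF M] \<rho>], of g \<pi>] by simp
    qed
    moreover have "(g (\<rho> u), t u, g (\<rho> (u @ [Lft])), g (\<rho> (u @ [Rgt]))) \<in> transitions M" for u
    proof -
      have "(\<rho> u, t u, \<rho> (u @ [Lft]), \<rho> (u @ [Rgt])) \<in> transitions (rename h M)"
        using \<rho> by (simp add: accepting_run_from_def)
      then obtain p q r where "(p, t u, q, r) \<in> transitions M"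
        "\<rho> u = h p" "\<rho> (u @ [Lft]) = h q" "\<rho> (u @ [Rgt]) = h r"
        unfolding rename_def by auto
      moreover from this(1) tr(1) have "p \<in> states M" "q \<in> states M" "r \<in> states M" by auto
      ultimately show ?thesis using g by simp
    qed
    moreover have "g (\<rho> []) = initial M"
      using \<rho> g tr(2) by (simp add: accepting_run_from_def rename_def)
    ultimately have "accepting_run_from M (initial M) t (\<lambda>u. g (\<rho> u))"
      unfolding accepting_run_from_def accepting_def by blast
    then show "t \<in> lang M" unfolding lang_iff_accepts_from[OF M] accepts_from_def by blast
  qed
  then show ?thesis by blast
qed

lemma nat_states:
  assumes "muller_automaton M"
  shows "\<exists>N :: (nat, 'a) muller. muller_automaton N \<and> alphabet N = alphabet M \<and> lang N = lang M"
proof -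
  have "finite (states M)" using assms by (simp add: muller_automaton_def)
  from finite_imp_inj_to_nat_seg[OF this] obtain h :: "_ \<Rightarrow> nat" where "inj_on h (states M)"
    by (elim exE conjE)
  then show ?thesis
    using assms by (intro exI[of _ "rename h M"]) (simp add: muller_rename lang_rename, simp add: rename_def)
qed

text \<open>The letter maps \<open>f\<close> and \<open>g\<close> let one construction cover both intersections and conditions on single
  components of a tuple.\<close>

definition product ::
  "('a \<Rightarrow> 'b) \<Rightarrow> ('a \<Rightarrow> 'c) \<Rightarrow> 'a set \<Rightarrow> ('p, 'b) muller \<Rightarrow> ('q, 'c) muller \<Rightarrow> ('p \<times> 'q, 'a) muller" where
  "product f g \<Sigma> M N = \<lparr>states = states M \<times> states N, alphabet = \<Sigma>,
     transitions = {((p, q), a, (p1, q1), (p2, q2)) | p q a p1 q1 p2 q2.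
       a \<in> \<Sigma> \<and> (p, f a, p1, p2) \<in> transitions M \<and> (q, g a, q1, q2) \<in> transitions N},
     initial = (initial M, initial N),
     acceptance = {S. S \<subseteq> states M \<times> states N \<and> fst ` S \<in> acceptance M \<and> snd ` S \<in> acceptance N}\<rparr>"

lemma muller_product:
  assumes "muller_automaton M" "muller_automaton N" "finite \<Sigma>"
  shows "muller_automaton (product f g \<Sigma> M N)"
proof -
  have "p \<in> states M \<and> q \<in> states M \<and> r \<in> states M" if "(p, a, q, r) \<in> transitions M" for p a q r
    using that assms(1) unfolding muller_automaton_def by blast
  moreover have "p \<in> states N \<and> q \<in> states N \<and> r \<in> states N" if "(p, a, q, r) \<in> transitions N" for p a q r
    using that assms(2) unfolding muller_automaton_def by blast
  ultimately have "transitions (product f g \<Sigma> M N) \<subseteq>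
      (states M \<times> states N) \<times> \<Sigma> \<times> (states M \<times> states N) \<times> (states M \<times> states N)"
    unfolding product_def by auto
  moreover have "acceptance (product f g \<Sigma> M N) \<subseteq> Pow (states M \<times> states N)"
    by (auto simp: product_def)
  moreover have "finite (states M \<times> states N)" "initial M \<in> states M" "initial N \<in> states N"
    using assms by (simp_all add: muller_automaton_def)
  ultimately show ?thesis
    using assms(3) unfolding muller_automaton_def by (simp add: product_def)
qed

lemma lang_product:
  assumes M: "muller_automaton M" and N: "muller_automaton N" and \<Sigma>: "finite \<Sigma>"
  shows "t \<in> lang (product f g \<Sigma> M N) \<longleftrightarrow>
    t \<in> trees \<Sigma> \<and> (\<lambda>u. f (t u)) \<in> lang M \<and> (\<lambda>u. g (t u)) \<in> lang N"
proof
  note MN = muller_product[OF M N \<Sigma>, of f g]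
  assume "t \<in> lang (product f g \<Sigma> M N)"
  then obtain \<rho> where \<rho>: "accepting_run_from (product f g \<Sigma> M N) (initial M, initial N) t \<rho>"
    unfolding lang_iff_accepts_from[OF MN] accepts_from_def by (auto simp: product_def)
  note img = inf_states_finite_image[OF finite_run_range[OF MN \<rho>]]
  have tr: "(\<rho> u, t u, \<rho> (u @ [Lft]), \<rho> (u @ [Rgt])) \<in> transitions (product f g \<Sigma> M N)" for u
    using \<rho> by (simp add: accepting_run_from_def)
  have acc: "inf_states \<rho> \<pi> \<in> acceptance (product f g \<Sigma> M N)" for \<pi>
    using \<rho> by (simp add: accepting_run_from_def accepting_def)
  have "accepting_run_from M (initial M) (\<lambda>u. f (t u)) (\<lambda>u. fst (\<rho> u))"
    unfolding accepting_run_from_def accepting_def img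
  proof (intro conjI allI)
    show "fst (\<rho> []) = initial M" using \<rho> by (simp add: accepting_run_from_def)
    show "(fst (\<rho> u), f (t u), fst (\<rho> (u @ [Lft])), fst (\<rho> (u @ [Rgt]))) \<in> transitions M" for u
      using tr[of u] by (auto simp: product_def)
    show "fst ` inf_states \<rho> \<pi> \<in> acceptance M" for \<pi>
      using acc[of \<pi>] by (simp add: product_def)
  qed
  moreover have "accepting_run_from N (initial N) (\<lambda>u. g (t u)) (\<lambda>u. snd (\<rho> u))"
    unfolding accepting_run_from_def accepting_def img
  proof (intro conjI allI)
    show "snd (\<rho> []) = initial N" using \<rho> by (simp add: accepting_run_from_def)
    show "(snd (\<rho> u), g (t u), snd (\<rho> (u @ [Lft])), snd (\<rho> (u @ [Rgt]))) \<in> transitions N" for u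
      using tr[of u] by (auto simp: product_def)
    show "snd ` inf_states \<rho> \<pi> \<in> acceptance N" for \<pi>
      using acc[of \<pi>] by (simp add: product_def)
  qed
  moreover have "t \<in> trees \<Sigma>"
    using accepting_run_in_states(2)[OF MN \<rho>] by (simp add: trees_def product_def)
  ultimately show "t \<in> trees \<Sigma> \<and> (\<lambda>u. f (t u)) \<in> lang M \<and> (\<lambda>u. g (t u)) \<in> lang N"
    unfolding lang_iff_accepts_from[OF M] lang_iff_accepts_from[OF N] accepts_from_def by blast
next
  note MN = muller_product[OF M N \<Sigma>, of f g]
  assume t: "t \<in> trees \<Sigma> \<and> (\<lambda>u. f (t u)) \<in> lang M \<and> (\<lambda>u. g (t u)) \<in> lang N"
  then obtain \<rho> \<rho>' where \<rho>: "accepting_run_from M (initial M) (\<lambda>u. f (t u)) \<rho>"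
    and \<rho>': "accepting_run_from N (initial N) (\<lambda>u. g (t u)) \<rho>'"
    unfolding lang_iff_accepts_from[OF M] lang_iff_accepts_from[OF N] accepts_from_def by blast
  have st: "\<rho> u \<in> states M" "\<rho>' u \<in> states N" for u
    using accepting_run_in_states(1)[OF M \<rho>] accepting_run_in_states(1)[OF N \<rho>'] by blast+
  define \<tau> where "\<tau> = (\<lambda>u. (\<rho> u, \<rho>' u))"
  have fin: "finite (range (\<lambda>n. \<tau> (branch_prefix \<pi> n)))" for \<pi>
    by (rule finite_subset[of _ "states M \<times> states N"])
      (use st M N in \<open>auto simp: \<tau>_def muller_automaton_def\<close>)
  have "inf_states \<tau> \<pi> \<in> acceptance (product f g \<Sigma> M N)" for \<pi>
  proof -
    have "fst ` inf_states \<tau> \<pi> = inf_states \<rho> \<pi>" "snd ` inf_states \<tau> \<pi> = inf_states \<rho>' \<pi>"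
      using inf_states_finite_image[OF fin, of fst \<pi>] inf_states_finite_image[OF fin, of snd \<pi>]
      by (simp_all add: \<tau>_def)
    moreover have "inf_states \<tau> \<pi> \<subseteq> states M \<times> states N"
      by (rule inf_states_subset) (use st in \<open>auto simp: \<tau>_def\<close>)
    ultimately show ?thesis
      using \<rho> \<rho>' by (simp add: product_def accepting_run_from_def accepting_def)
  qed
  moreover have "(\<tau> u, t u, \<tau> (u @ [Lft]), \<tau> (u @ [Rgt])) \<in> transitions (product f g \<Sigma> M N)" for u
    using \<rho> \<rho>' t by (simp add: product_def \<tau>_def accepting_run_from_def trees_def)
  moreover have "\<tau> [] = initial (product f g \<Sigma> M N)"
    using \<rho> \<rho>' by (simp add: product_def \<tau>_def accepting_run_from_def)
  ultimately show "t \<in> lang (product f g \<Sigma> M N)"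
    unfolding lang_iff_accepts_from[OF MN] accepts_from_def accepting_run_from_def accepting_def by blast
qed

text \<open>Fixing the second component of a relation to a tree \<open>x\<close> with finitely many subtrees: the
  automaton carries along the subtree of \<open>x\<close> at the current node.\<close>

definition section_automaton :: "'a set \<Rightarrow> ('q, 'a list) muller \<Rightarrow> 'a tree \<Rightarrow> ('q \<times> 'a tree, 'a) muller" where
  "section_automaton \<Sigma> M x = \<lparr>states = states M \<times> range (subtree x), alphabet = \<Sigma>,
     transitions = {((p, s), a, (q, subtree s [Lft]), (r, subtree s [Rgt])) | p s a q r.
       a \<in> \<Sigma> \<and> s \<in> range (subtree x) \<and> (p, [a, s []], q, r) \<in> transitions M},
     initial = (initial M, x),
     acceptance = {S. S \<subseteq> states M \<times> range (subtree x) \<and> fst ` S \<in> acceptance M}\<rparr>"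

lemma muller_section:
  assumes "muller_automaton M" "finite \<Sigma>" "finite (range (subtree x))"
  shows "muller_automaton (section_automaton \<Sigma> M x)"
proof -
  have "subtree s [d] \<in> range (subtree x)" if "s \<in> range (subtree x)" for s d
    using that by auto
  moreover have "x \<in> range (subtree x)" by (metis rangeI subtree_Nil)
  ultimately show ?thesis
    using assms unfolding muller_automaton_def section_automaton_def by auto
qed

lemma lang_section:
  assumes M: "muller_automaton M" and \<Sigma>: "finite \<Sigma>" and x: "finite (range (subtree x))"
  shows "t \<in> lang (section_automaton \<Sigma> M x) \<longleftrightarrow> t \<in> trees \<Sigma> \<and> pair_tree t x \<in> lang M"
proof
  note MX = muller_section[OF M \<Sigma> x]
  assume "t \<in> lang (section_automaton \<Sigma> M x)"
  then obtain \<rho> where \<rho>: "accepting_run_from (section_automaton \<Sigma> M x) (initial M, x) t \<rho>"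
    unfolding lang_iff_accepts_from[OF MX] accepts_from_def by (auto simp: section_automaton_def)
  note img = inf_states_finite_image[OF finite_run_range[OF MX \<rho>]]
  have tr: "(\<rho> u, t u, \<rho> (u @ [Lft]), \<rho> (u @ [Rgt])) \<in> transitions (section_automaton \<Sigma> M x)" for u
    using \<rho> by (simp add: accepting_run_from_def)
  have snd: "snd (\<rho> u) = subtree x u" for u
  proof (induction u rule: rev_induct)
    case Nil
    show ?case using \<rho> by (simp add: accepting_run_from_def)
  next
    case (snoc d u)
    show ?case using tr[of u] snoc by (cases d) (auto simp: section_automaton_def)
  qed
  have "accepting_run_from M (initial M) (pair_tree t x) (\<lambda>u. fst (\<rho> u))"
    unfolding accepting_run_from_def accepting_def img
  proof (intro conjI allI)
    show "fst (\<rho> []) = initial M" using \<rho> by (simp add: accepting_run_from_def)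
    show "(fst (\<rho> u), pair_tree t x u, fst (\<rho> (u @ [Lft])), fst (\<rho> (u @ [Rgt]))) \<in> transitions M" for u
      using tr[of u] snd[of u] by (auto simp: section_automaton_def pair_tree_apply subtree_apply)
    show "fst ` inf_states \<rho> \<pi> \<in> acceptance M" for \<pi>
      using \<rho> by (simp add: section_automaton_def accepting_run_from_def accepting_def)
  qed
  moreover have "t \<in> trees \<Sigma>"
    using accepting_run_in_states(2)[OF MX \<rho>] by (simp add: trees_def section_automaton_def)
  ultimately show "t \<in> trees \<Sigma> \<and> pair_tree t x \<in> lang M"
    unfolding lang_iff_accepts_from[OF M] accepts_from_def by blast
next
  note MX = muller_section[OF M \<Sigma> x]
  assume t: "t \<in> trees \<Sigma> \<and> pair_tree t x \<in> lang M"
  then obtain \<rho> where \<rho>: "accepting_run_from M (initial M) (pair_tree t x) \<rho>"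
    unfolding lang_iff_accepts_from[OF M] accepts_from_def by blast
  define \<tau> where "\<tau> = (\<lambda>u. (\<rho> u, subtree x u))"
  have st: "\<tau> u \<in> states M \<times> range (subtree x)" for u
    using accepting_run_in_states(1)[OF M \<rho>] by (simp add: \<tau>_def)
  have fin: "finite (range (\<lambda>n. \<tau> (branch_prefix \<pi> n)))" for \<pi>
  proof (rule finite_subset)
    show "range (\<lambda>n. \<tau> (branch_prefix \<pi> n)) \<subseteq> states M \<times> range (subtree x)" using st by blast
    show "finite (states M \<times> range (subtree x))"
      using x M by (intro finite_cartesian_product) (simp add: muller_automaton_def)
  qed
  have "inf_states \<tau> \<pi> \<in> acceptance (section_automaton \<Sigma> M x)" for \<pi>
  proof -
    have "fst ` inf_states \<tau> \<pi> = inf_states \<rho> \<pi>"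
      using inf_states_finite_image[OF fin, of fst \<pi>] by (simp add: \<tau>_def)
    moreover have "inf_states \<tau> \<pi> \<subseteq> states M \<times> range (subtree x)"
      by (rule inf_states_subset) (use st in blast)
    ultimately show ?thesis
      using \<rho> by (simp add: section_automaton_def accepting_run_from_def accepting_def)
  qed
  moreover have "(\<tau> u, t u, \<tau> (u @ [Lft]), \<tau> (u @ [Rgt])) \<in> transitions (section_automaton \<Sigma> M x)" for u
    using \<rho> t by (simp add: section_automaton_def \<tau>_def accepting_run_from_def trees_def
        pair_tree_apply subtree_apply)
  moreover have "\<tau> [] = initial (section_automaton \<Sigma> M x)"
    using \<rho> by (simp add: section_automaton_def \<tau>_def accepting_run_from_def)
  ultimately show "t \<in> lang (section_automaton \<Sigma> M x)"
    unfolding lang_iff_accepts_from[OF MX] accepts_from_def accepting_run_from_def accepting_def by blast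
qed

section \<open>Comparing trees at the last difference\<close>

text \<open>The depth-first order: a node precedes its descendants, and left subtrees precede right ones.\<close>

fun precedes :: "node \<Rightarrow> node \<Rightarrow> bool" where
  "precedes u [] \<longleftrightarrow> False"
| "precedes [] (d # v) \<longleftrightarrow> True"
| "precedes (d # u) (e # v) \<longleftrightarrow> (if d = e then precedes u v else d = Lft)"

lemma precedes_irrefl [simp]: "\<not> precedes u u"
  by (induction u) auto

lemma precedes_total: "u \<noteq> v \<Longrightarrow> precedes u v \<or> precedes v u"
proof (induction u v rule: precedes.induct)
  case (3 d u e v)
  then show ?case by (cases d; cases e) auto
qed (auto simp: neq_Nil_conv)

lemma precedes_append [simp]: "precedes (w @ u) (w @ v) \<longleftrightarrow> precedes u v"
  by (induction w) auto

definition tree_less :: "nat tree \<Rightarrow> nat tree \<Rightarrow> bool" where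
  "tree_less t t' \<longleftrightarrow> (\<exists>v. t v < t' v \<and> (\<forall>u. precedes v u \<longrightarrow> t u = t' u))"

text \<open>The last difference is at the root, in the left subtree, or in the right subtree; this recursion is
  what the automaton below implements.\<close>

lemma tree_less_children:
  "tree_less t t' \<longleftrightarrow>
     t [] < t' [] \<and> subtree t [Lft] = subtree t' [Lft] \<and> subtree t [Rgt] = subtree t' [Rgt] \<or>
     tree_less (subtree t [Lft]) (subtree t' [Lft]) \<and> subtree t [Rgt] = subtree t' [Rgt] \<or>
     tree_less (subtree t [Rgt]) (subtree t' [Rgt])" (is "_ \<longleftrightarrow> ?here \<or> ?left \<or> ?right")
proof
  assume "tree_less t t'"
  then obtain v where v: "t v < t' v" "\<And>u. precedes v u \<Longrightarrow> t u = t' u"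
    unfolding tree_less_def by blast
  show "?here \<or> ?left \<or> ?right"
  proof (cases v)
    case Nil
    then show ?thesis using v by (simp add: subtree_def fun_eq_iff)
  next
    case (Cons d w)
    have "tree_less (subtree t [d]) (subtree t' [d])"
      unfolding tree_less_def using v Cons by (intro exI[of _ w]) (simp add: subtree_def)
    moreover have "subtree t [Rgt] = subtree t' [Rgt]" if "d = Lft"
      using v Cons that by (simp add: subtree_def fun_eq_iff)
    ultimately show ?thesis by (cases d) simp_all
  qed
next
  assume "?here \<or> ?left \<or> ?right"
  then consider ?here | ?left | ?right by blast
  then show "tree_less t t'"
  proof cases
    case 1
    have "t u = t' u" if "precedes [] u" for u
    proof (cases u)
      case (Cons d u')
      have "subtree t [d] = subtree t' [d]" using 1 by (cases d) simp_all
      then show ?thesis using Cons by (simp add: subtree_def fun_eq_iff)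
    qed (use that in simp)
    with 1 show ?thesis unfolding tree_less_def by blast
  next
    case 2
    then obtain w where w: "t (Lft # w) < t' (Lft # w)" "\<And>u. precedes w u \<Longrightarrow> t (Lft # u) = t' (Lft # u)"
      and eq: "\<And>u. t (Rgt # u) = t' (Rgt # u)"
      unfolding tree_less_def by (auto simp: subtree_def fun_eq_iff)
    have "t u = t' u" if "precedes (Lft # w) u" for u
    proof (cases u)
      case (Cons d u')
      then show ?thesis using that w eq by (cases d) simp_all
    qed (use that in simp)
    with w show ?thesis unfolding tree_less_def by blast
  next
    case 3
    then obtain w where w: "t (Rgt # w) < t' (Rgt # w)" "\<And>u. precedes w u \<Longrightarrow> t (Rgt # u) = t' (Rgt # u)"
      unfolding tree_less_def by (auto simp: subtree_def)
    have "t u = t' u" if "precedes (Rgt # w) u" for u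
    proof (cases u)
      case (Cons d u')
      then show ?thesis using that w by (cases d) simp_all
    qed (use that in simp)
    with w show ?thesis unfolding tree_less_def by blast
  qed
qed

text \<open>State \<open>1\<close> means that the last difference lies in the current subtree, which has to be confirmed
  at some node since no branch may stay in \<open>1\<close>; the states \<open>0\<close> and \<open>2\<close> demand equality
  and nothing, respectively.\<close>

definition less_automaton :: "(nat, nat list) muller" where
  "less_automaton = \<lparr>states = {0, 1, 2}, alphabet = tuples 2 {0, 1},
     transitions = {(0, [a, a], 0, 0) | a. a \<in> {0, 1}} \<union> {(2, c, 2, 2) | c. c \<in> tuples 2 {0, 1}} \<union>
       {(1, [0, 1], 0, 0)} \<union> {(1, c, 1, 0) | c. c \<in> tuples 2 {0, 1}} \<union> {(1, c, 2, 1) | c. c \<in> tuples 2 {0, 1}},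
     initial = 1, acceptance = {{0}, {2}}\<rparr>"

lemma tuples_2: "tuples 2 S = {[a, b] | a b. a \<in> S \<and> b \<in> S}"
  by (auto simp: tuples_def numeral_2_eq_2 length_Suc_conv)

lemma finite_tuples_2: "finite S \<Longrightarrow> finite (tuples 2 S)"
proof -
  assume "finite S"
  moreover have "tuples 2 S = (\<lambda>(a, b). [a, b]) ` (S \<times> S)" by (auto simp: tuples_2)
  ultimately show ?thesis by simp
qed

lemma muller_less_automaton: "muller_automaton less_automaton"
  using finite_tuples_2[of "{0, 1 :: nat}"]
  by (auto simp: muller_automaton_def less_automaton_def tuples_2)

lemma pair_tree_in_trees: "pair_tree t t' \<in> trees (tuples 2 S) \<longleftrightarrow> t \<in> trees S \<and> t' \<in> trees S"
  by (auto simp: trees_def pair_tree_apply tuples_2)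

lemma less_automaton_constant:
  assumes "t \<in> trees {0, 1}" "t' \<in> trees {0, 1}"
  shows "accepts_from less_automaton 0 (pair_tree t t') \<longleftrightarrow> t = t'"
    and "accepts_from less_automaton 2 (pair_tree t t')"
proof -
  have [simp]: "inf_states (\<lambda>u. c) \<pi> = {c}" for c :: nat and \<pi>
    unfolding inf_states_eq by (rule inf_often_eventually_const) simp
  have t: "t u \<in> {0, 1}" "t' u \<in> {0, 1}" for u using assms by (simp_all add: trees_def)
  have "accepting_run_from less_automaton 2 (pair_tree t t') (\<lambda>_. 2)"
    using t by (auto simp: accepting_run_from_def accepting_def less_automaton_def pair_tree_apply tuples_2)
  then show "accepts_from less_automaton 2 (pair_tree t t')" unfolding accepts_from_def by blast
  show "accepts_from less_automaton 0 (pair_tree t t') \<longleftrightarrow> t = t'"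
  proof
    assume "t = t'"
    then have "accepting_run_from less_automaton 0 (pair_tree t t') (\<lambda>_. 0)"
      using t by (auto simp: accepting_run_from_def accepting_def less_automaton_def pair_tree_apply tuples_2)
    then show "accepts_from less_automaton 0 (pair_tree t t')" unfolding accepts_from_def by blast
  next
    assume "accepts_from less_automaton 0 (pair_tree t t')"
    then obtain \<rho> where \<rho>: "accepting_run_from less_automaton 0 (pair_tree t t') \<rho>"
      unfolding accepts_from_def by blast
    have tr: "(\<rho> u, pair_tree t t' u, \<rho> (u @ [Lft]), \<rho> (u @ [Rgt])) \<in> transitions less_automaton" for u
      using \<rho> by (simp add: accepting_run_from_def)
    have zero: "\<rho> u = 0" for u
    proof (induction u rule: rev_induct)
      case Nil
      show ?case using \<rho> by (simp add: accepting_run_from_def)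
    next
      case (snoc d u)
      show ?case using tr[of u] snoc by (cases d) (auto simp: less_automaton_def)
    qed
    have "t u = t' u" for u
      using tr[of u] zero by (auto simp: less_automaton_def pair_tree_apply)
    then show "t = t'" by blast
  qed
qed

lemma subtree_in_trees: "t \<in> trees S \<Longrightarrow> subtree t u \<in> trees S"
  by (simp add: trees_def subtree_apply)

lemma accepts_tree_less:
  assumes "tree_less t t'" "t \<in> trees {0, 1}" "t' \<in> trees {0, 1}"
  shows "accepts_from less_automaton 1 (pair_tree t t')"
proof -
  have "accepts_from less_automaton 1 (pair_tree t t')"
    if "t v < t' v" "\<And>u. precedes v u \<Longrightarrow> t u = t' u" "t \<in> trees {0, 1}" "t' \<in> trees {0, 1}" for v t t'
    using that
  proof (induction v arbitrary: t t')
    case Nil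
    have labels: "t [] \<in> {0, 1}" "t' [] \<in> {0, 1}" using Nil.prems(3,4) by (simp_all add: trees_def)
    have "subtree t [d] = subtree t' [d]" for d using Nil.prems(2) by (simp add: subtree_def)
    then have "accepts_from less_automaton 0 (subtree (pair_tree t t') [d])" for d
      using less_automaton_constant(1)[OF subtree_in_trees[OF Nil.prems(3)] subtree_in_trees[OF Nil.prems(4)]]
      unfolding subtree_pair_tree by blast
    moreover have "(1, pair_tree t t' [], 0, 0) \<in> transitions less_automaton"
      using labels Nil.prems(1) by (auto simp: less_automaton_def pair_tree_apply)
    ultimately show ?case unfolding accepts_from_children[of less_automaton 1 "pair_tree t t'"] by blast
  next
    case (Cons d v)
    have labels: "t [] \<in> {0, 1}" "t' [] \<in> {0, 1}" using Cons.prems(3,4) by (simp_all add: trees_def)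
    then have c: "pair_tree t t' [] \<in> tuples 2 {0, 1}" unfolding pair_tree_apply tuples_2 by blast
    have IH: "accepts_from less_automaton 1 (subtree (pair_tree t t') [d])"
      unfolding subtree_pair_tree
    proof (rule Cons.IH)
      show "subtree t [d] \<in> trees {0, 1}" "subtree t' [d] \<in> trees {0, 1}"
        using Cons.prems(3,4) by (simp_all only: subtree_in_trees)
    qed (use Cons.prems(1,2) in \<open>simp_all add: subtree_apply\<close>)
    show ?case
    proof (cases d)
      case Lft
      have "subtree t [Rgt] = subtree t' [Rgt]"
        using Cons.prems(2) Lft by (simp add: subtree_def)
      then have "accepts_from less_automaton 0 (subtree (pair_tree t t') [Rgt])"
        using less_automaton_constant(1)[OF subtree_in_trees[OF Cons.prems(3)] subtree_in_trees[OF Cons.prems(4)]]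
        unfolding subtree_pair_tree by blast
      moreover have "(1, pair_tree t t' [], 1, 0) \<in> transitions less_automaton"
        using c by (simp add: less_automaton_def)
      ultimately show ?thesis using IH Lft unfolding accepts_from_children[of less_automaton 1 "pair_tree t t'"] by blast
    next
      case Rgt
      have "accepts_from less_automaton 2 (subtree (pair_tree t t') [Lft])"
        using less_automaton_constant(2)[OF subtree_in_trees[OF Cons.prems(3)] subtree_in_trees[OF Cons.prems(4)]]
        unfolding subtree_pair_tree by blast
      moreover have "(1, pair_tree t t' [], 2, 1) \<in> transitions less_automaton"
        using c by (simp add: less_automaton_def)
      ultimately show ?thesis using IH Rgt unfolding accepts_from_children[of less_automaton 1 "pair_tree t t'"] by blast
    qed
  qed
  with assms show ?thesis unfolding tree_less_def by blast
qed

lemma tree_less_if_accepts: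
  assumes acc: "accepts_from less_automaton 1 (pair_tree t t')" and t: "t \<in> trees {0, 1}" "t' \<in> trees {0, 1}"
  shows "tree_less t t'"
proof (rule ccontr)
  assume not_less: "\<not> tree_less t t'"
  obtain \<rho> where \<rho>: "accepting_run_from less_automaton 1 (pair_tree t t') \<rho>"
    using acc unfolding accepts_from_def by blast
  define P where "P u \<longleftrightarrow> \<rho> u = 1 \<and> \<not> tree_less (subtree t u) (subtree t' u)" for u
  have "P []" using \<rho> not_less by (simp add: P_def accepting_run_from_def)
  moreover have "\<exists>d. P (u @ [d])" if "P u" for u
  proof -
    have eq: "subtree t (u @ [d]) = subtree t' (u @ [d])" if "\<rho> (u @ [d]) = 0" for d
    proof -
      have "accepts_from less_automaton 0 (pair_tree (subtree t (u @ [d])) (subtree t' (u @ [d])))"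
        using accepting_run_from_subtree[OF \<rho>, of "u @ [d]"] that unfolding accepts_from_def by auto
      then show ?thesis using less_automaton_constant(1) t subtree_in_trees by blast
    qed
    have "(\<rho> u, pair_tree t t' u, \<rho> (u @ [Lft]), \<rho> (u @ [Rgt])) \<in> transitions less_automaton"
      using \<rho> by (simp add: accepting_run_from_def)
    then consider "t u = 0" "t' u = 1" "\<rho> (u @ [Lft]) = 0" "\<rho> (u @ [Rgt]) = 0"
      | "\<rho> (u @ [Lft]) = 1" "\<rho> (u @ [Rgt]) = 0" | "\<rho> (u @ [Rgt]) = 1"
      using \<open>P u\<close> by (auto simp: less_automaton_def P_def pair_tree_apply)
    then show ?thesis
    proof cases
      case 1
      then have "tree_less (subtree t u) (subtree t' u)"
        unfolding tree_less_children[of "subtree t u"] using eq by (simp add: subtree_apply)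
      with \<open>P u\<close> show ?thesis by (simp add: P_def)
    next
      case 2
      then have "\<not> tree_less (subtree t (u @ [Lft])) (subtree t' (u @ [Lft]))"
        using \<open>P u\<close> eq unfolding P_def tree_less_children[of "subtree t u"] by simp
      with 2 show ?thesis unfolding P_def by blast
    next
      case 3
      then have "\<not> tree_less (subtree t (u @ [Rgt])) (subtree t' (u @ [Rgt]))"
        using \<open>P u\<close> unfolding P_def tree_less_children[of "subtree t u"] by simp
      with 3 show ?thesis unfolding P_def by blast
    qed
  qed
  ultimately obtain \<pi> where "\<And>n. P (branch_prefix \<pi> n)" using dependent_branch[of P] by blast
  then have "inf_states \<rho> \<pi> = {1}"
    unfolding inf_states_eq P_def by (intro inf_often_eventually_const) blast
  moreover have "inf_states \<rho> \<pi> \<in> acceptance less_automaton"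
    using \<rho> by (simp add: accepting_run_from_def accepting_def)
  ultimately show False by (simp add: less_automaton_def)
qed

lemma lang_less_automaton:
  assumes "t \<in> trees {0, 1}" "t' \<in> trees {0, 1}"
  shows "pair_tree t t' \<in> lang less_automaton \<longleftrightarrow> tree_less t t'"
proof -
  have "initial less_automaton = 1" by (simp add: less_automaton_def)
  then show ?thesis
    unfolding lang_iff_accepts_from[OF muller_less_automaton]
    using accepts_tree_less tree_less_if_accepts assms by auto
qed

definition order_automaton :: "('q, nat) muller \<Rightarrow> (('q \<times> 'q) \<times> nat, nat list) muller" where
  "order_automaton M = product (\<lambda>c. c) (\<lambda>c. c) (tuples 2 {0, 1})
     (product (\<lambda>c. c ! 0) (\<lambda>c. c ! 1) (tuples 2 {0, 1}) M M) less_automaton"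

lemma order_automaton:
  assumes M: "muller_automaton M" "alphabet M = {0, 1}"
  shows "muller_automaton (order_automaton M)" "alphabet (order_automaton M) = tuples 2 {0, 1}"
    and "lang (order_automaton M) = convolution ` {[t, t'] | t t'. t \<in> lang M \<and> t' \<in> lang M \<and> tree_less t t'}"
proof -
  note fin = finite_tuples_2[of "{0, 1 :: nat}", simplified]
  show "muller_automaton (order_automaton M)"
    unfolding order_automaton_def using M(1) fin by (intro muller_product muller_less_automaton) simp_all
  show "alphabet (order_automaton M) = tuples 2 {0, 1}"
    by (simp add: order_automaton_def product_def)
  have sub: "lang M \<subseteq> trees {0, 1}" using M(2) by (auto simp: lang_def)
  have *: "T \<in> lang (order_automaton M) \<longleftrightarrow> T \<in> trees (tuples 2 {0, 1}) \<and>
      (\<lambda>u. T u ! 0) \<in> lang M \<and> (\<lambda>u. T u ! 1) \<in> lang M \<and> T \<in> lang less_automaton" for T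
    unfolding order_automaton_def
    using M(1) fin by (simp add: lang_product muller_product muller_less_automaton)
  show "lang (order_automaton M) = convolution ` {[t, t'] | t t'. t \<in> lang M \<and> t' \<in> lang M \<and> tree_less t t'}"
  proof (intro equalityI subsetI)
    fix T assume "T \<in> lang (order_automaton M)"
    then have T: "T \<in> trees (tuples 2 {0, 1})" "(\<lambda>u. T u ! 0) \<in> lang M" "(\<lambda>u. T u ! 1) \<in> lang M"
      "T \<in> lang less_automaton"
      unfolding * by blast+
    have eq: "T = pair_tree (\<lambda>u. T u ! 0) (\<lambda>u. T u ! 1)"
    proof
      fix u
      have "T u \<in> tuples 2 {0, 1}" using T(1) by (simp add: trees_def)
      then show "T u = pair_tree (\<lambda>u. T u ! 0) (\<lambda>u. T u ! 1) u"
        by (auto simp: tuples_2 pair_tree_apply)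
    qed
    then have "tree_less (\<lambda>u. T u ! 0) (\<lambda>u. T u ! 1)"
      using lang_less_automaton[of "\<lambda>u. T u ! 0" "\<lambda>u. T u ! 1"] T sub by auto
    with T(2,3) eq show "T \<in> convolution ` {[t, t'] | t t'. t \<in> lang M \<and> t' \<in> lang M \<and> tree_less t t'}"
      unfolding pair_tree_def by blast
  next
    fix T assume "T \<in> convolution ` {[t, t'] | t t'. t \<in> lang M \<and> t' \<in> lang M \<and> tree_less t t'}"
    then obtain t t' where T: "T = pair_tree t t'" "t \<in> lang M" "t' \<in> lang M" "tree_less t t'"
      unfolding pair_tree_def by auto
    then have "t \<in> trees {0, 1}" "t' \<in> trees {0, 1}" using sub by blast+
    then show "T \<in> lang (order_automaton M)"
      unfolding * T(1) using T lang_less_automaton[of t t'] pair_tree_in_trees[of t t' "{0, 1}"]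
      by (simp add: pair_tree_apply)
  qed
qed

section \<open>Trees with finite support\<close>

abbreviation lefts :: "node \<Rightarrow> nat" where
  "lefts u \<equiv> count_list u Lft"

text \<open>The nodes with at most \<open>k\<close> steps to the left have type \<open>\<omega>\<^sup>k\<^sup>+\<^sup>1\<close> under \<open>precedes\<close>; their finite subsets
  have, under \<open>tree_less\<close>, the type of \<open>2\<close> to this power, which is \<open>\<omega>\<close> to the power of \<open>\<omega>\<^sup>k\<close>.\<close>

definition fin_trees :: "nat \<Rightarrow> nat tree set" where
  "fin_trees k = {t \<in> trees {0, 1}. finite {u. t u \<noteq> 0} \<and> (\<forall>u. t u \<noteq> 0 \<longrightarrow> lefts u \<le> k)}"

text \<open>State \<open>Some i\<close> permits at most \<open>i\<close> further steps to the left; \<open>None\<close> announces that only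
  zeros follow, and has to be reached on every branch.\<close>

definition support_automaton :: "nat \<Rightarrow> (nat option, nat) muller" where
  "support_automaton k = \<lparr>states = {q. \<forall>i. q = Some i \<longrightarrow> i \<le> k}, alphabet = {0, 1},
     transitions = insert (None, 0, None, None) {(Some i, a, l, r) | i a l r. i \<le> k \<and> a \<in> {0, 1} \<and>
       (l = None \<or> (\<exists>j. i = Suc j \<and> l = Some j)) \<and> (r = None \<or> r = Some i)},
     initial = Some k, acceptance = {{None}}\<rparr>"

lemma muller_support_automaton: "muller_automaton (support_automaton k)"
proof -
  have "{q. \<forall>i. q = Some i \<longrightarrow> i \<le> k} \<subseteq> insert None (Some ` {..k})"
  proof
    fix q assume "q \<in> {q. \<forall>i. q = Some i \<longrightarrow> i \<le> k}"
    then show "q \<in> insert None (Some ` {..k})" by (cases q) simp_all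
  qed
  then have "finite {q. \<forall>i. q = Some i \<longrightarrow> i \<le> k}" by (rule finite_subset) simp
  moreover have "(p, a, q, r) \<in> states (support_automaton k) \<times> {0, 1} \<times>
      states (support_automaton k) \<times> states (support_automaton k)"
    if "(p, a, q, r) \<in> transitions (support_automaton k)" for p a q r
  proof (cases p)
    case None
    then show ?thesis using that by (simp add: support_automaton_def)
  next
    case (Some i)
    then have "i \<le> k \<and> a \<in> {0, 1} \<and> (q = None \<or> (\<exists>j. i = Suc j \<and> q = Some j)) \<and> (r = None \<or> r = Some i)"
      using that by (simp add: support_automaton_def)
    then show ?thesis using Some by (simp add: support_automaton_def) (elim conjE disjE exE; simp)
  qed
  then have "transitions (support_automaton k) \<subseteq> states (support_automaton k) \<times> {0, 1} \<times>
      states (support_automaton k) \<times> states (support_automaton k)"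
    unfolding subset_iff split_paired_All by blast
  ultimately show ?thesis unfolding muller_automaton_def by (simp add: support_automaton_def)
qed

lemma alphabet_support_automaton: "alphabet (support_automaton k) = {0, 1}"
  by (simp add: support_automaton_def)

lemma finite_support_depth:
  assumes "finite {u :: node. t u \<noteq> (0 :: nat)}"
  shows "\<exists>N. \<forall>u v. length u \<ge> N \<longrightarrow> t (u @ v) = 0"
proof -
  define N where "N = Suc (Max (length ` {u. t u \<noteq> 0}))"
  have "t u = 0" if "length u \<ge> N" for u
  proof (rule ccontr)
    assume "t u \<noteq> 0"
    then have "length u \<le> Max (length ` {u. t u \<noteq> 0})" using assms by (intro Max_ge) auto
    with that show False by (simp add: N_def)
  qed
  then show ?thesis by (intro exI[of _ N]) simp
qed

lemma lang_support_automaton: "lang (support_automaton k) = fin_trees k"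
proof (intro equalityI subsetI)
  note M = muller_support_automaton[of k]
  fix t assume "t \<in> lang (support_automaton k)"
  then obtain \<rho> where \<rho>: "accepting_run_from (support_automaton k) (Some k) t \<rho>"
    unfolding lang_iff_accepts_from[OF M] accepts_from_def by (auto simp: support_automaton_def)
  have tr: "(\<rho> u, t u, \<rho> (u @ [Lft]), \<rho> (u @ [Rgt])) \<in> transitions (support_automaton k)" for u
    using \<rho> by (simp add: accepting_run_from_def)
  have dead: "\<rho> (u @ v) = None" if "\<rho> u = None" for u v
  proof (induction v rule: rev_induct)
    case Nil
    show ?case using that by simp
  next
    case (snoc d v)
    show ?case using tr[of "u @ v"] snoc by (cases d) (auto simp: support_automaton_def)
  qed
  have zero: "t u = 0" if "\<rho> u = None" for u
    using tr[of u] that by (auto simp: support_automaton_def)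
  have alive: "i + lefts u = k" if "\<rho> u = Some i" for u i
    using that
  proof (induction u arbitrary: i rule: rev_induct)
    case Nil
    then show ?case using \<rho> by (simp add: accepting_run_from_def)
  next
    case (snoc d u)
    show ?case using tr[of u] snoc by (cases d) (auto simp: support_automaton_def)
  qed
  have "finite {u. t u \<noteq> 0}"
  proof (rule ccontr)
    assume inf: "infinite {u. t u \<noteq> 0}"
    define P where "P u \<longleftrightarrow> infinite {v. t (u @ v) \<noteq> 0}" for u
    have "\<exists>d. P (u @ [d])" if "P u" for u
    proof (rule ccontr)
      assume "\<not> ?thesis"
      then have fin: "finite {v. t (u @ [d] @ v) \<noteq> 0}" for d by (simp add: P_def)
      have "{v. t (u @ v) \<noteq> 0} \<subseteq>
          insert [] ((#) Lft ` {v. t (u @ [Lft] @ v) \<noteq> 0} \<union> (#) Rgt ` {v. t (u @ [Rgt] @ v) \<noteq> 0})"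
      proof
        fix v assume v: "v \<in> {v. t (u @ v) \<noteq> 0}"
        show "v \<in> insert [] ((#) Lft ` {v. t (u @ [Lft] @ v) \<noteq> 0} \<union> (#) Rgt ` {v. t (u @ [Rgt] @ v) \<noteq> 0})"
        proof (cases v)
          case (Cons d w)
          then show ?thesis using v by (cases d) auto
        qed simp
      qed
      then have "finite {v. t (u @ v) \<noteq> 0}" by (rule finite_subset) (use fin in simp)
      with that show False by (simp add: P_def)
    qed
    moreover have "P []" using inf by (simp add: P_def)
    ultimately obtain \<pi> where \<pi>: "\<And>n. P (branch_prefix \<pi> n)" using dependent_branch[of P] by blast
    have "\<rho> (branch_prefix \<pi> n) \<noteq> None" for n
    proof
      assume "\<rho> (branch_prefix \<pi> n) = None"
      then have "t (branch_prefix \<pi> n @ v) = 0" for v by (intro zero dead)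
      with \<pi>[of n] show False by (simp add: P_def)
    qed
    then have "{n. \<rho> (branch_prefix \<pi> n) = None} = {}" by blast
    then have "None \<notin> inf_states \<rho> \<pi>" unfolding inf_states_eq inf_often_def
      by (metis finite.emptyI mem_Collect_eq)
    moreover have "inf_states \<rho> \<pi> \<in> acceptance (support_automaton k)"
      using \<rho> by (simp add: accepting_run_from_def accepting_def)
    ultimately show False by (simp add: support_automaton_def)
  qed
  moreover have "lefts u \<le> k" if "t u \<noteq> 0" for u
    using alive zero that by (cases "\<rho> u") force+
  moreover have "t \<in> trees {0, 1}"
    using accepting_run_in_states(2)[OF M \<rho>] by (simp add: trees_def support_automaton_def)
  ultimately show "t \<in> fin_trees k" by (simp add: fin_trees_def)
next
  note M = muller_support_automaton[of k]
  fix t assume t: "t \<in> fin_trees k"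
  define \<rho> where "\<rho> u = (if u \<noteq> [] \<and> (\<forall>v. t (u @ v) = 0) then None else Some (k - lefts u))" for u
  have lab: "t u = 0 \<or> t u = 1" for u using t by (simp add: fin_trees_def trees_def)
  have left: "\<exists>j. k - lefts u = Suc j \<and> \<rho> (u @ [Lft]) = Some j" if nz: "\<rho> (u @ [Lft]) \<noteq> None" for u
  proof -
    obtain v where "t (u @ [Lft] @ v) \<noteq> 0" using nz by (auto simp: \<rho>_def split: if_splits)
    then have "lefts (u @ [Lft] @ v) \<le> k" using t unfolding fin_trees_def by blast
    then have "lefts u + 1 \<le> k" by simp
    then show ?thesis using nz by (auto simp: \<rho>_def split: if_splits intro!: exI[of _ "k - Suc (lefts u)"])
  qed
  have "(\<rho> u, t u, \<rho> (u @ [Lft]), \<rho> (u @ [Rgt])) \<in> transitions (support_automaton k)" for u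
  proof (cases "\<rho> u = None")
    case True
    then have zero: "t (u @ v) = 0" for v by (simp add: \<rho>_def split: if_splits)
    have "t u = 0" using zero[of "[]"] by simp
    moreover have "\<rho> (u @ [d]) = None" for d by (simp add: \<rho>_def zero)
    ultimately have "t u = 0" "\<rho> (u @ [Lft]) = None" "\<rho> (u @ [Rgt]) = None" by blast+
    with True show ?thesis by (simp add: support_automaton_def)
  next
    case False
    then have "\<rho> u = Some (k - lefts u)" by (simp add: \<rho>_def split: if_splits)
    moreover have "\<rho> (u @ [Rgt]) = None \<or> \<rho> (u @ [Rgt]) = Some (k - lefts u)" by (simp add: \<rho>_def)
    moreover have "\<rho> (u @ [Lft]) = None \<or> (\<exists>j. k - lefts u = Suc j \<and> \<rho> (u @ [Lft]) = Some j)"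
      using left[of u] by blast
    ultimately show ?thesis using lab[of u] by (simp add: support_automaton_def)
  qed
  moreover have "inf_states \<rho> \<pi> \<in> acceptance (support_automaton k)" for \<pi>
  proof -
    obtain N where N: "\<And>u v. length u \<ge> N \<Longrightarrow> t (u @ v) = 0"
      using finite_support_depth[of t] t unfolding fin_trees_def by blast
    have "\<rho> (branch_prefix \<pi> n) = None" if "n \<ge> Suc N" for n
    proof -
      have "length (branch_prefix \<pi> n) \<noteq> 0" using that by simp
      then have "branch_prefix \<pi> n \<noteq> []" by (metis list.size(3))
      with that N show ?thesis by (simp add: \<rho>_def)
    qed
    then have "inf_states \<rho> \<pi> = {None}"
      unfolding inf_states_eq by (rule inf_often_eventually_const)
    then show ?thesis by (simp add: support_automaton_def)
  qed
  moreover have "\<rho> [] = initial (support_automaton k)" by (simp add: \<rho>_def support_automaton_def)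
  ultimately show "t \<in> lang (support_automaton k)"
    unfolding lang_iff_accepts_from[OF M] accepts_from_def accepting_run_from_def accepting_def by blast
qed

lemma finite_subtrees:
  assumes "finite {u :: node. t u \<noteq> (0 :: nat)}"
  shows "finite (range (subtree t))"
proof -
  obtain N where N: "\<And>u v. length u \<ge> N \<Longrightarrow> t (u @ v) = 0"
    using finite_support_depth[OF assms] by blast
  have "range (subtree t) \<subseteq> insert (\<lambda>_. 0) (subtree t ` {u. length u < N})"
  proof
    fix s assume "s \<in> range (subtree t)"
    then obtain u where "s = subtree t u" by blast
    then show "s \<in> insert (\<lambda>_. 0) (subtree t ` {u. length u < N})"
      using N[of u] by (cases "length u < N") (auto simp: subtree_def)
  qed
  then show ?thesis by (rule finite_subset) (use finite_nodes in simp)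
qed

subsection \<open>The order type of the trees with finite support\<close>

text \<open>With \<open>i\<close> steps to the left remaining, a step to the right adds \<open>\<omega>\<^sup>i\<close>, which exceeds all ranks below
  the left child. A step to the left adds the next smaller power, so that a left child is ranked above
  its parent.\<close>

fun node_rank :: "nat \<Rightarrow> node \<Rightarrow> nat multiset" where
  "node_rank i [] = {#}"
| "node_rank i (Rgt # u) = add_mset i (node_rank i u)"
| "node_rank i (Lft # u) = add_mset (i - 1) (node_rank (i - 1) u)"

lemma node_rank_bound: "x \<in># node_rank i u \<Longrightarrow> x \<le> i"
  by (induction i u rule: node_rank.induct) force+

lemma node_rank_less:
  "precedes u v \<Longrightarrow> lefts u \<le> i \<Longrightarrow> lefts v \<le> i \<Longrightarrow> node_rank i u < node_rank i v"
proof (induction u v arbitrary: i rule: precedes.induct)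
  case (2 d v)
  then show ?case by (cases d) simp_all
next
  case (3 d u e v)
  show ?case
  proof (cases "d = e")
    case True
    with 3 show ?thesis by (cases e) (auto intro!: add_mset_lt_right_lt)
  next
    case False
    with 3 have de: "d = Lft" "e = Rgt" by (auto intro: direction.exhaust[of e])
    with 3 have "i > 0" by simp
    then have "x < i" if "x \<in># node_rank i (d # u)" for x
      using that de node_rank_bound[of x "i - 1" u] by auto
    then show ?thesis using de by (intro ex_gt_imp_less_multiset) auto
  qed
qed simp

lemma node_rank_inj: "inj_on (node_rank k) {u. lefts u \<le> k}"
  by (rule inj_onI) (metis mem_Collect_eq node_rank_less order_less_irrefl precedes_total)

lemma node_rank_less_iff:
  assumes "lefts u \<le> k" "lefts v \<le> k"
  shows "node_rank k u < node_rank k v \<longleftrightarrow> precedes u v"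
  using node_rank_less precedes_total assms by (metis order_less_asym order_less_irrefl)

text \<open>The natural sum of the powers of \<open>\<omega>\<close> whose exponents are the ranks of the nodes labelled \<open>1\<close>.\<close>

definition code :: "nat \<Rightarrow> nat tree \<Rightarrow> cnf" where
  "code k t = mset_set (node_rank k ` {u. t u \<noteq> 0})"

lemma count_code:
  assumes t: "t \<in> fin_trees k"
  shows "lefts u \<le> k \<Longrightarrow> count (code k t) (node_rank k u) = t u"
    and "\<gamma> \<notin> node_rank k ` {u. lefts u \<le> k} \<Longrightarrow> count (code k t) \<gamma> = 0"
proof -
  have fin: "finite (node_rank k ` {u. t u \<noteq> 0})" using t by (simp add: fin_trees_def)
  have sub: "{u. t u \<noteq> 0} \<subseteq> {u. lefts u \<le> k}" using t by (auto simp: fin_trees_def)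
  have lab: "t u = 0 \<or> t u = 1" for u using t by (simp add: fin_trees_def trees_def)
  show "count (code k t) (node_rank k u) = t u" if "lefts u \<le> k"
  proof -
    have "node_rank k u \<in> node_rank k ` {u. t u \<noteq> 0} \<longleftrightarrow> u \<in> {u. t u \<noteq> 0}"
      by (rule inj_on_image_mem_iff[OF node_rank_inj _ sub]) (use that in simp)
    then show ?thesis using fin lab[of u] by (auto simp: code_def count_mset_set')
  qed
  show "count (code k t) \<gamma> = 0" if "\<gamma> \<notin> node_rank k ` {u. lefts u \<le> k}"
  proof -
    have "\<gamma> \<notin> node_rank k ` {u. t u \<noteq> 0}" using that sub by blast
    then show ?thesis by (simp add: code_def count_mset_set')
  qed
qed

lemma tree_less_iff_code:
  assumes t: "t \<in> fin_trees k" "t' \<in> fin_trees k"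
  shows "tree_less t t' \<longleftrightarrow> code k t < code k t'"
proof
  assume "tree_less t t'"
  then obtain v where v: "t v < t' v" "\<And>u. precedes v u \<Longrightarrow> t u = t' u" unfolding tree_less_def by blast
  then have "t' v \<noteq> 0" by simp
  then have lv: "lefts v \<le> k" using t(2) by (simp add: fin_trees_def)
  have "count (code k t) \<gamma> = count (code k t') \<gamma>" if "\<gamma> > node_rank k v" for \<gamma>
  proof (cases "\<gamma> \<in> node_rank k ` {u. lefts u \<le> k}")
    case True
    then obtain u where u: "lefts u \<le> k" "\<gamma> = node_rank k u" by blast
    then have "precedes v u" using that node_rank_less_iff[OF lv u(1)] by simp
    then show ?thesis using v(2) u count_code(1)[OF t(1)] count_code(1)[OF t(2)] by simp
  next
    case False
    then show ?thesis using count_code(2)[OF t(1)] count_code(2)[OF t(2)] by simp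
  qed
  moreover have "count (code k t) (node_rank k v) < count (code k t') (node_rank k v)"
    using v(1) lv count_code(1)[OF t(1)] count_code(1)[OF t(2)] by simp
  ultimately show "code k t < code k t'" unfolding less_multiset_iff_max_difference by blast
next
  assume "code k t < code k t'"
  then obtain \<gamma> where \<gamma>: "count (code k t) \<gamma> < count (code k t') \<gamma>"
    "\<And>x. x > \<gamma> \<Longrightarrow> count (code k t) x = count (code k t') x"
    unfolding less_multiset_iff_max_difference by blast
  then obtain v where v: "lefts v \<le> k" "\<gamma> = node_rank k v"
    using count_code(2)[OF t(2), of \<gamma>] by (metis (mono_tags, lifting) imageE mem_Collect_eq not_less0)
  have "t u = t' u" if "precedes v u" for u
  proof (cases "lefts u \<le> k")
    case True
    then have "\<gamma> < node_rank k u" using node_rank_less_iff[OF v(1) True] v(2) that by simp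
    then show ?thesis using \<gamma>(2) count_code(1)[OF t(1) True] count_code(1)[OF t(2) True] by simp
  next
    case False
    then have "t u = 0" "t' u = 0" using t unfolding fin_trees_def by blast+
    then show ?thesis by simp
  qed
  moreover have "t v < t' v" using \<gamma>(1) v count_code(1)[OF t(1)] count_code(1)[OF t(2)] by simp
  ultimately show "tree_less t t'" unfolding tree_less_def by blast
qed

lemma inj_on_code: "inj_on (code k) (fin_trees k)"
proof (rule inj_onI)
  fix t t' assume t: "t \<in> fin_trees k" "t' \<in> fin_trees k" and eq: "code k t = code k t'"
  show "t = t'"
  proof
    fix u
    show "t u = t' u"
    proof (cases "lefts u \<le> k")
      case True
      then show ?thesis using count_code(1)[OF t(1)] count_code(1)[OF t(2)] eq by metis
    next
      case False
      then have "t u = 0" "t' u = 0" using t unfolding fin_trees_def by blast+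
      then show ?thesis by simp
    qed
  qed
qed

text \<open>In the other direction, the summand \<open>\<omega>\<^sup>\<gamma> \<cdot> m\<close> of an ordinal is represented by a single label
  \<open>1\<close> at a node that depends on \<open>\<gamma>\<close> and \<open>m\<close>: the path first spells out the coefficients of \<open>\<gamma>\<close>
  and then moves \<open>m\<close> times to the right.\<close>

fun exponent_path :: "nat \<Rightarrow> nat multiset \<Rightarrow> node" where
  "exponent_path 0 \<gamma> = []"
| "exponent_path (Suc k) \<gamma> = replicate (count \<gamma> k) Rgt @ Lft # exponent_path k \<gamma>"

definition summand_node :: "nat \<Rightarrow> nat multiset \<Rightarrow> nat \<Rightarrow> node" where
  "summand_node k \<gamma> m = exponent_path k \<gamma> @ replicate m Rgt"

lemma count_list_replicate_other: "lefts (replicate n Rgt) = 0"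
  by (induction n) auto

lemma lefts_summand_node: "lefts (summand_node k \<gamma> m) = k"
proof -
  have "lefts (exponent_path k \<gamma>) = k" by (induction k) (simp_all add: count_list_replicate_other)
  then show ?thesis by (simp add: summand_node_def count_list_replicate_other)
qed

lemma precedes_replicate:
  "n < n' \<Longrightarrow> precedes (replicate n Rgt @ Lft # u) (replicate n' Rgt @ v)"
proof -
  assume "n < n'"
  then have "replicate n' Rgt = replicate n Rgt @ Rgt # replicate (n' - Suc n) Rgt"
    by (metis Suc_diff_Suc le_add_diff_inverse less_imp_le replicate_Suc replicate_add)
  then show ?thesis by simp
qed

lemma precedes_exponent_path:
  assumes "\<gamma> < \<gamma>'" "\<gamma>' < {#k#}"
  shows "precedes (exponent_path k \<gamma> @ w) (exponent_path k \<gamma>' @ w')"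
proof -
  obtain y where y: "count \<gamma> y < count \<gamma>' y" "\<forall>x>y. count \<gamma> x = count \<gamma>' x"
    using assms(1) unfolding less_multiset_iff_max_difference by blast
  then have "y \<in># \<gamma>'" by (metis count_greater_zero_iff gr_implies_not0 gr_zeroI)
  then have "y < k" using assms(2) by simp
  then show ?thesis
  proof (induction k)
    case (Suc k)
    show ?case
    proof (cases "y = k")
      case True
      then show ?thesis using y precedes_replicate[of "count \<gamma> k" "count \<gamma>' k"] by simp
    next
      case False
      then have "y < k" "count \<gamma> k = count \<gamma>' k" using Suc.prems y by auto
      then show ?thesis using Suc.IH by simp
    qed
  qed simp
qed

lemma precedes_summand_node:
  assumes "\<gamma> < {#k#}" "\<gamma>' < {#k#}"
  shows "precedes (summand_node k \<gamma> m) (summand_node k \<gamma>' m') \<longleftrightarrow> \<gamma> < \<gamma>' \<or> \<gamma> = \<gamma>' \<and> m < m'"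
proof -
  have less: "precedes (summand_node k \<gamma> m) (summand_node k \<gamma>' m')"
    if "\<gamma>' < {#k#}" "\<gamma> < \<gamma>' \<or> \<gamma> = \<gamma>' \<and> m < m'" for \<gamma> m \<gamma>' m'
  proof (cases "\<gamma> = \<gamma>'")
    case True
    then have "m < m'" using that by simp
    then obtain n where "replicate m' Rgt = replicate m Rgt @ Rgt # replicate n Rgt"
      by (metis less_imp_Suc_add replicate_Suc replicate_add add_Suc_right)
    then have "precedes (exponent_path k \<gamma> @ replicate m Rgt @ []) (exponent_path k \<gamma> @ replicate m' Rgt)"
      by (metis precedes.simps(2) precedes_append)
    then show ?thesis by (simp add: summand_node_def True)
  qed (use that precedes_exponent_path in \<open>auto simp: summand_node_def\<close>)
  have asym: "\<not> precedes v u" if "precedes u v" for u v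
    using that by (induction u v rule: precedes.induct) (auto split: if_splits)
  show ?thesis
  proof
    assume pre: "precedes (summand_node k \<gamma> m) (summand_node k \<gamma>' m')"
    show "\<gamma> < \<gamma>' \<or> \<gamma> = \<gamma>' \<and> m < m'"
    proof (rule ccontr)
      assume "\<not> ?thesis"
      then consider "\<gamma> = \<gamma>' \<and> m = m'" | "\<gamma>' < \<gamma> \<or> \<gamma>' = \<gamma> \<and> m' < m" by force
      then show False
      proof cases
        case 1
        then show ?thesis using pre by simp
      next
        case 2
        then show ?thesis using pre asym less[OF assms(1) 2] by blast
      qed
    qed
  qed (use less assms in blast)
qed

definition encode :: "nat \<Rightarrow> cnf \<Rightarrow> nat tree" where
  "encode k z u = (if \<exists>\<gamma>\<in>#z. u = summand_node k \<gamma> (count z \<gamma>) then 1 else 0)"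

lemma encode_in_fin_trees: "encode k z \<in> fin_trees k"
proof -
  have "{u. encode k z u \<noteq> 0} = (\<lambda>\<gamma>. summand_node k \<gamma> (count z \<gamma>)) ` set_mset z"
    by (auto simp: encode_def)
  then have "finite {u. encode k z u \<noteq> 0}" by simp
  then show ?thesis
    by (auto simp: fin_trees_def trees_def encode_def lefts_summand_node)
qed

text \<open>At the largest \<open>y\<close> where the coefficients of \<open>z\<close> and \<open>z'\<close> differ, the greater coefficient, that of
  \<open>z'\<close>, has its node further to the right, and at this node the two trees differ for the last time.\<close>

lemma encode_less:
  assumes less: "z < z'" and z: "z < {#{#k#}#}" "z' < {#{#k#}#}"
  shows "tree_less (encode k z) (encode k z')"
proof -
  have bound: "\<gamma> < {#k#}" if "\<gamma> \<in># z \<or> \<gamma> \<in># z'" for \<gamma> using that z by auto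
  obtain y where y: "count z y < count z' y" and above: "\<And>x. x > y \<Longrightarrow> count z x = count z' x"
    using less unfolding less_multiset_iff_max_difference by blast
  then have yz': "y \<in># z'" by (metis count_greater_zero_iff gr_implies_not0 gr_zeroI)
  note y_bound = bound[OF disjI2[OF yz']]
  define v where "v = summand_node k y (count z' y)"
  have "encode k z v = 0"
  proof (rule ccontr)
    assume "encode k z v \<noteq> 0"
    then obtain \<gamma> where \<gamma>: "\<gamma> \<in># z" "v = summand_node k \<gamma> (count z \<gamma>)" by (auto simp: encode_def split: if_splits)
    then have "\<not> precedes (summand_node k y (count z' y)) (summand_node k \<gamma> (count z \<gamma>))"
      "\<not> precedes (summand_node k \<gamma> (count z \<gamma>)) (summand_node k y (count z' y))"
      by (simp_all add: v_def[symmetric])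
    then have "\<gamma> = y \<and> count z \<gamma> = count z' y"
      using bound[OF disjI1[OF \<gamma>(1)]] y_bound by (simp add: precedes_summand_node) (metis linorder_neqE)
    with y show False by (metis less_irrefl)
  qed
  moreover have "encode k z' v = 1" using yz' by (auto simp: encode_def v_def)
  moreover have "encode k z u = encode k z' u" if "precedes v u" for u
  proof -
    have "(\<exists>\<gamma>\<in>#z. u = summand_node k \<gamma> (count z \<gamma>)) \<longleftrightarrow> (\<exists>\<gamma>\<in>#z'. u = summand_node k \<gamma> (count z' \<gamma>))"
    proof
      assume "\<exists>\<gamma>\<in>#z. u = summand_node k \<gamma> (count z \<gamma>)"
      then obtain \<gamma> where \<gamma>: "\<gamma> \<in># z" "u = summand_node k \<gamma> (count z \<gamma>)" by blast
      then have "y < \<gamma>"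
        using that y precedes_summand_node[OF y_bound bound[OF disjI1[OF \<gamma>(1)]]] by (auto simp: v_def)
      then have "count z \<gamma> = count z' \<gamma>" by (rule above)
      with \<gamma> show "\<exists>\<gamma>\<in>#z'. u = summand_node k \<gamma> (count z' \<gamma>)"
        by (metis count_greater_zero_iff)
    next
      assume "\<exists>\<gamma>\<in>#z'. u = summand_node k \<gamma> (count z' \<gamma>)"
      then obtain \<gamma> where \<gamma>: "\<gamma> \<in># z'" "u = summand_node k \<gamma> (count z' \<gamma>)" by blast
      then have "y < \<gamma>"
        using that precedes_summand_node[OF y_bound bound[OF disjI2[OF \<gamma>(1)]]] by (auto simp: v_def)
      then have "count z \<gamma> = count z' \<gamma>" by (rule above)
      with \<gamma> show "\<exists>\<gamma>\<in>#z. u = summand_node k \<gamma> (count z \<gamma>)"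
        by (metis count_greater_zero_iff)
    qed
    then show ?thesis by (simp add: encode_def)
  qed
  ultimately show ?thesis unfolding tree_less_def by (intro exI[of _ v]) simp
qed

section \<open>The ordinal \<open>\<omega>\<^sup>\<omega>\<^sup>\<omega>\<close>\<close>

definition rank_order :: "('b \<Rightarrow> 'o :: wellorder) \<Rightarrow> 'b set \<Rightarrow> 'b rel" where
  "rank_order f S = {(x, y). x \<in> S \<and> y \<in> S \<and> f x \<le> f y}"

lemma Field_rank_order [simp]: "Field (rank_order f S) = S"
  by (auto simp: Field_def rank_order_def)

lemma Well_order_rank_order:
  assumes "inj_on f S"
  shows "Well_order (rank_order f S)"
proof -
  have "wf (rank_order f S - Id)"
  proof (rule wf_subset)
    show "wf (inv_image {(x, y). x < y} f)" by (intro wf_inv_image wf)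
    show "rank_order f S - Id \<subseteq> inv_image {(x, y). x < y} f"
      using assms by (auto simp: rank_order_def inj_on_def order_le_less)
  qed
  moreover have "antisym (rank_order f S)"
    using assms by (auto simp: rank_order_def inj_on_def antisym_def)
  ultimately show ?thesis
    unfolding well_order_on_def linear_order_on_def partial_order_on_def preorder_on_def Field_rank_order
    by (auto simp: rank_order_def refl_on_def trans_def total_on_def)
qed

abbreviation cnf_order :: "cnf rel" where
  "cnf_order \<equiv> rank_order (\<lambda>z. z) UNIV"

lemma minim_omega: "wo_rel.minim \<omega> (Field \<omega>) = 0"
proof -
  have wo: "wo_rel \<omega>" by (simp add: wo_rel_def natLeq_Well_order)
  have least: "(0, b) \<in> \<omega>" for b by (simp add: natLeq_def)
  have "0 = wo_rel.minim \<omega> (Field \<omega>)"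
    by (rule wo_rel.equals_minim[OF wo]) (simp_all add: Field_natLeq least)
  then show ?thesis by simp
qed

lemma fin_funs_omega_iff:
  "f \<in> fin_funs \<omega> s \<longleftrightarrow> (\<forall>b. b \<notin> Field s \<longrightarrow> f b = undefined) \<and> finite {b \<in> Field s. f b \<noteq> 0}"
  unfolding fin_funs_def minim_omega by (auto simp: Func_def Field_natLeq)

lemma Field_oexp: "Field (r ^o s) = fin_funs r s"
  by (auto simp: Field_def oexp_def)

lemma exponents: "f \<in> fin_funs \<omega> \<omega> \<longleftrightarrow> finite {n. f n \<noteq> 0}"
  by (simp add: fin_funs_omega_iff Field_natLeq)

lemma fin_funs_exponents_iff:
  "F \<in> fin_funs \<omega> (\<omega> ^o \<omega>) \<longleftrightarrow>
     (\<forall>f. f \<notin> fin_funs \<omega> \<omega> \<longrightarrow> F f = undefined) \<and> finite {f \<in> fin_funs \<omega> \<omega>. F f \<noteq> 0}"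
  unfolding fin_funs_omega_iff[of F "\<omega> ^o \<omega>"] Field_oexp ..

lemma count_exponent: "count \<gamma> \<in> fin_funs \<omega> \<omega>"
  unfolding exponents by (rule finite_subset[of _ "set_mset \<gamma>"]) auto

lemma count_Abs_exponent: "f \<in> fin_funs \<omega> \<omega> \<Longrightarrow> count (Abs_multiset f) = f"
  by (simp add: exponents)

lemma exponent_order:
  assumes "f \<in> fin_funs \<omega> \<omega>" "g \<in> fin_funs \<omega> \<omega>"
  shows "(f, g) \<in> \<omega> ^o \<omega> \<longleftrightarrow> Abs_multiset f \<le> Abs_multiset g"
proof -
  have "Abs_multiset f = Abs_multiset g \<longleftrightarrow> f = g" using assms by (metis count_Abs_exponent)
  moreover have "Abs_multiset f < Abs_multiset g \<longleftrightarrow> (\<exists>b. f b < g b \<and> (\<forall>c>b. f c = g c))"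
    unfolding less_multiset_iff_max_difference using assms by (simp add: count_Abs_exponent)
  moreover have "(m, n) \<in> \<omega> \<longleftrightarrow> m \<le> n" for m n by (simp add: natLeq_def)
  then have "(f, g) \<in> \<omega> ^o \<omega> \<longleftrightarrow> f = g \<or> (\<exists>b. f b < g b \<and> (\<forall>c>b. f c = g c))"
    using assms by (simp add: oexp_def Field_natLeq) (metis order_less_le)
  ultimately show ?thesis by (simp add: order_le_less) blast
qed

text \<open>A function on all of \<open>nat \<Rightarrow> nat\<close> belongs to the field of the exponentiation only if it takes the
  value \<open>undefined\<close> wherever its argument is not an exponent.\<close>

definition to_function :: "cnf \<Rightarrow> (nat \<Rightarrow> nat) \<Rightarrow> nat" where
  "to_function z f = (if f \<in> fin_funs \<omega> \<omega> then count z (Abs_multiset f) else undefined)"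

lemma to_function_count: "to_function z (count \<gamma>) = count z \<gamma>"
  by (simp add: to_function_def count_exponent count_inverse)

lemma to_function_fin_funs: "to_function z \<in> fin_funs \<omega> (\<omega> ^o \<omega>)"
proof -
  have "{f \<in> fin_funs \<omega> \<omega>. to_function z f \<noteq> 0} \<subseteq> count ` set_mset z"
  proof
    fix f assume f: "f \<in> {f \<in> fin_funs \<omega> \<omega>. to_function z f \<noteq> 0}"
    then have "Abs_multiset f \<in># z" "f = count (Abs_multiset f)"
      by (auto simp: to_function_def count_Abs_exponent)
    then show "f \<in> count ` set_mset z" by blast
  qed
  then have "finite {f \<in> fin_funs \<omega> \<omega>. to_function z f \<noteq> 0}" by (rule finite_subset) simp
  moreover have "\<forall>f. f \<notin> fin_funs \<omega> \<omega> \<longrightarrow> to_function z f = undefined"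
    by (simp add: to_function_def)
  ultimately show ?thesis unfolding fin_funs_exponents_iff by blast
qed

lemma to_function_surj:
  assumes F: "F \<in> fin_funs \<omega> (\<omega> ^o \<omega>)"
  shows "\<exists>z. F = to_function z"
proof -
  define z where "z = Abs_multiset (\<lambda>\<gamma>. F (count \<gamma>))"
  have "{\<gamma>. F (count \<gamma>) > 0} \<subseteq> Abs_multiset ` {f \<in> fin_funs \<omega> \<omega>. F f \<noteq> 0}"
    using count_exponent by (force intro: count_inverse[symmetric])
  then have "finite {\<gamma>. F (count \<gamma>) > 0}"
    by (rule finite_subset) (use F in \<open>simp add: fin_funs_exponents_iff\<close>)
  then have z: "count z = (\<lambda>\<gamma>. F (count \<gamma>))" by (simp add: z_def)
  have "F f = to_function z f" for f
  proof (cases "f \<in> fin_funs \<omega> \<omega>")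
    case True
    then show ?thesis by (simp add: to_function_def z count_Abs_exponent)
  next
    case False
    then show ?thesis using F by (simp add: to_function_def fin_funs_exponents_iff)
  qed
  then show ?thesis by blast
qed

lemma inj_to_function: "inj to_function"
  by (rule injI) (metis multiset_eqI to_function_count)

lemma to_function_order: "(to_function z, to_function z') \<in> \<omega> ^o (\<omega> ^o \<omega>) \<longleftrightarrow> z \<le> z'"
proof -
  have "(\<exists>f\<in>fin_funs \<omega> \<omega>. to_function z f \<noteq> to_function z' f \<and> to_function z f \<le> to_function z' f \<and>
      (\<forall>g\<in>fin_funs \<omega> \<omega>. (f, g) \<in> \<omega> ^o \<omega> \<and> g \<noteq> f \<longrightarrow> to_function z g = to_function z' g)) \<longleftrightarrow> z < z'"
    (is "?L \<longleftrightarrow> _")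
  proof
    assume ?L
    then obtain f where f: "f \<in> fin_funs \<omega> \<omega>" "to_function z f < to_function z' f"
      "\<And>g. g \<in> fin_funs \<omega> \<omega> \<Longrightarrow> (f, g) \<in> \<omega> ^o \<omega> \<Longrightarrow> g \<noteq> f \<Longrightarrow> to_function z g = to_function z' g"
      by (auto simp: order_less_le)
    have "count z \<gamma> = count z' \<gamma>" if "\<gamma> > Abs_multiset f" for \<gamma>
    proof -
      have "(f, count \<gamma>) \<in> \<omega> ^o \<omega>" "count \<gamma> \<noteq> f"
        using that exponent_order[OF f(1) count_exponent[of \<gamma>]] by (auto simp: count_inverse)
      then show ?thesis using f(3)[OF count_exponent] by (metis to_function_count)
    qed
    moreover have "count z (Abs_multiset f) < count z' (Abs_multiset f)"
      using f(1,2) by (simp add: to_function_def)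
    ultimately show "z < z'" unfolding less_multiset_iff_max_difference by blast
  next
    assume "z < z'"
    then obtain \<gamma> where \<gamma>: "count z \<gamma> < count z' \<gamma>" "\<And>x. x > \<gamma> \<Longrightarrow> count z x = count z' x"
      unfolding less_multiset_iff_max_difference by blast
    have "to_function z g = to_function z' g"
      if "g \<in> fin_funs \<omega> \<omega>" "(count \<gamma>, g) \<in> \<omega> ^o \<omega>" "g \<noteq> count \<gamma>" for g
    proof -
      have "\<gamma> \<le> Abs_multiset g"
        using that exponent_order[OF count_exponent that(1)] by (simp add: count_inverse)
      moreover have "\<gamma> \<noteq> Abs_multiset g" using that by (metis count_Abs_exponent)
      ultimately show ?thesis using \<gamma>(2) that(1) by (simp add: to_function_def)
    qed
    then show ?L
      using \<gamma>(1) count_exponent[of \<gamma>] by (intro bexI[of _ "count \<gamma>"]) (simp_all add: to_function_count)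
  qed
  then show ?thesis
    unfolding oexp_def[of \<omega> "\<omega> ^o \<omega>"] using to_function_fin_funs inj_to_function
    by (auto simp: Field_oexp natLeq_def order_le_less dest: injD)
qed

lemma cnf_order_iso: "cnf_order =o \<omega> ^o (\<omega> ^o \<omega>)"
proof -
  have "\<omega> ^o (\<omega> ^o \<omega>) = dir_image cnf_order to_function"
  proof (intro equalityI subsetI)
    fix p assume p: "p \<in> \<omega> ^o (\<omega> ^o \<omega>)"
    then obtain F G where FG: "p = (F, G)" "F \<in> fin_funs \<omega> (\<omega> ^o \<omega>)" "G \<in> fin_funs \<omega> (\<omega> ^o \<omega>)"
      unfolding oexp_def[of \<omega> "\<omega> ^o \<omega>"] by blast
    then obtain z z' where "F = to_function z" "G = to_function z'" using to_function_surj by meson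
    with p FG show "p \<in> dir_image cnf_order to_function"
      by (auto simp: to_function_order dir_image_def rank_order_def)
  next
    fix p assume "p \<in> dir_image cnf_order to_function"
    then show "p \<in> \<omega> ^o (\<omega> ^o \<omega>)"
      by (auto simp: to_function_order dir_image_def rank_order_def)
  qed
  moreover have "Well_order cnf_order" by (rule Well_order_rank_order) simp
  ultimately show ?thesis using inj_to_function by (simp add: dir_image_ordIso)
qed

section \<open>Presentations of ordinals\<close>

lemma convolution_inject:
  assumes "length ts = length ts'" "convolution ts = convolution ts'"
  shows "ts = ts'"
proof (rule nth_equalityI[OF assms(1)])
  fix i assume i: "i < length ts"
  show "ts ! i = ts' ! i"
  proof
    fix u
    have "convolution ts u ! i = convolution ts' u ! i" using assms(2) by simp
    then show "(ts ! i) u = (ts' ! i) u" using i assms(1) by (simp add: convolution_def)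
  qed
qed

lemma pair_tree_in_convolution:
  assumes "R \<subseteq> tuples 2 S"
  shows "pair_tree x y \<in> convolution ` R \<longleftrightarrow> [x, y] \<in> R"
proof
  assume "pair_tree x y \<in> convolution ` R"
  then obtain ts where ts: "ts \<in> R" "convolution [x, y] = convolution ts" unfolding pair_tree_def by blast
  then have "length ts = 2" using assms by (auto simp: tuples_def)
  with ts convolution_inject[of "[x, y]" ts] show "[x, y] \<in> R" by simp
qed (auto simp: pair_tree_def)

text \<open>Let \<open>\<alpha>\<close> be the ordinal denoted by \<open>z\<^sub>0\<close> and let \<open>k\<close> exceed all numbers in \<open>z\<^sub>0\<close>. If the trees embedded
  into \<open>\<alpha>\<close>, then preceding this embedding by \<open>encode k\<close> would map the ordinals up to \<open>z\<^sub>0\<close> increasingly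
  to those below \<open>z\<^sub>0\<close>.\<close>

lemma below_fin_trees:
  assumes less: "\<alpha> <o \<omega> ^o (\<omega> ^o \<omega>)"
  shows "\<exists>k. \<alpha> <o rank_order (code k) (fin_trees k)"
proof -
  have W: "Well_order cnf_order" "Well_order (rank_order (code k) (fin_trees k))" "Well_order \<alpha>" for k
  proof -
    show "Well_order cnf_order" "Well_order (rank_order (code k) (fin_trees k))"
      by (rule Well_order_rank_order, simp add: inj_on_code)+
    show "Well_order \<alpha>" using less unfolding ordLess_def by blast
  qed
  have "\<alpha> <o cnf_order"
    using less ordIso_symmetric[OF cnf_order_iso] by (rule ordLess_ordIso_trans)
  then obtain z0 where z0: "\<alpha> =o Restr cnf_order (underS cnf_order z0)" (is "_ =o ?s")
    using ordLess_iff_ordIso_Restr[OF W(1,3)] by blast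
  have "finite (\<Union>\<gamma>\<in>set_mset z0. set_mset \<gamma>)" by simp
  then obtain k where k: "\<And>\<gamma> x. \<gamma> \<in># z0 \<Longrightarrow> x \<in># \<gamma> \<Longrightarrow> x < k"
    unfolding finite_nat_set_iff_bounded by blast
  then have z0_less: "z0 < {#{#k#}#}" by simp
  define L where "L = rank_order (code k) (fin_trees k)"
  have "\<not> L \<le>o \<alpha>"
  proof
    assume "L \<le>o \<alpha>"
    then have "L \<le>o ?s" using z0 by (rule ordLeq_ordIso_trans)
    then obtain h where h: "embed L ?s h" and WL: "Well_order L" unfolding ordLeq_def by blast
    define \<psi> where "\<psi> z = h (encode k z)" for z
    have mono: "\<psi> z < \<psi> z'" if "z < z'" "z' \<le> z0" for z z'
    proof -
      have z': "z' < {#{#k#}#}" using that(2) z0_less by (rule order_le_less_trans)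
      have "tree_less (encode k z) (encode k z')"
        using that(1) order_less_trans[OF that(1) z'] z' by (rule encode_less)
      then have lt: "code k (encode k z) < code k (encode k z')"
        using tree_less_iff_code[OF encode_in_fin_trees encode_in_fin_trees] by blast
      then have "(encode k z, encode k z') \<in> L"
        by (simp add: L_def rank_order_def encode_in_fin_trees)
      then have "(\<psi> z, \<psi> z') \<in> ?s" using embed_compat[OF h] unfolding compat_def \<psi>_def by blast
      then have "\<psi> z \<le> \<psi> z'" by (simp add: rank_order_def)
      moreover have "h (encode k z) \<noteq> h (encode k z')"
        using inj_on_eq_iff[OF embed_inj_on[OF WL h], of "encode k z" "encode k z'"] lt
        by (auto simp: L_def encode_in_fin_trees)
      ultimately show ?thesis by (simp add: \<psi>_def)
    qed
    have "z \<le> \<psi> z" if "z \<le> z0" for z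
      using that
    proof (induction z rule: less_induct)
      case (less z)
      have "y < \<psi> z" if "y < z" for y
      proof -
        have "y \<le> z0" using that less.prems by simp
        then have "y \<le> \<psi> y" by (rule less.IH[OF that])
        also have "\<psi> y < \<psi> z" using that less.prems by (rule mono)
        finally show ?thesis .
      qed
      then show ?case by (meson less_irrefl not_le)
    qed
    moreover have "\<psi> z0 \<in> Field ?s"
      unfolding \<psi>_def by (rule embed_in_Field[OF h]) (simp add: L_def encode_in_fin_trees)
    then have "\<psi> z0 < z0"
      by (auto simp: Field_def underS_def rank_order_def)
    ultimately show False by (meson leD order_refl)
  qed
  then have "\<alpha> <o L" using not_ordLeq_iff_ordLess[OF W(3) W(2)] unfolding L_def by blast
  then show ?thesis unfolding L_def by blast
qed

text \<open>The ordinal is isomorphic to the trees below some tree \<open>x\<close>, and the finitely many subtrees of \<open>x\<close>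
  make this a recognizable set.\<close>

lemma automatic_if_below:
  fixes \<alpha> :: "'a rel"
  assumes less: "\<alpha> <o \<omega> ^o (\<omega> ^o \<omega>)"
  shows "inj_omega_tree_automatic_ordinal \<alpha>"
proof -
  obtain k where k: "\<alpha> <o rank_order (code k) (fin_trees k)" using below_fin_trees[OF less] by blast
  define L where "L = rank_order (code k) (fin_trees k)"
  have WL: "Well_order L" unfolding L_def by (rule Well_order_rank_order[OF inj_on_code])
  have W\<alpha>: "Well_order \<alpha>" using less by (simp add: ordLess_def)
  obtain x where x: "x \<in> fin_trees k" and iso: "\<alpha> =o Restr L (underS L x)"
    using k ordLess_iff_ordIso_Restr[OF WL W\<alpha>] unfolding L_def by auto
  define U where "U = {t \<in> fin_trees k. tree_less t x}"
  have U: "underS L x = U"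
    using x inj_onD[OF inj_on_code]
    by (auto simp: U_def underS_def L_def rank_order_def tree_less_iff_code order_le_less)
  have "Refl L" using WL by (simp add: well_order_on_def linear_order_on_def partial_order_on_def preorder_on_def)
  then have Field: "Field (Restr L U) = U"
    by (rule Refl_Field_Restr2) (auto simp: L_def U_def)
  obtain h where "BNF_Wellorder_Embedding.iso (Restr L U) \<alpha> h"
    using ordIso_symmetric[OF iso] unfolding ordIso_def U by blast
  then have h: "bij_betw h U (Field \<alpha>)" "\<And>a b. a \<in> U \<Longrightarrow> b \<in> U \<Longrightarrow> (a, b) \<in> Restr L U \<longleftrightarrow> (h a, h b) \<in> \<alpha>"
    unfolding iso_iff2 Field by blast+
  have h_less: "tree_less a b \<longleftrightarrow> (h a, h b) \<in> \<alpha> \<and> h a \<noteq> h b" if ab: "a \<in> U" "b \<in> U" for a b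
  proof -
    have fin: "a \<in> fin_trees k" "b \<in> fin_trees k" using ab by (simp_all add: U_def)
    have "(h a, h b) \<in> \<alpha> \<longleftrightarrow> code k a \<le> code k b"
      using h(2)[OF ab] ab fin by (simp add: L_def rank_order_def)
    moreover have "h a = h b \<longleftrightarrow> code k a = code k b"
      using inj_on_eq_iff[OF bij_betw_imp_inj_on[OF h(1)] ab] inj_on_eq_iff[OF inj_on_code fin] by simp
    ultimately show ?thesis by (simp add: tree_less_iff_code[OF fin] order_less_le)
  qed
  let ?M = "support_automaton k"
  have ord: "muller_automaton (order_automaton ?M)"
    "lang (order_automaton ?M) = convolution ` {[t, t'] | t t'. t \<in> fin_trees k \<and> t' \<in> fin_trees k \<and> tree_less t t'}"
    using order_automaton[OF muller_support_automaton alphabet_support_automaton, of k]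
    by (simp_all add: lang_support_automaton)
  have pair: "pair_tree t x \<in> lang (order_automaton ?M) \<longleftrightarrow> t \<in> U" for t
  proof -
    have "{[t, t'] | t t'. t \<in> fin_trees k \<and> t' \<in> fin_trees k \<and> tree_less t t'} \<subseteq> tuples 2 UNIV"
      by (auto simp: tuples_def)
    from pair_tree_in_convolution[OF this] show ?thesis using x by (auto simp: ord U_def)
  qed
  define MU where "MU = section_automaton {0, 1} (order_automaton ?M) x"
  have fin: "finite (range (subtree x))" using x by (intro finite_subtrees) (simp add: fin_trees_def)
  have MU: "muller_automaton MU" "alphabet MU = {0, 1}" "lang MU = U"
  proof -
    show "muller_automaton MU" unfolding MU_def using ord fin by (intro muller_section) simp_all
    show "alphabet MU = {0, 1}" by (simp add: MU_def section_automaton_def)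
    have "U \<subseteq> trees {0, 1}" by (auto simp: U_def fin_trees_def)
    then show "lang MU = U"
      unfolding MU_def using lang_section[OF ord(1) _ fin, of "{0, 1}"] pair by auto
  qed
  obtain A :: "(nat, nat) muller" where A: "muller_automaton A" "alphabet A = {0, 1}" "lang A = U"
    using nat_states[OF MU(1)] MU by auto
  define R where "R = {[t, t'] | t t'. t \<in> U \<and> t' \<in> U \<and> tree_less t t'}"
  obtain B :: "(nat, nat list) muller" where
    B: "muller_automaton B" "alphabet B = tuples 2 {0, 1}" "lang B = convolution ` R"
    using nat_states[OF order_automaton(1)[OF MU(1,2)]] order_automaton[OF MU(1,2)] unfolding MU(3) R_def by metis
  define P where "P = \<lparr>universe = U, rels = [(2, R)]\<rparr>"
  have "wf_structure (ordinal_structure \<alpha>)"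
    by (auto simp: wf_structure_def ordinal_structure_def tuples_def Field_def)
  moreover have "wf_structure P"
    by (auto simp: wf_structure_def P_def R_def tuples_def)
  moreover have "structure_iso h P (ordinal_structure \<alpha>)"
    unfolding structure_iso_def
  proof
    show "bij_betw h (universe P) (universe (ordinal_structure \<alpha>))"
      using h(1) by (simp add: P_def ordinal_structure_def)
    have "ts \<in> R \<longleftrightarrow> map h ts \<in> {[a, b] | a b. (a, b) \<in> \<alpha> \<and> a \<noteq> b}" if "ts \<in> tuples 2 U" for ts
    proof -
      obtain a b where "ts = [a, b]" "a \<in> U" "b \<in> U" using \<open>ts \<in> tuples 2 U\<close> by (auto simp: tuples_2)
      then show ?thesis using h_less by (simp add: R_def)
    qed
    then show "list_all2 (\<lambda>(m, R') (n, R). m = n \<and>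
        (\<forall>ts\<in>tuples n (universe P). (ts \<in> R') = (map h ts \<in> R))) (rels P) (rels (ordinal_structure \<alpha>))"
      by (simp add: P_def ordinal_structure_def)
  qed
  moreover have "\<forall>(n, R')\<in>set (rels P). \<exists>\<B> :: (nat, nat list) muller.
      muller_automaton \<B> \<and> alphabet \<B> = tuples n (alphabet A) \<and> lang \<B> = convolution ` R'"
    using A B by (auto simp: P_def)
  moreover have "universe P = lang A" by (simp add: P_def A)
  ultimately show ?thesis
    unfolding inj_omega_tree_automatic_ordinal_def inj_omega_tree_automatic_def using A(1) by blast
qed

text \<open>Otherwise \<open>\<omega>\<^sup>\<omega>\<^sup>\<omega>\<close> is an initial segment of \<open>\<alpha>\<close>, and pulling it back along the isomorphism \<open>h\<close> gives
  the map excluded by \<open>no_cofinal_segments\<close>.\<close>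

lemma below_if_automatic:
  fixes \<alpha> :: "'a rel"
  assumes W: "Well_order \<alpha>" and auto: "inj_omega_tree_automatic_ordinal \<alpha>"
  shows "\<alpha> <o \<omega> ^o (\<omega> ^o \<omega>)"
proof (rule ccontr)
  assume not_less: "\<not> \<alpha> <o \<omega> ^o (\<omega> ^o \<omega>)"
  obtain A :: "(nat, nat) muller" and P h where A: "muller_automaton A" "wf_structure P" "universe P = lang A"
    "\<forall>(n, R')\<in>set (rels P). \<exists>\<B> :: (nat, nat list) muller.
       muller_automaton \<B> \<and> alphabet \<B> = tuples n (alphabet A) \<and> lang \<B> = convolution ` R'"
    "structure_iso h P (ordinal_structure \<alpha>)"
    using auto unfolding inj_omega_tree_automatic_ordinal_def inj_omega_tree_automatic_def by blast
  have h: "bij_betw h (lang A) (Field \<alpha>)"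
    using A(3,5) by (simp add: structure_iso_def ordinal_structure_def)
  obtain R where R: "rels P = [(2, R)]"
    and R_iff: "\<And>ts. ts \<in> tuples 2 (lang A) \<Longrightarrow> ts \<in> R \<longleftrightarrow> map h ts \<in> {[x, y] | x y. (x, y) \<in> \<alpha> \<and> x \<noteq> y}"
    using A(3,5) by (auto simp: structure_iso_def ordinal_structure_def list_all2_Cons2)
  obtain B :: "(nat, nat list) muller" where B: "muller_automaton B" "lang B = convolution ` R"
    using A(4) R by auto
  have R_sub: "R \<subseteq> tuples 2 (lang A)" using A(2,3) R by (simp add: wf_structure_def)
  define less where "less x y \<longleftrightarrow> pair_tree x y \<in> lang B" for x y
  have less: "less x y \<longleftrightarrow> (h x, h y) \<in> \<alpha> \<and> h x \<noteq> h y" if "x \<in> lang A" "y \<in> lang A" for x y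
    using R_iff[of "[x, y]"] that pair_tree_in_convolution[OF R_sub, of x y]
    by (simp add: less_def B tuples_2)
  have h_mem: "h x \<in> Field \<alpha>" if "x \<in> lang A" for x using h that by (auto simp: bij_betw_def)
  have h_eq: "h x = h y \<longleftrightarrow> x = y" if "x \<in> lang A" "y \<in> lang A" for x y
    using inj_on_eq_iff[OF bij_betw_imp_inj_on[OF h] that] .
  have trans: "trans \<alpha>" and antisym: "antisym \<alpha>" and total: "Total \<alpha>" and wf: "wf (\<alpha> - Id)"
    using W by (simp_all add: well_order_on_def linear_order_on_def partial_order_on_def preorder_on_def)
  interpret recognizable_wellorder A B less
  proof
    fix x y z assume x: "x \<in> lang A"
    show "\<not> less x x" using less[OF x x] by simp
    assume y: "y \<in> lang A"
    show "less x y \<or> less y x" if "x \<noteq> y"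
      using that total h_mem[OF x] h_mem[OF y] h_eq[OF x y] less[OF x y] less[OF y x]
      unfolding total_on_def by auto
    assume z: "z \<in> lang A"
    show "less x z" if "less x y" "less y z"
      using that less[OF x y] less[OF y z] less[OF x z] trans antisym
      by (metis antisymD transD)
  next
    fix f :: "nat \<Rightarrow> nat tree" assume f: "\<And>n. f n \<in> lang A"
    show "\<not> (\<forall>n. less (f (Suc n)) (f n))"
    proof
      assume "\<forall>n. less (f (Suc n)) (f n)"
      then have "\<forall>n. (h (f (Suc n)), h (f n)) \<in> \<alpha> - Id" using less f by auto
      then have "\<exists>c. \<forall>n. (c (Suc n), c n) \<in> \<alpha> - Id" by (rule exI[of _ "\<lambda>n. h (f n)"])
      then show False using wf unfolding wf_iff_no_infinite_down_chain by blast
    qed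
  qed (simp_all add: A B less_def)
  have W': "Well_order cnf_order" by (rule Well_order_rank_order) simp
  have "\<not> \<alpha> <o cnf_order" using not_less cnf_order_iso ordLess_ordIso_trans by blast
  then have "cnf_order \<le>o \<alpha>" using not_ordLess_iff_ordLeq[OF W' W] by simp
  then obtain e where e: "embed cnf_order \<alpha> e" unfolding ordLeq_def by blast
  have e_mem: "e z \<in> Field \<alpha>" for z using embed_in_Field[OF e, of z] by simp
  have e_less: "(e z, e z') \<in> \<alpha> \<and> e z \<noteq> e z'" if "z < z'" for z z'
  proof -
    have "(z, z') \<in> cnf_order" using that by (simp add: rank_order_def)
    then have "(e z, e z') \<in> \<alpha>" using embed_compat[OF e] unfolding compat_def by blast
    moreover have "e z \<noteq> e z'" using inj_onD[OF embed_inj_on[OF W' e], of z z'] that by auto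
    ultimately show ?thesis by blast
  qed
  have e_initial: "y \<in> range e" if "(y, e z) \<in> \<alpha>" for y z
  proof -
    have "wo_rel.ofilter \<alpha> (e ` Field cnf_order)" by (rule embed_Field_ofilter[OF W' W e])
    then have "under \<alpha> (e z) \<subseteq> range e"
      using W by (simp add: wo_rel.ofilter_def wo_rel_def)
    with that show ?thesis by (auto simp: under_def)
  qed
  define g where "g z = inv_into (lang A) h (e z)" for z
  have hg: "h (g z) = e z" for z
    unfolding g_def using e_mem h by (simp add: bij_betw_def f_inv_into_f)
  have g_mem: "g z \<in> lang A" for z
    unfolding g_def using e_mem h by (simp add: bij_betw_def inv_into_into)
  show False
  proof (rule no_cofinal_segments[of g])
    show "g z \<in> lang A" for z by (rule g_mem)
    show "less (g z) (g z')" if "z < z'" for z z'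
      using e_less[OF that] less[OF g_mem g_mem] by (simp add: hg)
    fix z y assume y: "y \<in> lang A" "less y (g z)"
    then have "(h y, e z) \<in> \<alpha>" using less[OF y(1) g_mem] by (simp add: hg)
    then obtain z' where "h y = e z'" using e_initial by blast
    then have "y = g z'" using h_eq[OF y(1) g_mem[of z']] by (simp add: hg)
    then show "y \<in> range g" by blast
  qed
qed

theorem theorem3p1:
  fixes \<alpha> :: "'a rel"
  assumes "Well_order \<alpha>"
  shows "inj_omega_tree_automatic_ordinal \<alpha> \<longleftrightarrow> \<alpha> <o \<omega> ^o (\<omega> ^o \<omega>)"
  using below_if_automatic[OF assms] automatic_if_below by blast

end
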